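(* The functions $u(\tau)$ and $w(\tau)$ each generate the field $A_0(\Gamma_0(18))$ of all modular functions on $\Gamma_0(18)$; that is, $A_0(\Gamma_0(18))=\mathbb{C}(u(\tau))$ and $A_0(\Gamma_0(18))=\mathbb{C}(w(\tau))$.
   Context: $\mathbb{H}$ is the complex upper half-plane, $q=e^{2\pi i\tau}$ for $\tau\in\mathbb{H}$, $q^r=e^{2\pi i r\tau}$ for rational $r$, and $\eta(\tau)=q^{1/24}\prod_{n=1}^\infty(1-q^n)$ is the Dedekind eta function. Define $$X(\tau)=\dfrac{\eta(\tau)\eta^2(6\tau)}{\eta^2(2\tau)\eta(3\tau)},\qquad w(\tau):=X(\tau)X(3\tau),\qquad u(\tau):=\dfrac{\eta(3\tau)\eta^3(18\tau)}{\eta(6\tau)\eta^3(9\tau)}.$$ $\Gamma_0(N)$ is the group of matrices $\begin{bmatrix}a&b\\c&d\end{bmatrix}\in\mathrm{SL}_2(\mathbb{Z})$ with $c\equiv 0\pmod N$, acting by linear fractional transformations. A modular function on $\Gamma_0(N)$ is a complex-valued function $f$ that is meromorphic on $\mathbb{H}$, satisfies $f(\gamma\tau)=f(\tau)$ for all $\gamma\in\Gamma_0(N)$, and is meromorphic at all cusps (i.e. for every $r\in\mathbb{Q}\cup\{\infty\}$ and $\gamma\in\mathrm{SL}_2(\mathbb{Z})$ with $\gamma(r)=\infty$, $f\circ\gamma^{-1}$ has an expansion $\sum_{n\ge n_0}a_nq^{n/h}$ for some integers $n_0$ and $h\geq 1$). $A_0(\Gamma_0(N))$ denotes the field of all modular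 functions on $\Gamma_0(N)$. *)

theory Defs
  imports "HOL-Complex_Analysis.Complex_Analysis" "HOL-Number_Theory.Cong"
begin

definition upper_half_plane :: "complex set" where
  "upper_half_plane = {\<tau>. Im \<tau> > 0}"

text \<open>The power \<open>q\<^sup>r\<close> of \<open>q = exp (2 \<pi> \<i> \<tau>)\<close>, with the branch fixed by \<open>\<tau>\<close>.\<close>

definition qpow :: "rat \<Rightarrow> complex \<Rightarrow> complex" where
  "qpow r \<tau> = exp (2 * of_real pi * \<i> * of_rat r * \<tau>)"

text \<open>The index of \<^const>\<open>prodinf\<close> starts at 0, hence the shift.\<close>

definition dedekind_eta :: "complex \<Rightarrow> complex" where
  "dedekind_eta \<tau> = qpow (1 / 24) \<tau> * (\<Prod>n. 1 - qpow 1 \<tau> ^ (n + 1))"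

definition X_fun :: "complex \<Rightarrow> complex" where
  "X_fun \<tau> = (dedekind_eta \<tau> * dedekind_eta (6 * \<tau>) ^ 2) /
             (dedekind_eta (2 * \<tau>) ^ 2 * dedekind_eta (3 * \<tau>))"

definition w_fun :: "complex \<Rightarrow> complex" where
  "w_fun \<tau> = X_fun \<tau> * X_fun (3 * \<tau>)"

definition u_fun :: "complex \<Rightarrow> complex" where
  "u_fun \<tau> = (dedekind_eta (3 * \<tau>) * dedekind_eta (18 * \<tau>) ^ 3) /
             (dedekind_eta (6 * \<tau>) * dedekind_eta (9 * \<tau>) ^ 3)"

definition SL2Z :: "(int ^ 2 ^ 2) set" where
  "SL2Z = {A. det A = 1}"

definition Gamma0 :: "nat \<Rightarrow> (int ^ 2 ^ 2) set" where
  "Gamma0 N = {A \<in> SL2Z. [A $ 2 $ 1 = 0] (mod int N)}"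

definition moebius :: "int ^ 2 ^ 2 \<Rightarrow> complex \<Rightarrow> complex" where
  "moebius A \<tau> = (of_int (A $ 1 $ 1) * \<tau> + of_int (A $ 1 $ 2)) /
                 (of_int (A $ 2 $ 1) * \<tau> + of_int (A $ 2 $ 2))"

text \<open>The same action on the cusps \<open>\<rat> \<union> {\<infinity>}\<close>, with \<^const>\<open>None\<close> in the role of \<open>\<infinity>\<close>.\<close>

fun moebius_cusp :: "int ^ 2 ^ 2 \<Rightarrow> rat option \<Rightarrow> rat option" where
  "moebius_cusp A None =
     (if A $ 2 $ 1 = 0 then None else Some (of_int (A $ 1 $ 1) / of_int (A $ 2 $ 1)))"
| "moebius_cusp A (Some r) =
     (if of_int (A $ 2 $ 1) * r + of_int (A $ 2 $ 2) = 0 then None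
      else Some ((of_int (A $ 1 $ 1) * r + of_int (A $ 1 $ 2)) /
                 (of_int (A $ 2 $ 1) * r + of_int (A $ 2 $ 2))))"

text \<open>
  The function may have poles in the upper half-plane, so the expansion is only
  required to hold when the imaginary part of \<open>\<tau>\<close> is sufficiently large.
\<close>

definition has_q_expansion :: "(complex \<Rightarrow> complex) \<Rightarrow> bool" where
  "has_q_expansion g \<longleftrightarrow>
     (\<exists>(n\<^sub>0 :: int) (h :: nat) (a :: int \<Rightarrow> complex) (Y :: real). h \<ge> 1 \<and> Y > 0 \<and>
        (\<forall>\<tau>. Im \<tau> > Y \<longrightarrow>
           ((\<lambda>n. a n * qpow (of_int n / of_nat h) \<tau>) has_sum g \<tau>) {n\<^sub>0..}))"

definition meromorphic_at_cusps :: "(complex \<Rightarrow> complex) \<Rightarrow> bool" where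
  "meromorphic_at_cusps f \<longleftrightarrow>
     (\<forall>(r :: rat option) \<gamma>. \<gamma> \<in> SL2Z \<longrightarrow> moebius_cusp \<gamma> r = None \<longrightarrow>
        has_q_expansion (f \<circ> moebius (matrix_inv \<gamma>)))"

text \<open>
  Functions that are nicely meromorphic have all removable singularities removed and take
  the conventional value 0 at their poles, so on the upper half-plane each meromorphic
  function has exactly one such representative, and invariance can be stated pointwise
  everywhere. Values outside the upper half-plane are irrelevant and left arbitrary.
\<close>

definition modular_functions :: "nat \<Rightarrow> (complex \<Rightarrow> complex) set" where
  "modular_functions N =
     {f. f nicely_meromorphic_on upper_half_plane \<and>
         (\<forall>\<gamma>\<in>Gamma0 N. \<forall>\<tau>\<in>upper_half_plane. f (moebius \<gamma> \<tau>) = f \<tau>) \<and>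
         meromorphic_at_cusps f}"

text \<open>
  The field \<open>\<complex>(g)\<close>: the meromorphic functions on the upper half-plane of the form
  \<open>p(g) / q(g)\<close> with polynomials \<open>p\<close>, \<open>q\<close> such that \<open>q(g)\<close> is not identically zero.
  Equality of meromorphic functions and nonvanishing of the meromorphic function
  \<open>q(g)\<close> are expressed away from a set of isolated points, namely poles of \<open>g\<close>
  and zeros of \<open>q(g)\<close>.
\<close>

definition rational_functions_in :: "(complex \<Rightarrow> complex) \<Rightarrow> (complex \<Rightarrow> complex) set" where
  "rational_functions_in g =
     {f. f nicely_meromorphic_on upper_half_plane \<and>
         (\<exists>(p :: complex poly) (q :: complex poly).
            \<forall>\<^sub>\<approx>\<tau>\<in>upper_half_plane.
              poly q (g \<tau>) \<noteq> 0 \<and> f \<tau> = poly p (g \<tau>) / poly q (g \<tau>))}"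

end

theory Submission
  imports Defs
begin

text \<open>
  Write \<open>t\<close> for \<open>1/w\<close> or \<open>1/u\<close>. Both functions are holomorphic on the upper half-plane and
  invariant under \<open>\<Gamma>\<^sub>0(18)\<close>, they have a simple pole at the cusp \<open>\<infinity>\<close>, and they are bounded at every
  cusp that is not equivalent to \<open>\<infinity>\<close>. These properties alone make \<open>t\<close> a generator (the locale
  \<open>hauptmodul\<close>). Given a modular function \<open>f\<close>, some nonzero polynomial \<open>p\<close> makes \<open>f p(t)\<close>
  holomorphic on the half-plane and bounded at all cusps not equivalent to \<open>\<infinity>\<close>: a pole \<open>z\<close> is
  cancelled by a power of \<open>t - t(z)\<close>, and compactness of a truncated fundamental domain leaves
  only finitely many poles to treat (\<open>clear_poles\<close>). The pole of \<open>f p(t)\<close> at \<open>\<infinity>\<close> is then removed by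
  subtracting a polynomial in \<open>t\<close>, since \<open>t\<close> starts with \<open>1/q\<close>. What remains is bounded everywhere,
  hence constant (\<open>Gamma0_vanishing\<close>): once the value at \<open>\<infinity>\<close> is subtracted, the product of its
  finitely many conjugates under \<open>SL\<^sub>2(\<int>)\<close> has level one and tends to \<open>0\<close> at \<open>\<infinity>\<close>, so its modulus
  attains its maximum in the fundamental strip.

  The analytic input about \<open>\<eta>\<close> is the inversion law up to modulus,
  \<open>|\<eta>(-1/\<tau>)|\<^sup>2 = |\<tau>| |\<eta>(\<tau>)|\<^sup>2\<close> (\<open>norm_eta_inversion\<close>). It comes from the inversion of a theta function
  given as a product, where Liouville's theorem determines everything up to one factor, and that
  factor is found by evaluation at the three points of order two. Euclid's algorithm then expresses
  \<open>|\<eta>(\<delta> \<gamma>\<tau>)|\<close> through \<open>|\<eta>((g \<tau> + B)/D)|\<close> with \<open>g = gcd(\<delta>, c)\<close> and \<open>g D = \<delta>\<close>, where \<open>c\<close> is the lower left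
  entry of \<open>\<gamma>\<close>; this gives the order of \<open>w\<close> at every cusp, and shows that \<open>u\<close> and \<open>w\<close> are multiplied
  by constants of modulus one under \<open>\<Gamma>\<^sub>0(18)\<close>.

  That these constants are \<open>1\<close> follows without computing any multiplier system. The Jacobi triple
  product turns the splitting of \<open>\<Sum> q\<^bsup>n(n+1)/2\<^esup>\<close> modulo \<open>3\<close> into the identity \<open>1/u = 1/w - 1\<close>
  (\<open>inverse_u_w\<close>). If \<open>w\<close> is multiplied by \<open>c\<close> and \<open>u\<close> by \<open>d\<close>, then \<open>(1/w - 1)/d = 1/(c w) - 1\<close>, and as
  \<open>w\<close> is not constant this forces \<open>c = d = 1\<close>. The same identity transfers the behaviour at the cusps
  from \<open>w\<close> to \<open>u\<close>.
\<close>

section \<open>Infinite q-products and the eta function\<close>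

definition qpoch :: "complex \<Rightarrow> complex \<Rightarrow> complex" where
  "qpoch a q = (\<Prod>n. 1 - a * q ^ n)"

lemma abs_convergent_qpoch:
  assumes "norm q < 1"
  shows "abs_convergent_prod (\<lambda>n. 1 - a * q ^ n :: complex)"
  using assms by (auto simp: abs_convergent_prod_conv_summable norm_mult norm_power
      intro!: summable_mult summable_geometric)

lemma convergent_qpoch:
  assumes "norm q < 1"
  shows "convergent_prod (\<lambda>n. 1 - a * q ^ n :: complex)"
  by (rule abs_convergent_prod_imp_convergent_prod[OF abs_convergent_qpoch[OF assms]])

lemma qpoch_eq_0_iff:
  assumes "norm q < 1"
  shows "qpoch a q = 0 \<longleftrightarrow> (\<exists>n. a * q ^ n = 1)"
proof
  assume "\<exists>n. a * q ^ n = 1"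
  then obtain n where n: "a * q ^ n = 1" by auto
  have "(\<lambda>n. 1 - a * q ^ n) has_prod qpoch a q"
    unfolding qpoch_def by (rule convergent_prod_has_prod[OF convergent_qpoch[OF assms]])
  hence "qpoch a q = 0 \<longleftrightarrow> 0 \<in> range (\<lambda>n. 1 - a * q ^ n)"
    by (rule has_prod_eq_0_iff)
  moreover have "1 - a * q ^ n = 0" using n by simp
  ultimately show "qpoch a q = 0" by (metis rangeI)
next
  assume "qpoch a q = 0"
  show "\<exists>n. a * q ^ n = 1"
  proof (rule ccontr)
    assume "\<not> ?thesis"
    hence "\<And>n. 1 - a * q ^ n \<noteq> 0" by (metis right_minus_eq)
    from prodinf_nonzero[OF convergent_qpoch[OF assms] this] \<open>qpoch a q = 0\<close>
    show False by (simp add: qpoch_def)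
  qed
qed

lemma qpoch_LIMSEQ:
  assumes "norm q < 1"
  shows "(\<lambda>N. \<Prod>n<N. 1 - a * q ^ n) \<longlonglongrightarrow> qpoch a q"
  unfolding qpoch_def
  using convergent_prod_LIMSEQ[OF convergent_qpoch[OF assms]]
  by (subst LIMSEQ_lessThan_iff_atMost) simp

lemma qpoch_rec:
  assumes "norm q < 1"
  shows "qpoch a q = (1 - a) * qpoch (a * q) q"
proof -
  have "(\<lambda>N. \<Prod>n<Suc N. 1 - a * q ^ n) \<longlonglongrightarrow> qpoch a q"
    using qpoch_LIMSEQ[OF assms] by (rule LIMSEQ_Suc)
  moreover have "(\<lambda>N. \<Prod>n<Suc N. 1 - a * q ^ n) = (\<lambda>N. (1 - a) * (\<Prod>n<N. 1 - (a * q) * q ^ n))"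
    by (simp only: prod.lessThan_Suc_shift) (simp add: mult_ac)
  moreover have "(\<lambda>N. (1 - a) * (\<Prod>n<N. 1 - (a * q) * q ^ n)) \<longlonglongrightarrow> (1 - a) * qpoch (a * q) q"
    by (intro tendsto_intros qpoch_LIMSEQ assms)
  ultimately show ?thesis using LIMSEQ_unique by fastforce
qed

lemma qpoch_mult_minus:
  assumes "norm q < 1"
  shows "qpoch a q * qpoch (-a) q = qpoch (a\<^sup>2) (q\<^sup>2)"
proof -
  have q2: "norm (q\<^sup>2) < 1" using assms by (simp add: norm_power power_less_one_iff)
  have "(\<lambda>N. (\<Prod>n<N. 1 - a * q ^ n) * (\<Prod>n<N. 1 - (-a) * q ^ n)) \<longlonglongrightarrow> qpoch a q * qpoch (-a) q"
    by (intro tendsto_intros qpoch_LIMSEQ assms)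
  moreover have "(\<Prod>n<N. 1 - a * q ^ n) * (\<Prod>n<N. 1 - (-a) * q ^ n) = (\<Prod>n<N. 1 - a\<^sup>2 * (q\<^sup>2) ^ n)" for N
    by (subst prod.distrib [symmetric], intro prod.cong)
       (auto simp: algebra_simps power2_eq_square power_mult_distrib)
  ultimately show ?thesis using LIMSEQ_unique[OF _ qpoch_LIMSEQ[OF q2]] by simp
qed

text \<open>
  The factors of the product are sorted by the residue of their index modulo \<open>m\<close>.
\<close>

lemma qpoch_dissect:
  assumes "norm q < 1" "m > 0"
  shows "(\<Prod>j<m. qpoch (a * q ^ j) (q ^ m)) = qpoch a q"
proof -
  have qm: "norm (q ^ m) < 1" using assms by (simp add: norm_power power_less_one_iff)
  have 1: "(\<lambda>N. \<Prod>j<m. \<Prod>n<N. 1 - a * q ^ j * (q ^ m) ^ n) \<longlonglongrightarrow> (\<Prod>j<m. qpoch (a * q ^ j) (q ^ m))"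
    by (intro tendsto_intros qpoch_LIMSEQ qm)
  have "(\<Prod>j<m. \<Prod>n<N. 1 - a * q ^ j * (q ^ m) ^ n) = (\<Prod>k<N*m. 1 - a * q ^ k)" for N
  proof -
    have "(\<Prod>k<N*m. 1 - a * q ^ k) = (\<Prod>n<N. \<Prod>k\<in>{n*m..<n*m+m}. 1 - a * q ^ k)"
      by (rule prod.nat_group [symmetric])
    also have "\<dots> = (\<Prod>n<N. \<Prod>j<m. 1 - a * q ^ j * (q ^ m) ^ n)"
    proof (rule prod.cong[OF refl])
      fix n
      have "(\<Prod>k\<in>{n*m..<n*m+m}. 1 - a * q ^ k) = (\<Prod>k\<in>{0+n*m..<m+n*m}. 1 - a * q ^ k)"
        by (simp add: add.commute)
      also have "\<dots> = (\<Prod>j\<in>{0..<m}. 1 - a * q ^ (j + n * m))"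
        by (rule prod.shift_bounds_nat_ivl)
      finally show "(\<Prod>k\<in>{n*m..<n*m+m}. 1 - a * q ^ k) = (\<Prod>j<m. 1 - a * q ^ j * (q ^ m) ^ n)"
        by (simp add: power_add power_mult [symmetric] mult_ac atLeast0LessThan)
    qed
    also have "\<dots> = (\<Prod>j<m. \<Prod>n<N. 1 - a * q ^ j * (q ^ m) ^ n)" by (rule prod.swap)
    finally show ?thesis ..
  qed
  moreover have "(\<lambda>N. \<Prod>k<N*m. 1 - a * q ^ k) \<longlonglongrightarrow> qpoch a q"
  proof -
    have "filterlim (\<lambda>N. N * m) at_top sequentially"
      using assms(2) by (auto intro!: filterlim_subseq simp: strict_mono_def)
    from filterlim_compose[OF qpoch_LIMSEQ[OF assms(1)] this] show ?thesis by simp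
  qed
  ultimately show ?thesis using LIMSEQ_unique[OF 1] by simp
qed

text \<open>
  Both arguments may vary: for theta functions the first one is a function of \<open>z\<close> and the second is
  fixed, for the eta function both are equal to \<open>q\<close>.
\<close>

lemma holomorphic_qpoch:
  assumes "open S" "g holomorphic_on S" "k holomorphic_on S" "\<And>z. z \<in> S \<Longrightarrow> norm (k z) < 1"
  shows "(\<lambda>z. qpoch (g z) (k z)) holomorphic_on S"
proof (rule holomorphic_uniform_sequence[OF assms(1), where f = "\<lambda>N z. \<Prod>n<N. 1 - g z * k z ^ n"])
  show "(\<lambda>z. \<Prod>n<N. 1 - g z * k z ^ n) holomorphic_on S" for N
    by (intro holomorphic_intros assms)
  fix x assume "x \<in> S"
  with \<open>open S\<close> obtain d where d: "d > 0" "cball x d \<subseteq> S" by (meson open_contains_cball)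
  have cg: "continuous_on (cball x d) g" and ck: "continuous_on (cball x d) k"
    using assms d by (meson holomorphic_on_imp_continuous_on continuous_on_subset)+
  have ne: "cball x d \<noteq> {}" using d by auto
  obtain y where y: "y \<in> cball x d" "\<And>z. z \<in> cball x d \<Longrightarrow> norm (k z) \<le> norm (k y)"
    using continuous_attains_sup[OF compact_cball ne continuous_on_norm[OF ck]] by blast
  obtain y' where y': "y' \<in> cball x d" "\<And>z. z \<in> cball x d \<Longrightarrow> norm (g z) \<le> norm (g y')"
    using continuous_attains_sup[OF compact_cball ne continuous_on_norm[OF cg]] by blast
  define r where "r = norm (k y)"
  have r: "0 \<le> r" "r < 1" using y d assms(4) by (auto simp: r_def)
  have "uniformly_convergent_on (cball x d) (\<lambda>N z. \<Prod>n<N. 1 - g z * k z ^ n)"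
  proof (rule uniformly_convergent_on_prod')
    show "continuous_on (cball x d) (\<lambda>z. 1 - g z * k z ^ n)" for n
      by (intro continuous_intros cg ck)
    show "uniformly_convergent_on (cball x d) (\<lambda>N z. \<Sum>n<N. norm (1 - g z * k z ^ n - 1))"
    proof (rule Weierstrass_m_test')
      show "summable (\<lambda>n. norm (g y') * r ^ n)"
        using r by (intro summable_mult summable_geometric) auto
      fix n z assume "z \<in> cball x d"
      thus "norm (norm (1 - g z * k z ^ n - 1)) \<le> norm (g y') * r ^ n"
        using y y' by (auto simp: norm_mult norm_power r_def intro!: mult_mono power_mono)
    qed
  qed auto
  then obtain l where l: "uniform_limit (cball x d) (\<lambda>N z. \<Prod>n<N. 1 - g z * k z ^ n) l sequentially"
    by (auto simp: uniformly_convergent_on_def)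
  have "uniform_limit (cball x d) (\<lambda>N z. \<Prod>n<N. 1 - g z * k z ^ n) (\<lambda>z. qpoch (g z) (k z)) sequentially"
  proof (rule uniform_limit_cong'[THEN iffD1, OF _ _ l])
    fix z assume z: "z \<in> cball x d"
    show "l z = qpoch (g z) (k z)"
      using tendsto_uniform_limitI[OF l z] qpoch_LIMSEQ[of "k z" "g z"] z d assms(4) LIMSEQ_unique
      by blast
  qed auto
  thus "\<exists>d>0. cball x d \<subseteq> S \<and> uniform_limit (cball x d)
           (\<lambda>n z. \<Prod>i<n. 1 - g z * k z ^ i) (\<lambda>z. qpoch (g z) (k z)) sequentially"
    using d by blast
qed

text \<open>
  The Euler function \<open>(q; q)\<^sub>\<infinity>\<close>, the part of \<open>\<eta>\<close> without the factor \<open>q\<^bsup>1/24\<^esup>\<close>.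
\<close>

definition euler :: "complex \<Rightarrow> complex" where "euler q = qpoch q q"

lemma euler_nonzero: assumes "norm q < 1" shows "euler q \<noteq> 0"
proof
  assume "euler q = 0"
  then obtain n where "q ^ Suc n = 1" using qpoch_eq_0_iff[OF assms] by (auto simp: euler_def)
  hence "norm q ^ Suc n = 1" by (metis norm_one norm_power)
  moreover have "norm q ^ Suc n \<le> norm q ^ 1"
    using assms by (intro power_decreasing) auto
  ultimately show False using assms by simp
qed

lemma holomorphic_euler: "euler holomorphic_on ball 0 1"
  unfolding euler_def by (intro holomorphic_qpoch holomorphic_intros) auto

lemma euler_0 [simp]: "euler 0 = 1"
  by (simp add: euler_def qpoch_def)

lemma qpow_power: "qpow r \<tau> ^ n = qpow (of_nat n * r) \<tau>"
  by (simp add: qpow_def exp_of_nat_mult [symmetric] of_rat_mult algebra_simps)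

lemma qpow_scale: "qpow r (of_nat n * \<tau>) = qpow (r * of_nat n) \<tau>"
  by (simp add: qpow_def of_rat_mult algebra_simps)

lemma qpow_nonzero [simp]: "qpow r \<tau> \<noteq> 0" by (simp add: qpow_def)

lemma norm_qpow: "norm (qpow r \<tau>) = exp (- 2 * pi * of_rat r * Im \<tau>)"
proof -
  have "of_rat r = complex_of_real (of_rat r)"
    by (cases r) (simp add: of_rat_rat)
  thus ?thesis unfolding qpow_def norm_exp_eq_Re by simp
qed

lemma norm_qpow_less_1: "Im \<tau> > 0 \<Longrightarrow> norm (qpow 1 \<tau>) < 1"
  by (simp add: norm_qpow)

lemma eta_eq: "dedekind_eta \<tau> = qpow (1/24) \<tau> * euler (qpow 1 \<tau>)"
  by (simp add: dedekind_eta_def euler_def qpoch_def)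

lemma eta_nonzero: "Im \<tau> > 0 \<Longrightarrow> dedekind_eta \<tau> \<noteq> 0"
  by (simp add: eta_eq euler_nonzero norm_qpow_less_1)

lemma holomorphic_qpow [holomorphic_intros]:
  "g holomorphic_on S \<Longrightarrow> (\<lambda>z. qpow r (g z)) holomorphic_on S"
  unfolding qpow_def by (intro holomorphic_intros)

lemma holomorphic_eta: "dedekind_eta holomorphic_on {\<tau>. Im \<tau> > 0}"
  unfolding eta_eq
  by (intro holomorphic_intros holomorphic_on_compose_gen[OF _ holomorphic_euler, unfolded o_def])
     (auto simp: norm_qpow_less_1)

section \<open>Inversion of the eta function\<close>

abbreviation e2pi :: "complex \<Rightarrow> complex" where "e2pi z \<equiv> exp (2 * of_real pi * \<i> * z)"

lemma qpow_1: "qpow 1 z = e2pi z" by (simp add: qpow_def)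

lemma e2pi_eq_1_iff: "e2pi z = 1 \<longleftrightarrow> z \<in> \<int>"
proof
  assume "e2pi z = 1"
  then obtain n :: int where n: "Im (2 * of_real pi * \<i> * z) = of_int (2 * n) * pi" "Re (2 * of_real pi * \<i> * z) = 0"
    by (auto simp: exp_eq_1)
  hence "Re z = of_int n" "Im z = 0" by auto
  hence "z = of_int n" by (simp add: complex_eq_iff)
  thus "z \<in> \<int>" by simp
next
  assume "z \<in> \<int>"
  then obtain n where "z = of_int n" by (auto elim: Ints_cases)
  thus "e2pi z = 1" using exp_integer_2pi[of "of_int n"] by (simp add: mult_ac)
qed

lemma lattice_periodic:
  fixes f :: "complex \<Rightarrow> 'a"
  assumes "\<And>z. f (z + 1) = f z" and "\<And>z. f (z + \<tau>) = f z"
  shows "f (z + of_int m + of_int n * \<tau>) = f z"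
proof -
  have iterate: "f (z + of_int k * \<omega>) = f z" if per: "\<And>z. f (z + \<omega>) = f z" for z \<omega> and k :: int
  proof (induction k rule: int_induct[where k = 0])
    case (step1 i) thus ?case using per[of "z + of_int i * \<omega>"] by (simp add: algebra_simps)
  next
    case (step2 i) thus ?case using per[of "z + of_int (i - 1) * \<omega>"] by (simp add: algebra_simps)
  qed auto
  show ?thesis
    using iterate[of 1 z m, OF assms(1)] iterate[of \<tau> "z + of_int m" n, OF assms(2)] by simp
qed

text \<open>
  Every value is taken in the compact period parallelogram, so Liouville's theorem applies.
\<close>

lemma elliptic_entire_constant:
  assumes hol: "f holomorphic_on UNIV" and \<tau>: "Im \<tau> \<noteq> 0"
    and per1: "\<And>z. f (z + 1) = f z" and per2: "\<And>z. f (z + \<tau>) = f z"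
  shows "f z = f w"
proof -
  define g where "g = (\<lambda>(s, t). of_real s + of_real t * \<tau> :: complex)"
  define K where "K = g ` ({0..1} \<times> {0..1})"
  have "continuous_on ({0..1} \<times> {0..1}) g"
    unfolding g_def case_prod_unfold by (intro continuous_intros)
  hence "compact K" unfolding K_def by (intro compact_continuous_image compact_Times compact_Icc)
  moreover have "continuous_on K f"
    using hol by (meson holomorphic_on_imp_continuous_on continuous_on_subset subset_UNIV)
  ultimately have "bounded (f ` K)" by (intro compact_imp_bounded compact_continuous_image)
  moreover have "range f \<subseteq> f ` K"
  proof safe
    fix z
    define t where "t = Im z / Im \<tau>"
    define s where "s = Re z - t * Re \<tau>"
    have z: "z = g (s, t)" using \<tau> by (simp add: g_def s_def t_def complex_eq_iff)
    have "g (frac s, frac t) = z + of_int (- \<lfloor>s\<rfloor>) + of_int (- \<lfloor>t\<rfloor>) * \<tau>"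
      by (simp add: z g_def frac_def algebra_simps)
    hence "f (g (frac s, frac t)) = f z" by (simp only: lattice_periodic[OF per1 per2])
    moreover have "g (frac s, frac t) \<in> K"
      unfolding K_def by (intro imageI) (auto simp: frac_lt_1 less_imp_le)
    ultimately show "f z \<in> f ` K" by (metis imageI)
  qed
  ultimately have "bounded (range f)" by (rule bounded_subset)
  from Liouville_theorem[OF hol this] show ?thesis by (auto simp: constant_on_def)
qed

text \<open>
  The function \<open>\<theta>\<^sub>1(z)\<close> without its factor \<open>\<i> q\<^bsup>1/8\<^esup> (q; q)\<^sub>\<infinity>\<close>, written so that a shift of \<open>z\<close> by
  \<open>\<tau>\<close> moves one factor from one product to the other.
\<close>

definition theta :: "complex \<Rightarrow> complex \<Rightarrow> complex" where
  "theta \<tau> z = exp (- (of_real pi * \<i> * z)) * qpoch (e2pi z) (e2pi \<tau>) * qpoch (e2pi (\<tau> - z)) (e2pi \<tau>)"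

context
  fixes \<tau> :: complex assumes \<tau>: "Im \<tau> > 0"
begin

text \<open>
  In this form the symmetry \<open>z \<mapsto> -z\<close> and the behaviour near the simple zero at \<open>0\<close> are visible; the
  definition shows the location of all zeros.
\<close>

lemma theta_altdef:
  "theta \<tau> z = (exp (- (of_real pi * \<i> * z)) - exp (of_real pi * \<i> * z)) * 
     qpoch (e2pi (\<tau> + z)) (e2pi \<tau>) * qpoch (e2pi (\<tau> - z)) (e2pi \<tau>)"
proof -
  have "e2pi z = exp (of_real pi * \<i> * z) * exp (of_real pi * \<i> * z)"
    by (simp add: exp_add [symmetric] algebra_simps)
  hence "exp (- (of_real pi * \<i> * z)) * (1 - e2pi z) = exp (- (of_real pi * \<i> * z)) - exp (of_real pi * \<i> * z)"
    by (simp add: exp_minus field_simps)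
  moreover have "qpoch (e2pi z) (e2pi \<tau>) = (1 - e2pi z) * qpoch (e2pi (\<tau> + z)) (e2pi \<tau>)"
    by (subst qpoch_rec) (simp_all add: \<tau> exp_add [symmetric] algebra_simps)
  ultimately show ?thesis by (simp add: theta_def mult_ac)
qed

lemma theta_minus: "theta \<tau> (-z) = - theta \<tau> z"
  unfolding theta_altdef by (simp add: algebra_simps)

lemma theta_plus_1: "theta \<tau> (z + 1) = - theta \<tau> z"
proof -
  have e: "e2pi (z + 1) = e2pi z" 
    using e2pi_eq_1_iff[of 1] by (simp add: ring_distribs exp_add)
  have "e2pi (\<tau> - (z + 1)) = e2pi (\<tau> - z)"
    using e2pi_eq_1_iff[of "-1"] by (simp add: ring_distribs exp_diff exp_add)
  moreover have "exp (- (of_real pi * \<i> * (z + 1))) = - exp (- (of_real pi * \<i> * z))"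
    by (simp add: ring_distribs exp_diff exp_add exp_minus)
  ultimately show ?thesis using e by (simp add: theta_def)
qed

lemma theta_plus_tau: "theta \<tau> (z + \<tau>) = - exp (- (of_real pi * \<i> * \<tau>)) * e2pi (-z) * theta \<tau> z"
proof -
  define A where "A = qpoch (e2pi (\<tau> + z)) (e2pi \<tau>)"
  define B where "B = qpoch (e2pi (\<tau> - z)) (e2pi \<tau>)"
  have B': "qpoch (e2pi (-z)) (e2pi \<tau>) = (1 - e2pi (-z)) * B" unfolding B_def
    by (subst qpoch_rec) (simp_all add: \<tau> exp_add [symmetric] algebra_simps)
  have "theta \<tau> (z + \<tau>) = exp (- (of_real pi * \<i> * (z + \<tau>))) * A * ((1 - e2pi (-z)) * B)"
    unfolding B' [symmetric] by (simp add: theta_def A_def B_def add_ac)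
  moreover have "theta \<tau> z = (exp (- (of_real pi * \<i> * z)) - exp (of_real pi * \<i> * z)) * A * B"
    by (simp add: theta_altdef A_def B_def)
  moreover have "exp (- (of_real pi * \<i> * (z + \<tau>))) * (1 - e2pi (-z)) =
      - exp (- (of_real pi * \<i> * \<tau>)) * e2pi (-z) * (exp (- (of_real pi * \<i> * z)) - exp (of_real pi * \<i> * z))"
    by (simp add: algebra_simps exp_add [symmetric])
  ultimately show ?thesis by (simp add: mult_ac)
qed

lemma holomorphic_theta: "theta \<tau> holomorphic_on S"
proof (rule holomorphic_on_subset)
  show "theta \<tau> holomorphic_on UNIV"
    unfolding theta_def by (intro holomorphic_intros holomorphic_qpoch) (auto simp: \<tau>)
qed auto

lemma theta_eq_0_imp:
  assumes "theta \<tau> z = 0"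
  obtains m n :: int where "z = of_int m + of_int n * \<tau>"
proof -
  have nq: "norm (e2pi \<tau>) < 1" by (simp add: \<tau>)
  from assms consider n where "e2pi z * e2pi \<tau> ^ n = 1" | n where "e2pi (\<tau> - z) * e2pi \<tau> ^ n = 1"
    unfolding theta_def using qpoch_eq_0_iff[OF nq] by auto
  thus ?thesis
  proof cases
    case (1 n)
    hence "e2pi (z + of_nat n * \<tau>) = 1"
      by (simp add: exp_add ring_distribs exp_of_nat_mult [symmetric] mult_ac)
    then obtain m where "z + of_nat n * \<tau> = of_int m" by (subst (asm) e2pi_eq_1_iff) (auto elim: Ints_cases)
    hence "z = of_int m + of_int (- int n) * \<tau>" by (simp add: algebra_simps)
    thus ?thesis by (rule that)
  next
    case (2 n)
    hence "e2pi (\<tau> - z + of_nat n * \<tau>) = 1"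
      by (simp add: exp_add ring_distribs exp_diff exp_of_nat_mult [symmetric] mult_ac)
    then obtain m where "\<tau> - z + of_nat n * \<tau> = of_int m" by (subst (asm) e2pi_eq_1_iff) (auto elim: Ints_cases)
    hence "z = of_int (- m) + of_int (int n + 1) * \<tau>" by (simp add: algebra_simps)
    thus ?thesis by (rule that)
  qed
qed

lemma theta_div_tendsto: 
  "((\<lambda>z. theta \<tau> z / z) \<longlongrightarrow> - 2 * of_real pi * \<i> * euler (e2pi \<tau>) ^ 2) (at 0)"
proof -
  define A where "A = (\<lambda>z. qpoch (e2pi (\<tau> + z)) (e2pi \<tau>) * qpoch (e2pi (\<tau> - z)) (e2pi \<tau>))"
  have "A holomorphic_on UNIV"
    unfolding A_def by (intro holomorphic_intros holomorphic_qpoch) (auto simp: \<tau>)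
  hence "isCont A 0" by (auto simp: holomorphic_on_imp_continuous_on continuous_on_eq_continuous_at dest!: holomorphic_on_imp_continuous_on)
  hence "A \<midarrow>0\<rightarrow> A 0" by (simp add: isCont_def)
  moreover have "((\<lambda>z. exp (- (of_real pi * \<i> * z)) - exp (of_real pi * \<i> * z)) has_field_derivative
     - 2 * of_real pi * \<i>) (at 0)"
    by (auto intro!: derivative_eq_intros)
  hence "((\<lambda>z. (exp (- (of_real pi * \<i> * z)) - exp (of_real pi * \<i> * z)) / z) \<longlongrightarrow> - 2 * of_real pi * \<i>) (at 0)"
    by (simp add: has_field_derivative_iff)
  ultimately have "((\<lambda>z. (exp (- (of_real pi * \<i> * z)) - exp (of_real pi * \<i> * z)) / z * A z) \<longlongrightarrow> - 2 * of_real pi * \<i> * A 0) (at 0)"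
    by (intro tendsto_intros)
  thus ?thesis by (simp add: A_def theta_altdef euler_def power2_eq_square mult.assoc)
qed

lemma norm_theta_half: "norm (theta \<tau> (1/2)) = 2 * norm (qpoch (- e2pi \<tau>) (e2pi \<tau>)) ^ 2"
proof -
  have "e2pi (1/2) = -1" by (simp add: exp_Euler [symmetric])
  moreover have "e2pi (\<tau> - 1/2) = - e2pi \<tau>"
    using \<open>e2pi (1/2) = -1\<close> by (simp add: ring_distribs exp_diff)
  moreover have "qpoch (-1) (e2pi \<tau>) = 2 * qpoch (- e2pi \<tau>) (e2pi \<tau>)"
    by (subst qpoch_rec) (simp_all add: \<tau>)
  ultimately show ?thesis unfolding theta_def by (simp add: norm_mult power2_eq_square)
qed

lemma norm_theta_half_tau:
  "norm (theta \<tau> (\<tau>/2)) = exp (pi * Im \<tau> / 2) * norm (qpoch (e2pi (\<tau>/2)) (e2pi \<tau>)) ^ 2"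
proof -
  have "\<tau> - \<tau> / 2 = \<tau> / 2" by simp
  thus ?thesis unfolding theta_def by (simp only: norm_mult) (simp add: power2_eq_square)
qed

lemma norm_theta_half_tau_plus_1:
  "norm (theta \<tau> ((1 + \<tau>)/2)) = exp (pi * Im \<tau> / 2) * norm (qpoch (- e2pi (\<tau>/2)) (e2pi \<tau>)) ^ 2"
proof -
  have h: "e2pi (1/2) = -1" by (simp add: exp_Euler [symmetric])
  have "\<tau> - (1 + \<tau>)/2 = \<tau>/2 - 1/2" by (simp add: field_simps)
  moreover have "e2pi ((1 + \<tau>) / 2) = - e2pi (\<tau>/2)"
    using h by (simp add: ring_distribs exp_add add_divide_distrib)
  moreover have "e2pi (\<tau> / 2 - 1/2) = - e2pi (\<tau>/2)"
    using h by (simp add: ring_distribs exp_diff)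
  ultimately have "theta \<tau> ((1 + \<tau>)/2) = exp (- (of_real pi * \<i> * ((1 + \<tau>)/2))) * qpoch (- e2pi (\<tau>/2)) (e2pi \<tau>) ^ 2"
    unfolding theta_def by (simp only: power2_eq_square mult.assoc)
  thus ?thesis by (simp add: norm_mult norm_power)
qed

text \<open>
  The three products are, up to powers of \<open>q\<close>, Weber's functions. Joining the last two gives
  \<open>(q; q\<^sup>2)\<^sub>\<infinity>\<close>, and \<open>(-q; q)\<^sub>\<infinity> (q; q\<^sup>2)\<^sub>\<infinity> = 1\<close> is Euler's identity.
\<close>

lemma weber_product:
  "qpoch (- e2pi \<tau>) (e2pi \<tau>) * qpoch (e2pi (\<tau>/2)) (e2pi \<tau>) * qpoch (- e2pi (\<tau>/2)) (e2pi \<tau>) = 1"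
proof -
  define q where "q = e2pi \<tau>"
  have q: "norm q < 1" by (simp add: q_def \<tau>)
  have "(e2pi (\<tau>/2))\<^sup>2 = q" by (simp add: q_def power2_eq_square mult_ac flip: exp_add)
  hence "qpoch (e2pi (\<tau>/2)) q * qpoch (- e2pi (\<tau>/2)) q = qpoch q (q\<^sup>2)"
    by (simp add: qpoch_mult_minus[OF q])
  moreover have "qpoch q q * qpoch (-q) q = qpoch (q\<^sup>2) (q\<^sup>2)"
    by (rule qpoch_mult_minus[OF q])
  moreover have "qpoch q (q\<^sup>2) * qpoch (q\<^sup>2) (q\<^sup>2) = qpoch q q"
    using qpoch_dissect[OF q, of 2 q] by (simp add: numeral_2_eq_2 power2_eq_square)
  ultimately have "(qpoch q q * qpoch (-q) q) * (qpoch (e2pi (\<tau>/2)) q * qpoch (- e2pi (\<tau>/2)) q) = qpoch q q"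
    by (simp only: mult.commute)
  hence "euler q * (qpoch (-q) q * qpoch (e2pi (\<tau>/2)) q * qpoch (- e2pi (\<tau>/2)) q) = euler q * 1"
    by (simp only: euler_def mult.assoc mult_1_right)
  thus ?thesis using euler_nonzero[OF q] by (simp add: q_def)
qed

end

text \<open>
  As functions of \<open>z\<close>, both sides have the same multipliers under the shifts by \<open>1\<close> and by \<open>\<tau>\<close>, and the
  left side vanishes at the simple zeros of \<open>theta \<tau>\<close>. Their quotient is therefore an entire elliptic
  function, that is, a constant, and its value is read off from the leading terms at \<open>z = 0\<close>.
\<close>

lemma theta_inversion:
  assumes \<tau>: "Im \<tau> > 0"
  shows "exp (- (of_real pi * \<i> * z\<^sup>2 / \<tau>)) * theta (-1/\<tau>) (z/\<tau>) =
           euler (e2pi (-1/\<tau>)) ^ 2 / (\<tau> * euler (e2pi \<tau>) ^ 2) * theta \<tau> z \<or> theta \<tau> z = 0"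
proof -
  define \<tau>' where "\<tau>' = -1/\<tau>"
  have [simp]: "\<tau> \<noteq> 0" using \<tau> by auto
  have \<tau>': "Im \<tau>' > 0" using \<tau> by (simp add: \<tau>'_def Im_divide' )
  define T where "T = (\<lambda>z. exp (- (of_real pi * \<i> * z\<^sup>2 / \<tau>)) * theta \<tau>' (z/\<tau>))"
  define \<kappa> where "\<kappa> = euler (e2pi \<tau>') ^ 2 / (\<tau> * euler (e2pi \<tau>) ^ 2)"
  have T_1: "T (z + 1) = - T z" for z
  proof -
    have "theta \<tau>' (z / \<tau>) = theta \<tau>' ((z + 1)/\<tau> + \<tau>')" by (simp add: \<tau>'_def field_simps)
    also have "\<dots> = - exp (- (of_real pi * \<i> * \<tau>')) * e2pi (-((z + 1)/\<tau>)) * theta \<tau>' ((z+1)/\<tau>)"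
      by (rule theta_plus_tau[OF \<tau>'])
    finally have "T z = - (exp (- (of_real pi * \<i> * z\<^sup>2 / \<tau>)) * exp (- (of_real pi * \<i> * \<tau>')) * e2pi (-((z + 1)/\<tau>))) * theta \<tau>' ((z+1)/\<tau>)"
      by (simp add: T_def)
    also have "exp (- (of_real pi * \<i> * z\<^sup>2 / \<tau>)) * exp (- (of_real pi * \<i> * \<tau>')) * e2pi (-((z + 1)/\<tau>)) =
                 exp (- (of_real pi * \<i> * z\<^sup>2 / \<tau>) + (- (of_real pi * \<i> * \<tau>')) + 2 * of_real pi * \<i> * (-((z + 1)/\<tau>)))"
      by (simp only: exp_add)
    also have "- (of_real pi * \<i> * z\<^sup>2 / \<tau>) + (- (of_real pi * \<i> * \<tau>')) + 2 * of_real pi * \<i> * (-((z + 1)/\<tau>)) =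
                 - (of_real pi * \<i> * (z + 1)\<^sup>2 / \<tau>)"
      by (simp add: \<tau>'_def field_simps power2_eq_square)
    finally show ?thesis by (simp add: T_def)
  qed
  have T_\<tau>: "T (z + \<tau>) = - exp (- (of_real pi * \<i> * \<tau>)) * e2pi (-z) * T z" for z
  proof -
    have "T (z + \<tau>) = - exp (- (of_real pi * \<i> * (z + \<tau>)\<^sup>2 / \<tau>)) * theta \<tau>' (z/\<tau>)"
      by (simp add: T_def add_divide_distrib theta_plus_1[OF \<tau>'])
    also have "- (of_real pi * \<i> * (z + \<tau>)\<^sup>2 / \<tau>) = - (of_real pi * \<i> * z\<^sup>2 / \<tau>) + (- (of_real pi * \<i> * \<tau>)) + 2 * of_real pi * \<i> * (-z)"
      by (simp add: field_simps power2_eq_square)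
    finally show ?thesis unfolding exp_add by (simp add: T_def mult_ac)
  qed
  \<comment> \<open>At the zeros the quotient is given the value that it has to have at \<open>0\<close>; by periodicity it is the
    same at all zeros.\<close>
  define R where "R = (\<lambda>z. if theta \<tau> z = 0 then \<kappa> else T z / theta \<tau> z)"
  have R1: "R (z + 1) = R z" for z
    by (auto simp: R_def T_1 theta_plus_1[OF \<tau>])
  have R2: "R (z + \<tau>) = R z" for z
    by (auto simp: R_def T_\<tau> theta_plus_tau[OF \<tau>])
  have holT: "T holomorphic_on S" for S
    unfolding T_def
    by (intro holomorphic_intros holomorphic_on_compose_gen[OF _ holomorphic_theta[OF \<tau>', of UNIV], unfolded o_def]) auto
  have nz: "euler (e2pi \<tau>) \<noteq> 0"  using \<tau> by (intro euler_nonzero) auto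
  have lim\<theta>: "((\<lambda>z. theta \<tau> z / z) \<longlongrightarrow> - 2 * of_real pi * \<i> * euler (e2pi \<tau>) ^ 2) (at 0)"
    by (rule theta_div_tendsto[OF \<tau>])
  have limT: "((\<lambda>z. T z / z) \<longlongrightarrow> - 2 * of_real pi * \<i> * euler (e2pi \<tau>') ^ 2 / \<tau>) (at 0)"
  proof -
    have "filterlim (\<lambda>z. z / \<tau>) (at 0) (at 0)"
      by (auto simp: filterlim_at eventually_at_filter intro!: tendsto_eq_intros)
    from filterlim_compose[OF theta_div_tendsto[OF \<tau>'] this]
    have "((\<lambda>z. exp (- (of_real pi * \<i> * z\<^sup>2 / \<tau>)) * (theta \<tau>' (z/\<tau>) / (z/\<tau>)) / \<tau>)
       \<longlongrightarrow> exp (- (of_real pi * \<i> * 0\<^sup>2 / \<tau>)) * (- 2 * of_real pi * \<i> * euler (e2pi \<tau>') ^ 2) / \<tau>) (at 0)"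
      by (intro tendsto_intros) auto
    thus ?thesis by (simp add: T_def)
  qed
  have nz0: "eventually (\<lambda>z. theta \<tau> z \<noteq> 0) (at 0)"
  proof -
    have "eventually (\<lambda>z. theta \<tau> z / z \<noteq> 0) (at 0)"
      using nz by (intro tendsto_imp_eventually_ne[OF lim\<theta>]) auto
    thus ?thesis by eventually_elim auto
  qed
  have [simp]: "theta \<tau> 0 = 0" using theta_minus[OF \<tau>, of 0] by simp
  have limR: "(R \<longlongrightarrow> R 0) (at 0)"
  proof -
    have "((\<lambda>z. (T z / z) / (theta \<tau> z / z)) \<longlongrightarrow> \<kappa>) (at 0)"
      using tendsto_divide[OF limT lim\<theta>] nz by (simp add: \<kappa>_def divide_simps mult_ac)
    moreover have "eventually (\<lambda>z. (T z / z) / (theta \<tau> z / z) = R z) (at 0)"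
      using nz0 eventually_neq_at_within[of 0] by eventually_elim (auto simp: R_def)
    ultimately have "(R \<longlongrightarrow> \<kappa>) (at 0)" by (rule Lim_transform_eventually)
    thus ?thesis by (simp add: R_def)
  qed
  have an0: "R analytic_on {0}"
  proof -
    from nz0 obtain d where d: "d > 0" "\<And>z. z \<noteq> 0 \<Longrightarrow> dist z 0 < d \<Longrightarrow> theta \<tau> z \<noteq> 0"
      by (auto simp: eventually_at)
    have hol: "R holomorphic_on ball 0 d - {0}"
      by (rule holomorphic_transform[where f = "\<lambda>z. T z / theta \<tau> z"])
         (use d in \<open>auto intro!: holomorphic_intros holT holomorphic_theta[OF \<tau>] simp: R_def dist_commute\<close>)
    have "continuous_on (ball 0 d) R"
    proof (subst continuous_on_eq_continuous_at)
      show "\<forall>z\<in>ball 0 d. isCont R z"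
      proof
        fix z :: complex assume z: "z \<in> ball 0 d"
        show "isCont R z"
        proof (cases "z = 0")
          case True thus ?thesis using limR by (simp add: isCont_def)
        next
          case False
          hence "R field_differentiable at z"
            using z by (intro holomorphic_on_imp_differentiable_at[OF hol]) auto
          thus ?thesis by (rule field_differentiable_imp_continuous_at)
        qed
      qed
    qed auto
    from no_isolated_singularity[OF this hol] have "R holomorphic_on ball 0 d" by simp
    thus ?thesis using d by (auto simp: analytic_at intro!: exI[of _ "ball 0 d"])
  qed
  have an: "R analytic_on {z}" for z
  proof (cases "theta \<tau> z = 0")
    case True
    then obtain m n :: int where mn: "z = of_int m + of_int n * \<tau>" by (rule theta_eq_0_imp[OF \<tau>])
    have "R (w - z) = R w" for w
      using lattice_periodic[of R \<tau> "w - z" m n, OF R1 R2] by (simp add: mn algebra_simps)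
    hence "R = R \<circ> (\<lambda>w. w - z)" by (auto simp: fun_eq_iff)
    moreover have "(R \<circ> (\<lambda>w. w - z)) analytic_on {z}"
      by (rule analytic_on_compose) (auto intro!: analytic_intros an0)
    ultimately show ?thesis by simp
  next
    case False
    have "isCont (theta \<tau>) z"
      using holomorphic_on_imp_continuous_on[OF holomorphic_theta[OF \<tau>, of UNIV]]
      by (simp add: continuous_on_eq_continuous_at)
    hence "(theta \<tau> \<longlongrightarrow> theta \<tau> z) (nhds z)"
      by (simp add: continuous_at tendsto_nhds_iff)
    hence "eventually (\<lambda>w. theta \<tau> w \<noteq> 0) (nhds z)"
      by (rule tendsto_imp_eventually_ne[OF _ False])
    hence "eventually (\<lambda>w. R w = T w / theta \<tau> w) (nhds z)"
      by eventually_elim (simp add: R_def)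
    moreover have "(\<lambda>w. T w / theta \<tau> w) analytic_on {z}"
      using False holT[of UNIV] holomorphic_theta[OF \<tau>, of UNIV]
      by (intro analytic_on_divide) (auto simp: analytic_on_holomorphic intro: exI[of _ UNIV])
    ultimately show ?thesis by (simp add: analytic_at_cong)
  qed
  hence "R holomorphic_on UNIV"
    using analytic_on_analytic_at[of R UNIV] analytic_imp_holomorphic by blast
  hence "R z = R 0" by (rule elliptic_entire_constant[where \<tau> = \<tau>]) (use \<tau> R1 R2 in auto)
  thus ?thesis by (auto simp: R_def T_def \<kappa>_def \<tau>'_def field_simps split: if_splits)
qed

text \<open>
  The identity \<open>theta_inversion\<close> at the points \<open>1/2\<close>, \<open>\<tau>/2\<close> and \<open>(1 + \<tau>)/2\<close> relates the three Weber products
  for \<open>\<tau>\<close> and for \<open>-1/\<tau>\<close>. By \<open>weber_product\<close> they disappear when the three equations are multiplied,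
  which leaves the cube of the constant of proportionality. Working with absolute values avoids the
  choice of a square root of \<open>\<tau>\<close> and of roots of unity.
\<close>

lemma norm_eta_inversion:
  assumes \<tau>: "Im \<tau> > 0"
  shows "norm (dedekind_eta (-1/\<tau>)) ^ 2 = norm \<tau> * norm (dedekind_eta \<tau>) ^ 2"
proof -
  define \<tau>' where "\<tau>' = -1/\<tau>"
  have [simp]: "\<tau> \<noteq> 0" using \<tau> by auto
  have \<tau>': "Im \<tau>' > 0" using \<tau> by (simp add: \<tau>'_def Im_divide' )
  define y y' where "y = Im \<tau>" and "y' = Im \<tau>'"
  define k where "k = norm (euler (e2pi \<tau>') ^ 2 / (\<tau> * euler (e2pi \<tau>) ^ 2))"
  define a b c where "a = norm (qpoch (- e2pi \<tau>) (e2pi \<tau>))" 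
    and "b = norm (qpoch (e2pi (\<tau>/2)) (e2pi \<tau>))" and "c = norm (qpoch (- e2pi (\<tau>/2)) (e2pi \<tau>))"
  define a' b' c' where "a' = norm (qpoch (- e2pi \<tau>') (e2pi \<tau>'))" 
    and "b' = norm (qpoch (e2pi (\<tau>'/2)) (e2pi \<tau>'))" and "c' = norm (qpoch (- e2pi (\<tau>'/2)) (e2pi \<tau>'))"
  have abc: "a * b * c = 1" unfolding a_def b_def c_def norm_mult [symmetric] weber_product[OF \<tau>] by simp
  have abc': "a' * b' * c' = 1" unfolding a'_def b'_def c'_def norm_mult [symmetric] weber_product[OF \<tau>'] by simp
  have pos: "a > 0" "b > 0" "c > 0"
    using abc by (auto simp: a_def b_def c_def)
  have inv: "norm (exp (- (of_real pi * \<i> * z\<^sup>2 / \<tau>))) * norm (theta \<tau>' (z/\<tau>)) = k * norm (theta \<tau> z)"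
    if "norm (theta \<tau> z) > 0" for z
  proof -
    have "exp (- (of_real pi * \<i> * z\<^sup>2 / \<tau>)) * theta \<tau>' (z/\<tau>) =
           euler (e2pi \<tau>') ^ 2 / (\<tau> * euler (e2pi \<tau>) ^ 2) * theta \<tau> z"
      using theta_inversion[OF \<tau>, of z] that by (auto simp: \<tau>'_def)
    thus ?thesis unfolding k_def by (metis norm_mult)
  qed
  have th: "norm (theta \<tau> (1/2)) = 2 * a ^ 2" "norm (theta \<tau> (\<tau>/2)) = exp (pi * y / 2) * b ^ 2"
     "norm (theta \<tau> ((1 + \<tau>)/2)) = exp (pi * y / 2) * c ^ 2"
    by (simp_all add: norm_theta_half[OF \<tau>] norm_theta_half_tau[OF \<tau>] norm_theta_half_tau_plus_1[OF \<tau>]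
         a_def b_def c_def y_def)
  have th': "norm (theta \<tau>' (1/2)) = 2 * a' ^ 2" "norm (theta \<tau>' (\<tau>'/2)) = exp (pi * y' / 2) * b' ^ 2"
     "norm (theta \<tau>' ((1 + \<tau>')/2)) = exp (pi * y' / 2) * c' ^ 2"
    by (simp_all add: norm_theta_half[OF \<tau>'] norm_theta_half_tau[OF \<tau>'] norm_theta_half_tau_plus_1[OF \<tau>']
         a'_def b'_def c'_def y'_def)
  have 1: "exp (- pi * y' / 4) * (exp (pi * y' / 2) * b' ^ 2) = k * (2 * a ^ 2)"
  proof -
    have "- (of_real pi * \<i> * (1/2)\<^sup>2 / \<tau>) = of_real pi * \<i> * \<tau>' / 4"
      by (simp add: \<tau>'_def power2_eq_square)
    hence "norm (exp (- (of_real pi * \<i> * (1/2)\<^sup>2 / \<tau>))) = exp (- pi * y' / 4)"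
      by (simp only: norm_exp_eq_Re) (simp add: y'_def)
    moreover have "(1/2)/\<tau> = - (\<tau>'/2)" by (simp add: \<tau>'_def)
    hence "norm (theta \<tau>' ((1/2)/\<tau>)) = exp (pi * y' / 2) * b' ^ 2"
      by (simp add: theta_minus[OF \<tau>'] th')
    ultimately show ?thesis using inv[of "1/2"] th(1) pos by (simp del: norm_exp_eq_Re)
  qed
  have 2: "exp (pi * y / 4) * (2 * a' ^ 2) = k * (exp (pi * y / 2) * b ^ 2)"
  proof -
    have "- (of_real pi * \<i> * (\<tau>/2)\<^sup>2 / \<tau>) = - (of_real pi * \<i> * \<tau> / 4)"
      by (simp add: power2_eq_square)
    hence "norm (exp (- (of_real pi * \<i> * (\<tau>/2)\<^sup>2 / \<tau>))) = exp (pi * y / 4)"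
      by (simp only: norm_exp_eq_Re) (simp add: y_def)
    moreover have "(\<tau>/2)/\<tau> = 1/2" by simp
    ultimately show ?thesis using inv[of "\<tau>/2"] th(2) th'(1) pos by (simp del: norm_exp_eq_Re)
  qed
  have 3: "exp (- pi * y' / 4 + pi * y / 4) * (exp (pi * y' / 2) * c' ^ 2) = k * (exp (pi * y / 2) * c ^ 2)"
  proof -
    have "- (of_real pi * \<i> * ((1+\<tau>)/2)\<^sup>2 / \<tau>) = of_real pi * \<i> * \<tau>' / 4 - of_real pi * \<i> / 2 - of_real pi * \<i> * \<tau> / 4"
      by (simp add: \<tau>'_def power2_eq_square field_simps)
    hence "norm (exp (- (of_real pi * \<i> * ((1+\<tau>)/2)\<^sup>2 / \<tau>))) = exp (- pi * y' / 4 + pi * y / 4)"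
      by (simp only: norm_exp_eq_Re) (simp add: y'_def y_def)
    moreover have "((1+\<tau>)/2)/\<tau> = - ((1 + \<tau>')/2) + 1" by (simp add: \<tau>'_def field_simps)
    hence "norm (theta \<tau>' (((1+\<tau>)/2)/\<tau>)) = exp (pi * y' / 2) * c' ^ 2"
      by (simp only: theta_plus_1[OF \<tau>'] theta_minus[OF \<tau>'] th' norm_minus_cancel)
    ultimately show ?thesis using inv[of "(1+\<tau>)/2"] th(3) pos by (simp del: norm_exp_eq_Re)
  qed
  \<comment> \<open>The product of the three equations.\<close>
  have "k ^ 3 = exp (pi * (y' - y) / 6) ^ 3"
  proof -
    have "(exp (- pi * y' / 4) * (exp (pi * y' / 2) * b' ^ 2)) * (exp (pi * y / 4) * (2 * a' ^ 2)) *
          (exp (- pi * y' / 4 + pi * y / 4) * (exp (pi * y' / 2) * c' ^ 2)) =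
          exp (- pi * y' / 4 + pi * y' / 2 + pi * y / 4 + (- pi * y' / 4 + pi * y / 4) + pi * y' / 2) * 2 * (a' * b' * c') ^ 2"
      by (simp only: exp_add) (simp add: power_mult_distrib)
    also have "- pi * y' / 4 + pi * y' / 2 + pi * y / 4 + (- pi * y' / 4 + pi * y / 4) + pi * y' / 2 = pi * (y' - y) / 2 + pi * y"
      by (simp add: field_simps)
    finally have l: "(exp (- pi * y' / 4) * (exp (pi * y' / 2) * b' ^ 2)) * (exp (pi * y / 4) * (2 * a' ^ 2)) *
          (exp (- pi * y' / 4 + pi * y / 4) * (exp (pi * y' / 2) * c' ^ 2)) = exp (pi * (y' - y) / 2) * exp (pi * y) * 2"
      by (simp add: abc' exp_add)
    have "(k * (2 * a ^ 2)) * (k * (exp (pi * y / 2) * b ^ 2)) * (k * (exp (pi * y / 2) * c ^ 2)) =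
          k ^ 3 * exp (pi * y / 2 + pi * y / 2) * 2 * (a * b * c) ^ 2"
      by (simp only: exp_add) (simp add: power_mult_distrib power3_eq_cube)
    hence "(k * (2 * a ^ 2)) * (k * (exp (pi * y / 2) * b ^ 2)) * (k * (exp (pi * y / 2) * c ^ 2)) = k ^ 3 * exp (pi * y) * 2"
      by (simp add: abc)
    with l have "k ^ 3 = exp (pi * (y' - y) / 2)" unfolding 1 2 3 by simp
    thus ?thesis by (simp flip: exp_of_nat_mult)
  qed
  hence k: "k = exp (pi * (y' - y) / 6)"
    by (rule power_eq_imp_eq_base) (auto simp: k_def)
  have eta: "norm (dedekind_eta t) ^ 2 = exp (- pi * Im t / 6) * norm (euler (e2pi t)) ^ 2" for t
    by (simp add: eta_eq norm_mult norm_qpow power_mult_distrib qpow_1 of_rat_divide flip: exp_of_nat_mult)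
  have "norm (euler (e2pi \<tau>)) > 0" using euler_nonzero[of "e2pi \<tau>"] \<tau> by simp
  hence "norm (euler (e2pi \<tau>')) ^ 2 = exp (pi * (y' - y) / 6) * norm \<tau> * norm (euler (e2pi \<tau>)) ^ 2"
    using k by (simp add: k_def norm_divide norm_mult norm_power field_simps)
  hence "norm (dedekind_eta \<tau>') ^ 2 = exp (- pi * y' / 6) * exp (pi * (y' - y) / 6) * norm \<tau> * norm (euler (e2pi \<tau>)) ^ 2"
    by (simp add: eta y'_def)
  also have "exp (- pi * y' / 6) * exp (pi * (y' - y) / 6) = exp (- pi * y / 6)"
    by (simp add: exp_add [symmetric] field_simps)
  finally show ?thesis by (simp add: eta y_def \<tau>'_def)
qed

section \<open>The Jacobi triple product\<close>

definition triangular :: "nat \<Rightarrow> nat" where "triangular n = n * (n + 1) div 2"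

lemma two_triangular: "2 * triangular n = n * (n + 1)"
  by (simp add: triangular_def)

lemma triangular_Suc: "triangular (Suc n) = triangular n + Suc n"
  using two_triangular[of n] two_triangular[of "Suc n"] by (simp add: algebra_simps)

lemma triangular_0 [simp]: "triangular 0 = 0" by (simp add: triangular_def)

context
  fixes q :: complex assumes q: "norm q < 1"
begin

definition qfac :: "nat \<Rightarrow> complex" where "qfac n = (\<Prod>k<n. 1 - q ^ Suc k)"

definition qbinom :: "nat \<Rightarrow> nat \<Rightarrow> complex" where
  "qbinom n k = (if k \<le> n then qfac n / (qfac k * qfac (n - k)) else 0)"

lemma qfac_Suc: "qfac (Suc n) = qfac n * (1 - q ^ Suc n)"
  by (simp add: qfac_def)

lemma qfac_0 [simp]: "qfac 0 = 1"
  by (simp add: qfac_def)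

lemma one_minus_power_nz: "1 - q ^ Suc n \<noteq> 0"
proof
  assume "1 - q ^ Suc n = 0"
  hence "norm q ^ Suc n = 1" by (metis norm_one norm_power right_minus_eq)
  moreover have "norm q ^ Suc n \<le> norm q ^ 1"
    using q by (intro power_decreasing) auto
  ultimately show False using q by simp
qed

lemma qfac_nonzero: "qfac n \<noteq> 0"
  unfolding qfac_def using one_minus_power_nz by (subst prod_zero_iff) blast+

lemma qbinom_0 [simp]: "qbinom n 0 = 1"
  by (simp add: qbinom_def qfac_nonzero)

lemma qbinom_Suc: 
  "qbinom (Suc n) (Suc k) * q ^ k = qbinom n (Suc k) * q ^ k + q ^ n * qbinom n k"
proof (cases k n rule: linorder_cases)
  case less
  then obtain m where m: "n = Suc (k + m)" by (metis less_imp_Suc_add)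
  have *: "qfac (Suc n) = qfac n * (1 - q ^ Suc n)" "qfac (Suc k) = qfac k * (1 - q ^ Suc k)"
    "qfac (Suc m) = qfac m * (1 - q ^ Suc m)" by (simp_all only: qfac_Suc)
  have nz: "qfac n \<noteq> 0" "qfac k \<noteq> 0" "qfac m \<noteq> 0" "1 - q ^ Suc k \<noteq> 0" "1 - q ^ Suc m \<noteq> 0"
    using qfac_nonzero one_minus_power_nz by auto
  have eqs: "qbinom (Suc n) (Suc k) = qfac n * (1 - q ^ Suc n) / (qfac k * (1 - q ^ Suc k) * (qfac m * (1 - q ^ Suc m)))"
       "qbinom n (Suc k) = qfac n / (qfac k * (1 - q ^ Suc k) * qfac m)"
       "qbinom n k = qfac n / (qfac k * (qfac m * (1 - q ^ Suc m)))"
    unfolding qbinom_def using m * by (simp_all add: Suc_diff_le)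
  define Q R where "Q = q ^ k" and "R = q ^ m"
  have pw: "q ^ Suc n = Q * R * q * q" "q ^ n = Q * R * q" "q ^ Suc k = Q * q" "q ^ Suc m = R * q" "q ^ k = Q"
    by (simp_all add: m Q_def R_def power_add)
  show ?thesis using nz unfolding eqs pw by (simp add: divide_simps) (simp add: algebra_simps)
next
  case equal
  thus ?thesis by (simp add: qbinom_def qfac_nonzero)
next
  case greater
  thus ?thesis by (simp add: qbinom_def)
qed

text \<open>
  The exponent \<open>triangular j - j\<close> is \<open>j (j - 1) / 2\<close>.
\<close>

lemma q_binomial_theorem:
  "(\<Prod>k<n. 1 + z * q ^ k) = (\<Sum>j\<le>n. qbinom n j * q ^ (triangular j - j) * z ^ j)"
proof (induction n)
  case (Suc n)
  have t: "triangular (Suc j) - Suc j = (triangular j - j) + j" for j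
  proof (cases j)
    case (Suc i)
    thus ?thesis by (simp add: triangular_Suc)
  qed (simp add: triangular_def)
  have "(\<Prod>k<Suc n. 1 + z * q ^ k) = (\<Sum>j\<le>n. qbinom n j * q ^ (triangular j - j) * z ^ j) * (1 + z * q ^ n)"
    by (simp add: Suc)
  also have "\<dots> = (\<Sum>j\<le>Suc n. qbinom n j * q ^ (triangular j - j) * z ^ j) + 
       (\<Sum>j\<le>n. q ^ n * qbinom n j * q ^ (triangular j - j) * z ^ Suc j)"
    by (simp add: qbinom_def[of n "Suc n"] sum_distrib_left sum_distrib_right sum.distrib algebra_simps)
  also have "\<dots> = 1 + (\<Sum>j\<le>n. (qbinom n (Suc j) * q ^ j + q ^ n * qbinom n j) * q ^ (triangular j - j) * z ^ Suc j)"
    by (subst sum.atMost_Suc_shift) (simp add: t sum.distrib [symmetric] power_add algebra_simps)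
  also have "\<dots> = (\<Sum>j\<le>Suc n. qbinom (Suc n) j * q ^ (triangular j - j) * z ^ j)"
    by (simp only: qbinom_Suc [symmetric] sum.atMost_Suc_shift) (simp add: t power_add mult_ac)
  finally show ?case .
qed auto

text \<open>
  This is the q-binomial theorem for \<open>2 N + 1\<close> factors whose exponents are centred at \<open>0\<close>. The terms with
  index \<open>N - n\<close> and \<open>N + 1 + n\<close> carry the same power of \<open>q\<close>, because \<open>n (n + 1) / 2\<close> is unchanged under
  \<open>n \<mapsto> -n - 1\<close>; combining them replaces a bilateral sum by a sum over natural numbers.
\<close>

lemma finite_triple_product:
  assumes "q \<noteq> 0" "x * y = 1"
  shows "(\<Prod>k<Suc N. 1 + y * q ^ k) * (\<Prod>k<N. 1 + x * q * q ^ k) =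
           (\<Sum>n\<le>N. qfac (2*N+1) / (qfac (N + 1 + n) * qfac (N - n)) * (q ^ triangular n * (x ^ n + y ^ Suc n)))"
proof -
  have nz: "x \<noteq> 0" "y \<noteq> 0" using assms by auto
  have eq_swap: "c * f = a * d" if "a = b * c" "b * d = f" for a b c d f :: complex
    using that by auto
  \<comment> \<open>With this argument the factors \<open>k \<ge> N\<close> of the q-binomial theorem are \<open>1 + y q\<^sup>i\<close>, while those with
    \<open>k < N\<close> become \<open>1 + x q\<^sup>i\<close> after extraction of a monomial.\<close>
  define z where "z = y / q ^ N"
  define B where "B = (\<lambda>j. qbinom (2*N+1) j * q ^ (triangular j - j) * z ^ j * (x ^ N * q ^ triangular N))"
  have "(\<Prod>k<2*N+1. 1 + z * q ^ k) = (\<Prod>k<N. 1 + z * q ^ k) * (\<Prod>k<Suc N. 1 + y * q ^ k)"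
  proof -
    have "{..<2*N+1} = {..<N} \<union> {N..<2*N+1}" by auto
    moreover have "(\<Prod>k\<in>{..<N} \<union> {N..<2*N+1}. 1 + z * q ^ k) = (\<Prod>k<N. 1 + z * q ^ k) * (\<Prod>k\<in>{N..<2*N+1}. 1 + z * q ^ k)"
      by (rule prod.union_disjoint) auto
    ultimately have "(\<Prod>k<2*N+1. 1 + z * q ^ k) = (\<Prod>k<N. 1 + z * q ^ k) * (\<Prod>k\<in>{N..<2*N+1}. 1 + z * q ^ k)"
      by (simp only:)
    also have "(\<Prod>k\<in>{N..<2*N+1}. 1 + z * q ^ k) = (\<Prod>k\<in>{0+N..<Suc N+N}. 1 + z * q ^ k)"
      by (simp add: mult_2)
    also have "\<dots> = (\<Prod>k\<in>{0..<Suc N}. 1 + z * q ^ (k + N))" by (rule prod.shift_bounds_nat_ivl)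
    also have "\<dots> = (\<Prod>k<Suc N. 1 + y * q ^ k)"
      using assms by (simp add: z_def power_add atLeast0LessThan del: prod.lessThan_Suc prod.op_ivl_Suc)
    finally show ?thesis .
  qed
  moreover have "(\<Prod>k<N. 1 + z * q ^ k) * (x ^ N * q ^ triangular N) = (\<Prod>k<N. 1 + x * q * q ^ k)"
  proof -
    have "(\<Prod>k<N. x * q ^ Suc k) = x ^ N * q ^ triangular N"
      by (induction N) (simp_all add: triangular_Suc power_add mult_ac)
    hence "(\<Prod>k<N. 1 + z * q ^ k) * (x ^ N * q ^ triangular N) = (\<Prod>k<N. 1 + z * q ^ k) * (\<Prod>k<N. x * q ^ Suc k)"
      by simp
    also have "\<dots> = (\<Prod>k<N. 1 + z * q ^ (N - Suc k)) * (\<Prod>k<N. x * q ^ Suc k)"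
      using prod.nat_diff_reindex[of "\<lambda>k. 1 + z * q ^ k" N] by simp
    also have "\<dots> = (\<Prod>k<N. (1 + z * q ^ (N - Suc k)) * (x * q ^ Suc k))"
      by (rule prod.distrib [symmetric])
    also have "\<dots> = (\<Prod>k<N. 1 + x * q * q ^ k)"
    proof (rule prod.cong[OF refl])
      fix k assume "k \<in> {..<N}"
      hence "q ^ (N - Suc k) * q ^ Suc k = q ^ N" by (subst power_add [symmetric]) simp
      hence "z * q ^ (N - Suc k) * (x * q ^ Suc k) = z * x * q ^ N" by (simp add: mult_ac)
      also have "\<dots> = 1" using assms by (simp add: z_def mult_ac)
      finally show "(1 + z * q ^ (N - Suc k)) * (x * q ^ Suc k) = 1 + x * q * q ^ k"
        by (simp add: algebra_simps)
    qed
    finally show ?thesis .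
  qed
  ultimately have "(\<Prod>k<Suc N. 1 + y * q ^ k) * (\<Prod>k<N. 1 + x * q * q ^ k) =
      (\<Prod>k<2*N+1. 1 + z * q ^ k) * (x ^ N * q ^ triangular N)"
    by (rule eq_swap)
  also have "\<dots> = (\<Sum>j\<le>2*N+1. B j)"
    by (simp only: q_binomial_theorem B_def sum_distrib_right)
  also have "\<dots> = (\<Sum>n\<le>N. B (N - n)) + (\<Sum>n\<le>N. B (N + 1 + n))"
  proof -
    have "{..2*N+1} = {..N} \<union> {0+(N+1)..N+(N+1)}" by auto
    moreover have "(\<Sum>j\<in>{..N} \<union> {0+(N+1)..N+(N+1)}. B j) = (\<Sum>j\<le>N. B j) + (\<Sum>j\<in>{0+(N+1)..N+(N+1)}. B j)"
      by (rule sum.union_disjoint) auto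
    ultimately have "(\<Sum>j\<le>2*N+1. B j) = (\<Sum>j\<le>N. B j) + (\<Sum>j\<in>{0+(N+1)..N+(N+1)}. B j)"
      by (simp only:)
    also have "(\<Sum>j\<in>{0+(N+1)..N+(N+1)}. B j) = (\<Sum>n\<le>N. B (N + 1 + n))"
      by (subst sum.shift_bounds_cl_nat_ivl) (simp add: atLeast0AtMost add_ac)
    also have "(\<Sum>j\<le>N. B j) = (\<Sum>n\<le>N. B (N - n))"
      using sum.nat_diff_reindex[of B "Suc N"] by (simp add: lessThan_Suc_atMost)
    finally show ?thesis .
  qed
  also have "\<dots> = (\<Sum>n\<le>N. B (N - n) + B (N + 1 + n))" by (rule sum.distrib [symmetric])
  also have "\<dots> = (\<Sum>n\<le>N. qfac (2*N+1) / (qfac (N + 1 + n) * qfac (N - n)) * (q ^ triangular n * (x ^ n + y ^ Suc n)))"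
  proof (rule sum.cong[OF refl])
    fix n assume "n \<in> {..N}"
    hence n: "n \<le> N" by simp
    have le: "j \<le> triangular j" for j by (induction j) (auto simp: triangular_Suc)
    have key: "q ^ (triangular j - j) * z ^ j * (x ^ N * q ^ triangular N) = q ^ triangular n * (x ^ N * y ^ j)"
      if "triangular j - j + triangular N = triangular n + N * j" for j
    proof -
      have "q ^ (triangular j - j) * z ^ j * (x ^ N * q ^ triangular N) = q ^ (triangular j - j + triangular N) * y ^ j / q ^ (N * j) * x ^ N"
        by (simp add: z_def power_divide power_add power_mult)
      also have "\<dots> = q ^ triangular n * (x ^ N * y ^ j)"
        unfolding that using assms by (simp add: power_add)
      finally show ?thesis .
    qed
    have e1: "triangular (N - n) - (N - n) + triangular N = triangular n + N * (N - n)"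
    proof -
      obtain m where m: "N = n + m" using n by (metis le_iff_add)
      show ?thesis using le[of m] two_triangular[of m] two_triangular[of "n + m"] two_triangular[of n] unfolding m
        by (simp add: algebra_simps)
    qed
    have e2: "triangular (N + 1 + n) - (N + 1 + n) + triangular N = triangular n + N * (N + 1 + n)"
      using le[of "N + 1 + n"] two_triangular[of "N + 1 + n"] two_triangular[of N] two_triangular[of n]
      by (simp add: algebra_simps)
    have xy: "x ^ k * y ^ k = 1" for k using assms by (simp flip: power_mult_distrib)
    have "x ^ N * y ^ (N - n) = x ^ n * (x ^ (N - n) * y ^ (N - n))"
      using n by (simp add: mult.assoc [symmetric] power_add [symmetric])
    hence p1: "x ^ N * y ^ (N - n) = x ^ n" by (simp add: xy)
    have p2: "x ^ N * y ^ (N + 1 + n) = y ^ Suc n"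
      using xy[of N] by (simp add: power_add mult_ac)
    have b1: "B (N - n) = qfac (2*N+1) / (qfac (N + 1 + n) * qfac (N - n)) * (q ^ triangular n * x ^ n)"
    proof -
      have "2*N+1 - (N - n) = N + 1 + n" using n by simp
      hence "qbinom (2*N+1) (N - n) = qfac (2*N+1) / (qfac (N + 1 + n) * qfac (N - n))"
        using n by (simp add: qbinom_def mult_ac)
      thus ?thesis unfolding B_def using key[OF e1] p1 by (simp add: mult.assoc)
    qed
    have b2: "B (N + 1 + n) = qfac (2*N+1) / (qfac (N + 1 + n) * qfac (N - n)) * (q ^ triangular n * y ^ Suc n)"
    proof -
      have "2*N+1 - (N + 1 + n) = N - n" using n by simp
      hence "qbinom (2*N+1) (N + 1 + n) = qfac (2*N+1) / (qfac (N + 1 + n) * qfac (N - n))"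
        using n by (simp add: qbinom_def mult_ac)
      thus ?thesis unfolding B_def using key[OF e2] p2 by (simp only: mult.assoc)
    qed
    show "B (N - n) + B (N + 1 + n) = qfac (2*N+1) / (qfac (N + 1 + n) * qfac (N - n)) * (q ^ triangular n * (x ^ n + y ^ Suc n))"
      unfolding b1 b2 by (simp only: distrib_left)
  qed
  finally show ?thesis .
qed

lemma summable_theta_series: "summable (\<lambda>n. norm (q ^ triangular n * w ^ n))"
proof -
  have "(\<lambda>n. norm q ^ Suc n * norm w) \<longlonglongrightarrow> 0 * norm w"
    using q by (intro tendsto_intros LIMSEQ_Suc LIMSEQ_power_zero) auto
  hence "eventually (\<lambda>n. norm q ^ Suc n * norm w < 1/2) sequentially"
    by (intro order_tendstoD) auto
  then obtain N where N: "\<And>n. n \<ge> N \<Longrightarrow> norm q ^ Suc n * norm w < 1/2"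
    by (auto simp: eventually_at_top_linorder)
  show ?thesis
  proof (rule summable_ratio_test[where c = "1/2" and N = N])
    fix n assume "n \<ge> N"
    have "norm (norm (q ^ triangular (Suc n) * w ^ Suc n)) = (norm q ^ Suc n * norm w) * norm (q ^ triangular n * w ^ n)"
      by (simp add: triangular_Suc power_add norm_mult norm_power)
    also have "\<dots> \<le> 1/2 * norm (q ^ triangular n * w ^ n)"
      using N[OF \<open>n \<ge> N\<close>] by (intro mult_right_mono) auto
    finally show "norm (norm (q ^ triangular (Suc n) * w ^ Suc n)) \<le> 1/2 * norm (norm (q ^ triangular n * w ^ n))" by simp
  qed auto
qed

text \<open>
  The limit of the finite version. The coefficients tend to \<open>1 / (q; q)\<^sub>\<infinity>\<close> and are bounded, so
  Tannery's theorem allows the limit to be taken term by term. The sum is the usual one over all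
  integers, with \<open>n\<close> and \<open>-n - 1\<close> combined.
\<close>

theorem jacobi_triple_product:
  assumes "q \<noteq> 0" "x * y = 1"
  shows "(\<lambda>n. q ^ triangular n * (x ^ n + y ^ Suc n)) sums (euler q * qpoch (- (x * q)) q * qpoch (- y) q)"
proof -
  define t where "t = (\<lambda>n. q ^ triangular n * (x ^ n + y ^ Suc n))"
  have sn: "summable (\<lambda>n. norm (t n))"
  proof (rule summable_comparison_test'[where N = 0])
    show "summable (\<lambda>n. norm (q ^ triangular n * x ^ n) + norm y * norm (q ^ triangular n * y ^ n))"
      by (intro summable_add summable_mult summable_theta_series)
    show "norm (norm (t n)) \<le> norm (q ^ triangular n * x ^ n) + norm y * norm (q ^ triangular n * y ^ n)" for n
    proof -
      have "t n = q ^ triangular n * x ^ n + y * (q ^ triangular n * y ^ n)" by (simp add: t_def algebra_simps)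
      thus ?thesis using norm_triangle_ineq[of "q ^ triangular n * x ^ n" "y * (q ^ triangular n * y ^ n)"]
        by (simp add: norm_mult)
    qed
  qed
  have "qfac = (\<lambda>N. \<Prod>n<N. 1 - q * q ^ n)" by (simp add: qfac_def fun_eq_iff)
  hence lq: "qfac \<longlonglongrightarrow> euler q"
    using qpoch_LIMSEQ[OF q, of q] by (simp add: euler_def)
  have nz: "euler q \<noteq> 0" by (rule euler_nonzero[OF q])
  obtain K where K: "\<And>n. norm (qfac n) \<le> K"
    using convergent_imp_Bseq[of qfac] lq by (auto simp: Bseq_def convergent_def)
  have "(\<lambda>n. inverse (qfac n)) \<longlonglongrightarrow> inverse (euler q)" by (intro tendsto_inverse lq nz)
  then obtain L where L: "\<And>n. norm (inverse (qfac n)) \<le> L"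
    using convergent_imp_Bseq[of "\<lambda>n. inverse (qfac n)"] unfolding Bseq_def convergent_def by blast
  have "K \<ge> 0" "L \<ge> 0" using K[of 0] L[of 0] by auto
  define b where "b = (\<lambda>N n. qfac (2*N+1) * inverse (qfac (N + 1 + n)) * inverse (qfac (N - n)))"
  define f where "f = (\<lambda>n N. if n \<le> N then b N n * t n else 0)"
  have "(\<lambda>N. \<Sum>n. f n N) \<longlonglongrightarrow> (\<Sum>n. inverse (euler q) * t n)"
  proof (rule tannerys_theorem[of f "\<lambda>n. inverse (euler q) * t n" sequentially "\<lambda>n. (K * L * L) * norm (t n)",
          THEN conjunct2, THEN conjunct2])
    show "\<forall>\<^sub>F (n, N) in at_top \<times>\<^sub>F sequentially. norm (f n N) \<le> (K * L * L) * norm (t n)"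
    proof (intro always_eventually allI, clarify)
      fix n N :: nat
      have "norm (b N n) \<le> K * L * L"
        unfolding b_def norm_mult by (intro mult_mono K L mult_nonneg_nonneg) (auto simp: \<open>K \<ge> 0\<close> \<open>L \<ge> 0\<close>)
      hence "norm (b N n * t n) \<le> K * L * L * norm (t n)"
        unfolding norm_mult by (intro mult_right_mono) auto
      moreover have "0 \<le> K * L * L * norm (t n)" using \<open>K \<ge> 0\<close> \<open>L \<ge> 0\<close> by simp
      ultimately show "norm (f n N) \<le> K * L * L * norm (t n)" by (simp add: f_def)
    qed
    show "summable (\<lambda>n. K * L * L * norm (t n))" by (intro summable_mult sn)
    fix n
    have "(\<lambda>N. qfac (2*N+1) * inverse (qfac (N + 1 + n)) * inverse (qfac (N - n)) * t n) \<longlonglongrightarrow>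
            euler q * inverse (euler q) * inverse (euler q) * t n"
    proof (intro tendsto_intros nz)
      show "(\<lambda>N. qfac (2*N+1)) \<longlonglongrightarrow> euler q"
        using LIMSEQ_subseq_LIMSEQ[OF lq, of "\<lambda>N. 2*N+1"] by (simp add: strict_mono_def o_def)
      show "(\<lambda>N. qfac (N + 1 + n)) \<longlonglongrightarrow> euler q"
        using LIMSEQ_ignore_initial_segment[OF lq, of "Suc n"] by simp
      show "(\<lambda>N. qfac (N - n)) \<longlonglongrightarrow> euler q"
        by (rule LIMSEQ_offset[where k = n]) (simp add: lq)
    qed
    hence "(\<lambda>N. b N n * t n) \<longlonglongrightarrow> inverse (euler q) * t n" using nz by (simp add: b_def)
    moreover have "eventually (\<lambda>N. b N n * t n = f n N) sequentially"
      using eventually_ge_at_top[of n] by eventually_elim (simp add: f_def)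
    ultimately show "(\<lambda>N. f n N) \<longlonglongrightarrow> inverse (euler q) * t n" by (rule Lim_transform_eventually)
  qed auto
  moreover have "(\<Sum>n. f n N) = (\<Prod>k<Suc N. 1 + y * q ^ k) * (\<Prod>k<N. 1 + x * q * q ^ k)" for N
  proof -
    have "(\<Sum>n. f n N) = (\<Sum>n\<le>N. f n N)" by (rule suminf_finite) (auto simp: f_def)
    also have "\<dots> = (\<Sum>n\<le>N. qfac (2*N+1) / (qfac (N + 1 + n) * qfac (N - n)) * (q ^ triangular n * (x ^ n + y ^ Suc n)))"
      by (intro sum.cong) (auto simp: f_def b_def t_def field_simps)
    finally show ?thesis using finite_triple_product[OF assms, of N] by simp
  qed
  ultimately have l1: "(\<lambda>N. (\<Prod>k<Suc N. 1 + y * q ^ k) * (\<Prod>k<N. 1 + x * q * q ^ k)) \<longlonglongrightarrow> (\<Sum>n. inverse (euler q) * t n)"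
    by simp
  have "(\<lambda>N. (\<Prod>k<Suc N. 1 - (-y) * q ^ k) * (\<Prod>k<N. 1 - (- (x * q)) * q ^ k)) \<longlonglongrightarrow> qpoch (-y) q * qpoch (- (x * q)) q"
    by (intro tendsto_mult LIMSEQ_Suc[OF qpoch_LIMSEQ] qpoch_LIMSEQ q)
  hence "(\<Sum>n. inverse (euler q) * t n) = qpoch (-y) q * qpoch (- (x * q)) q"
    using LIMSEQ_unique[OF l1] by simp
  hence "suminf t = euler q * qpoch (- (x * q)) q * qpoch (- y) q"
    unfolding suminf_mult[OF summable_norm_cancel[OF sn]] using nz by (simp add: field_simps)
  thus ?thesis using summable_sums[OF summable_norm_cancel[OF sn]] by (simp add: t_def)
qed

text \<open>
  The triple product at \<open>x = 1\<close>, where every term of the bilateral sum occurs twice.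
\<close>

lemma ramanujan_psi_sums: 
  assumes "q \<noteq> 0"
  shows "(\<lambda>n. q ^ triangular n) sums (euler (q\<^sup>2) ^ 2 / euler q)"
proof -
  have "qpoch (-1) q = 2 * qpoch (-q) q" by (subst qpoch_rec) (simp_all add: q)
  moreover have "euler q * qpoch (-q) q = euler (q\<^sup>2)"
    using qpoch_mult_minus[OF q, of q] by (simp add: euler_def)
  ultimately have "(euler q * qpoch (- (1 * q)) q * qpoch (- 1) q) / 2 = euler (q\<^sup>2) ^ 2 / euler q"
    using euler_nonzero[OF q] by (simp add: field_simps power2_eq_square)
  moreover have "(\<lambda>n. q ^ triangular n * (1 ^ n + 1 ^ Suc n) / 2) sums ((euler q * qpoch (- (1 * q)) q * qpoch (- 1) q) / 2)"
    by (intro sums_divide jacobi_triple_product assms) auto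
  ultimately show ?thesis by simp
qed

end

section \<open>The relation between u and w\<close>

text \<open>
  The triangular numbers of index \<open>3 n + 1\<close> are \<open>1 + 9 n (n + 1) / 2\<close>, so these terms form
  \<open>q \<psi>(q\<^sup>9)\<close>. Those of index \<open>3 n\<close> and \<open>3 n + 2\<close> together form the triple product for \<open>q\<^sup>9\<close> at
  \<open>x = q\<^bsup>-3\<^esup>\<close>, which again is a quotient of Euler functions.
\<close>

lemma psi_3_dissection:
  fixes q :: complex
  assumes q: "norm q < 1" "q \<noteq> 0"
  shows "euler (q ^ 2) ^ 2 / euler q = 
          euler (q ^ 9) ^ 2 * euler (q ^ 6) / (euler (q ^ 18) * euler (q ^ 3)) + q * (euler (q ^ 18) ^ 2 / euler (q ^ 9))"
proof -
  have nq: "norm (q ^ Suc n) < 1" for n 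
  proof -
    have "norm q ^ Suc n \<le> norm q ^ 1" using q by (intro power_decreasing) auto
    also have "\<dots> < 1" using q by simp
    finally show ?thesis by (simp only: norm_power)
  qed
  have n9: "norm (q ^ 9) < 1" and n3: "norm (q ^ 3) < 1" using nq[of 8] nq[of 2] by simp_all
  have psi: "(\<lambda>n. q ^ triangular n) sums (euler (q ^ 2) ^ 2 / euler q)"
    by (rule ramanujan_psi_sums[OF q])
  have psi9: "(\<lambda>n. q * (q ^ 9) ^ triangular n) sums (q * (euler (q ^ 18) ^ 2 / euler (q ^ 9)))"
    using sums_mult[OF ramanujan_psi_sums[OF n9], of q] q by (simp flip: power_mult)
  have j: "(\<lambda>n. (q ^ 9) ^ triangular n * ((1 / q ^ 3) ^ n + (q ^ 3) ^ Suc n)) sums 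
          (euler (q ^ 9) * qpoch (- (1 / q ^ 3 * q ^ 9)) (q ^ 9) * qpoch (- (q ^ 3)) (q ^ 9))"
    by (rule jacobi_triple_product[OF n9]) (use q in auto)
  have prod: "euler (q ^ 9) * qpoch (- (1 / q ^ 3 * q ^ 9)) (q ^ 9) * qpoch (- (q ^ 3)) (q ^ 9) =
          euler (q ^ 9) ^ 2 * euler (q ^ 6) / (euler (q ^ 18) * euler (q ^ 3))"
  proof -
    have "(\<Prod>j<3. qpoch (- (q ^ 3) * (q ^ 3) ^ j) ((q ^ 3) ^ 3)) = qpoch (- (q ^ 3)) (q ^ 3)"
      by (rule qpoch_dissect[OF n3]) auto
    hence d: "qpoch (- (q ^ 3)) (q ^ 9) * qpoch (- (q ^ 6)) (q ^ 9) * qpoch (- (q ^ 9)) (q ^ 9) = qpoch (- (q ^ 3)) (q ^ 3)"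
      by (simp add: numeral_3_eq_3 eval_nat_numeral mult_ac)
    have e: "1 / q ^ 3 * q ^ 9 = q ^ 6" using q by (simp add: field_simps flip: power_add)
    have a3: "euler (q ^ 3) * qpoch (- (q ^ 3)) (q ^ 3) = euler (q ^ 6)"
      using qpoch_mult_minus[OF n3, of "q ^ 3"] by (simp add: euler_def flip: power_mult)
    have a9: "euler (q ^ 9) * qpoch (- (q ^ 9)) (q ^ 9) = euler (q ^ 18)"
      using qpoch_mult_minus[OF n9, of "q ^ 9"] by (simp add: euler_def flip: power_mult)
    have nz: "euler (q ^ 3) \<noteq> 0" "euler (q ^ 9) \<noteq> 0" "euler (q ^ 18) \<noteq> 0"
      using nq[of 2] nq[of 8] nq[of 17] euler_nonzero by auto
    hence nz9: "qpoch (- (q ^ 9)) (q ^ 9) \<noteq> 0" using a9 by auto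
    show ?thesis unfolding e a3 [symmetric] a9 [symmetric] d [symmetric]
      using nz nz9 by (simp add: field_simps power2_eq_square)
  qed
  have T: "triangular (3*n+1) = 1 + 9 * triangular n" "triangular (3*n+2) = 9 * triangular n + 3 * Suc n" "triangular (3*n) + 3 * n = 9 * triangular n" for n
    using two_triangular[of "3*n+1"] two_triangular[of "3*n+2"] two_triangular[of "3*n"] two_triangular[of n] by (simp_all add: algebra_simps)
  have "(\<lambda>n. \<Sum>k\<in>{n*3..<n*3+3}. q ^ triangular k) sums (euler (q ^ 2) ^ 2 / euler q)"
    by (rule sums_group[OF psi]) auto
  also have "(\<lambda>n. \<Sum>k\<in>{n*3..<n*3+3}. q ^ triangular k) = 
      (\<lambda>n. (q ^ 9) ^ triangular n * ((1 / q ^ 3) ^ n + (q ^ 3) ^ Suc n) + q * (q ^ 9) ^ triangular n)"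
  proof
    fix n :: nat
    have "{n*3..<n*3+3} = {3*n, 3*n+1, 3*n+2}" by auto
    hence "(\<Sum>k\<in>{n*3..<n*3+3}. q ^ triangular k) = q ^ triangular (3*n) + q ^ triangular (3*n+1) + q ^ triangular (3*n+2)"
      by simp
    also have "q ^ triangular (3*n) = (q ^ 9) ^ triangular n * (1 / q ^ 3) ^ n"
      using T(3)[of n, symmetric] q by (simp flip: power_mult) (simp add: power_add power_divide power_mult)
    also have "q ^ triangular (3*n+1) = q * (q ^ 9) ^ triangular n" unfolding T by (simp add: power_add power_mult)
    also have "q ^ triangular (3*n+2) = (q ^ 9) ^ triangular n * (q ^ 3) ^ Suc n" unfolding T by (simp only: power_add power_mult)
    finally show "(\<Sum>k\<in>{n*3..<n*3+3}. q ^ triangular k) = 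
        (q ^ 9) ^ triangular n * ((1 / q ^ 3) ^ n + (q ^ 3) ^ Suc n) + q * (q ^ 9) ^ triangular n"
      by (simp only: distrib_left add_ac)
  qed
  finally show ?thesis
    using sums_unique2[OF _ sums_add[OF j psi9]] by (simp only: prod)
qed

text \<open>
  The 3-dissection divided by \<open>q \<psi>(q\<^sup>9)\<close>: the left side becomes \<open>1/w\<close> and the two terms on the right
  become \<open>1/u\<close> and \<open>1\<close>.
\<close>

lemma inverse_u_w:
  assumes \<tau>: "Im \<tau> > 0"
  shows "1 / u_fun \<tau> = 1 / w_fun \<tau> - 1"
proof -
  define q where "q = qpow 1 \<tau>"
  have q: "norm q < 1" "q \<noteq> 0" by (simp_all add: q_def norm_qpow_less_1 \<tau>)
  have eta: "dedekind_eta (of_nat n * \<tau>) = qpow (of_nat n / 24) \<tau> * euler (q ^ n)" for n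
    by (simp add: eta_eq qpow_scale qpow_power q_def)
  define E where "E = (\<lambda>n. euler (q ^ n))"
  \<comment> \<open>All fractional powers of \<open>q\<close> are powers of \<open>h\<close>, and for \<open>u\<close> and \<open>w\<close> they combine to \<open>h\<^bsup>24\<^esup> = q\<close>.\<close>
  define h where "h = qpow (1/24) \<tau>"
  have h: "h \<noteq> 0" by (simp add: h_def)
  have hq: "h ^ 24 = q" by (simp add: h_def q_def qpow_power)
  have eta': "dedekind_eta (of_nat n * \<tau>) = h ^ n * E n" for n
    by (simp add: eta h_def qpow_power E_def)
  have nz: "E n \<noteq> 0" if "n > 0" for n
    using q that unfolding E_def by (intro euler_nonzero) (simp add: norm_power power_less_one_iff)
  have e: "dedekind_eta \<tau> = h * E 1" "dedekind_eta (2*\<tau>) = h ^ 2 * E 2" "dedekind_eta (3*\<tau>) = h ^ 3 * E 3"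
    "dedekind_eta (6*\<tau>) = h ^ 6 * E 6" "dedekind_eta (9*\<tau>) = h ^ 9 * E 9" "dedekind_eta (18*\<tau>) = h ^ 18 * E 18"
    using eta'[of 1] eta'[of 2] eta'[of 3] eta'[of 6] eta'[of 9] eta'[of 18] by simp_all
  have main: "E 2 ^ 2 / E 1 = E 9 ^ 2 * E 6 / (E 18 * E 3) + q * (E 18 ^ 2 / E 9)"
    using psi_3_dissection[OF q] by (simp add: E_def)
  have nzs: "E 1 \<noteq> 0" "E 2 \<noteq> 0" "E 3 \<noteq> 0" "E 6 \<noteq> 0" "E 9 \<noteq> 0" "E 18 \<noteq> 0"
    by (simp_all add: nz)
  have "w_fun \<tau> = q * E 1 * E 18 ^ 2 / (E 2 ^ 2 * E 9)"
  proof -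
    have "w_fun \<tau> = (h * E 1) * (h ^ 6 * E 6) ^ 2 / ((h ^ 2 * E 2) ^ 2 * (h ^ 3 * E 3)) *
            ((h ^ 3 * E 3) * (h ^ 18 * E 18) ^ 2 / ((h ^ 6 * E 6) ^ 2 * (h ^ 9 * E 9)))"
      by (simp only: e [symmetric] w_fun_def X_fun_def) simp
    also have "\<dots> = (h * E 1) * (h ^ 18 * E 18) ^ 2 / ((h ^ 2 * E 2) ^ 2 * (h ^ 9 * E 9))"
      using nzs h by (simp del: power_mult_distrib)
    also have "(h * E 1) * (h ^ 18 * E 18) ^ 2 = h ^ 37 * (E 1 * E 18 ^ 2)" by algebra
    also have "(h ^ 2 * E 2) ^ 2 * (h ^ 9 * E 9) = h ^ 13 * (E 2 ^ 2 * E 9)" by algebra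
    also have "h ^ 37 = h ^ 13 * h ^ 24" by (simp flip: power_add)
    finally show ?thesis using h by (simp add: hq mult_ac)
  qed
  moreover have "u_fun \<tau> = q * E 3 * E 18 ^ 3 / (E 6 * E 9 ^ 3)"
  proof -
    have "u_fun \<tau> = (h ^ 3 * E 3) * (h ^ 18 * E 18) ^ 3 / ((h ^ 6 * E 6) * (h ^ 9 * E 9) ^ 3)"
      by (simp only: e [symmetric] u_fun_def)
    also have "(h ^ 3 * E 3) * (h ^ 18 * E 18) ^ 3 = h ^ 57 * (E 3 * E 18 ^ 3)" by algebra
    also have "(h ^ 6 * E 6) * (h ^ 9 * E 9) ^ 3 = h ^ 33 * (E 6 * E 9 ^ 3)" by algebra
    also have "h ^ 57 = h ^ 33 * h ^ 24" by (simp flip: power_add)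
    finally show ?thesis using h by (simp add: hq mult_ac)
  qed
  moreover have "E 6 * E 9 ^ 3 / (q * E 3 * E 18 ^ 3) = (E 9 ^ 2 * E 6 / (E 18 * E 3)) / (q * (E 18 ^ 2 / E 9))"
    using nz[of 3] nz[of 6] nz[of 9] nz[of 18] q by (simp add: field_simps eval_nat_numeral)
  moreover have "\<dots> = (E 2 ^ 2 / E 1) / (q * (E 18 ^ 2 / E 9)) - 1"
  proof -
    have split: "a / b = (a + b) / b - 1" if "b \<noteq> 0" for a b :: complex
      using that by (simp add: field_simps)
    show ?thesis unfolding main by (rule split) (use nzs q in simp)
  qed
  moreover have "1 / (q * E 1 * E 18 ^ 2 / (E 2 ^ 2 * E 9)) = (E 2 ^ 2 / E 1) / (q * (E 18 ^ 2 / E 9))"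
    by simp
  moreover have "1 / (q * E 3 * E 18 ^ 3 / (E 6 * E 9 ^ 3)) = E 6 * E 9 ^ 3 / (q * E 3 * E 18 ^ 3)"
    by simp
  ultimately show ?thesis by metis
qed

section \<open>The eta function under integral matrices\<close>

abbreviation a11 :: "int ^ 2 ^ 2 \<Rightarrow> int" where "a11 A \<equiv> vec_nth (vec_nth A 1) 1"
abbreviation a12 :: "int ^ 2 ^ 2 \<Rightarrow> int" where "a12 A \<equiv> vec_nth (vec_nth A 1) 2"
abbreviation a21 :: "int ^ 2 ^ 2 \<Rightarrow> int" where "a21 A \<equiv> vec_nth (vec_nth A 2) 1"
abbreviation a22 :: "int ^ 2 ^ 2 \<Rightarrow> int" where "a22 A \<equiv> vec_nth (vec_nth A 2) 2"

lemma Im_linear_frac: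
  "Im ((of_int a * \<tau> + of_int b) / (of_int c * \<tau> + of_int d)) =
     of_int (a * d - b * c) * Im \<tau> / norm (of_int c * \<tau> + of_int d) ^ 2"
  by (simp add: Im_divide cmod_power2 algebra_simps)

lemma cocycle_nonzero:
  assumes "Im \<tau> > 0" "c \<noteq> 0 \<or> d \<noteq> (0::int)"
  shows "of_int c * \<tau> + of_int d \<noteq> 0"
proof
  assume *: "of_int c * \<tau> + of_int d = 0"
  have "Im (of_int c * \<tau> + of_int d) = of_int c * Im \<tau>" by simp
  with * assms have "c = 0" by auto
  with * assms show False by simp
qed

lemma Im_linear_frac_pos:
  assumes "Im \<tau> > 0" "a * d - b * c > (0::int)"
  shows "Im ((of_int a * \<tau> + of_int b) / (of_int c * \<tau> + of_int d)) > 0"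
proof -
  have "c \<noteq> 0 \<or> d \<noteq> 0" using assms(2) by auto
  from cocycle_nonzero[OF assms(1) this] show ?thesis
    unfolding Im_linear_frac using assms
    by (intro divide_pos_pos mult_pos_pos) (auto simp only: of_int_0_less_iff zero_less_norm_iff intro!: zero_less_power)
qed

text \<open>
  Euclid's algorithm on the first column: a translation reduces \<open>a\<close> modulo \<open>c\<close>, and an inversion exchanges
  the two rows. It ends with an upper triangular matrix of the same determinant whose corner entry is
  \<open>gcd a c\<close>. Determinants other than \<open>1\<close> occur because \<open>\<tau> \<mapsto> \<delta> \<gamma>\<tau>\<close> has determinant \<open>\<delta>\<close>.
\<close>

lemma modular_invariant_hermite:
  fixes F :: "complex \<Rightarrow> 'a"
  assumes T: "\<And>\<tau> n::int. Im \<tau> > 0 \<Longrightarrow> F (\<tau> + of_int n) = F \<tau>"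
    and S: "\<And>\<tau>. Im \<tau> > 0 \<Longrightarrow> F (-1/\<tau>) = F \<tau>"
    and det: "a * d - b * c = n" "n > 0"
  obtains B where "\<And>\<tau>. Im \<tau> > 0 \<Longrightarrow> F ((of_int a * \<tau> + of_int b) / (of_int c * \<tau> + of_int d)) =
                      F ((of_int (gcd a c) * \<tau> + of_int B) / of_int (n div gcd a c))"
proof -
  have "\<exists>B. \<forall>\<tau>. Im \<tau> > 0 \<longrightarrow> F ((of_int a * \<tau> + of_int b) / (of_int c * \<tau> + of_int d)) =
                      F ((of_int (gcd a c) * \<tau> + of_int B) / of_int (n div gcd a c))"
    using det(1)
  proof (induction "nat \<bar>c\<bar>" arbitrary: a b c d rule: less_induct)
    case less
    show ?case
    proof (cases "c = 0")
      case True
      hence ad: "a * d = n" using less.prems by simp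
      hence "a \<noteq> 0" "d \<noteq> 0" using det(2) by auto
      have "\<bar>d\<bar> = n div \<bar>a\<bar>"
        using ad det(2) \<open>a \<noteq> 0\<close> by (metis abs_mult abs_of_pos nonzero_mult_div_cancel_left abs_eq_0)
      hence "n div gcd a c = \<bar>d\<bar>" "gcd a c = \<bar>a\<bar>" using True by simp_all
      moreover have "sgn a = sgn d" using ad det(2) by (auto simp: sgn_if zero_less_mult_iff split: if_splits)
      hence "(of_int a * \<tau> + of_int b) / of_int d = 
             (of_int \<bar>a\<bar> * \<tau> + of_int (sgn a * b)) / of_int \<bar>d\<bar>" for \<tau> :: complex
        using \<open>a \<noteq> 0\<close> \<open>d \<noteq> 0\<close> by (cases "a > 0"; cases "d > 0") (auto simp: sgn_if field_simps)
      ultimately show ?thesis using True by (intro exI[of _ "sgn a * b"]) simp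
    next
      case False
      \<comment> \<open>The entry \<open>r\<close> is smaller than \<open>c\<close> in modulus, so the induction hypothesis applies to the matrix with rows
        \<open>(-c, -d)\<close> and \<open>(r, b - k d)\<close>.\<close>
      define r k where "r = a mod c" and "k = a div c"
      have a: "a = c * k + r" by (simp add: r_def k_def)
      have less': "nat \<bar>r\<bar> < nat \<bar>c\<bar>" using False abs_mod_less[of c a] by (simp add: r_def)
      have det': "(-c) * (b - k * d) - (- d) * r = n" using less.prems by (simp add: a algebra_simps)
      have g: "gcd (-c) r = gcd a c" by (simp add: r_def gcd_red_int [of a c])
      from less.hyps[OF less' det'] obtain B where B: "\<And>\<tau>. Im \<tau> > 0 \<Longrightarrow>
          F ((of_int (-c) * \<tau> + of_int (-d)) / (of_int r * \<tau> + of_int (b - k * d))) =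
            F ((of_int (gcd a c) * \<tau> + of_int B) / of_int (n div gcd a c))"
        unfolding g by blast
      have "F ((of_int a * \<tau> + of_int b) / (of_int c * \<tau> + of_int d)) =
             F ((of_int (-c) * \<tau> + of_int (-d)) / (of_int r * \<tau> + of_int (b - k * d)))" if \<tau>: "Im \<tau> > 0" for \<tau>
      proof -
        define \<sigma> where "\<sigma> = (of_int r * \<tau> + of_int (b - k * d)) / (of_int c * \<tau> + of_int d)"
        have nz: "of_int c * \<tau> + of_int d \<noteq> 0" using False by (intro cocycle_nonzero \<tau>) auto
        have "r * d - (b - k * d) * c = n" using det' by (simp add: algebra_simps)
        hence \<sigma>: "Im \<sigma> > 0" unfolding \<sigma>_def using det(2) by (intro Im_linear_frac_pos \<tau>) auto
        have "(of_int a * \<tau> + of_int b) / (of_int c * \<tau> + of_int d) = \<sigma> + of_int k"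
          using nz by (simp add: \<sigma>_def a field_simps)
        hence "F ((of_int a * \<tau> + of_int b) / (of_int c * \<tau> + of_int d)) = F (-1/\<sigma>)"
          using T[OF \<sigma>] S[OF \<sigma>] by simp
        also have "-1/\<sigma> = (of_int (-c) * \<tau> + of_int (-d)) / (of_int r * \<tau> + of_int (b - k * d))"
          by (simp add: \<sigma>_def)
        finally show ?thesis .
      qed
      thus ?thesis using B by auto
    qed
  qed
  thus ?thesis using that by blast
qed

text \<open>
  The weight \<open>1/2\<close> of \<open>\<eta>\<close> is absorbed by the imaginary part, which makes this function invariant.
\<close>

definition Phi :: "complex \<Rightarrow> real" where
  "Phi \<tau> = Im \<tau> * norm (dedekind_eta \<tau>) ^ 4"

lemma norm_eta: "norm (dedekind_eta \<tau>) = exp (- pi * Im \<tau> / 12) * norm (euler (qpow 1 \<tau>))"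
  by (simp add: eta_eq norm_mult norm_qpow of_rat_divide)

lemma qpow_1_periodic: "qpow 1 (\<tau> + of_int n) = qpow 1 \<tau>"
  using e2pi_eq_1_iff[of "of_int n"] by (simp add: qpow_1 ring_distribs exp_add)

lemma norm_eta_plus_int: "norm (dedekind_eta (\<tau> + of_int n)) = norm (dedekind_eta \<tau>)"
  by (simp add: norm_eta qpow_1_periodic)

lemma Phi_plus_int: "Phi (\<tau> + of_int n) = Phi \<tau>"
  by (simp add: Phi_def norm_eta_plus_int)

lemma Phi_inversion: 
  assumes "Im \<tau> > 0"
  shows "Phi (-1/\<tau>) = Phi \<tau>"
proof -
  have "\<tau> \<noteq> 0" using assms by auto
  have "Im (-1/\<tau>) = Im \<tau> / norm \<tau> ^ 2"
    by (simp add: Im_divide cmod_power2)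
  moreover have "norm (dedekind_eta (-1/\<tau>)) ^ 4 = (norm (dedekind_eta (-1/\<tau>)) ^ 2) ^ 2"
    by (simp flip: power_mult)
  hence "norm (dedekind_eta (-1/\<tau>)) ^ 4 = norm \<tau> ^ 2 * norm (dedekind_eta \<tau>) ^ 4"
    unfolding norm_eta_inversion[OF assms] by (simp add: power_mult_distrib flip: power_mult)
  ultimately show ?thesis using \<open>\<tau> \<noteq> 0\<close> unfolding Phi_def by simp
qed

lemma SL2Z_D: "A \<in> SL2Z \<Longrightarrow> a11 A * a22 A - a12 A * a21 A = 1"
  by (simp add: SL2Z_def det_2)

lemma moebius_denom_nonzero:
  assumes "A \<in> SL2Z" "Im \<tau> > 0"
  shows "of_int (a21 A) * \<tau> + of_int (a22 A) \<noteq> 0"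
  using SL2Z_D[OF assms(1)] by (intro cocycle_nonzero assms) auto

lemma Im_moebius_pos:
  assumes "A \<in> SL2Z" "Im \<tau> > 0"
  shows "Im (moebius A \<tau>) > 0"
  unfolding moebius_def using SL2Z_D[OF assms(1)] by (intro Im_linear_frac_pos assms) auto

text \<open>
  The invariance of \<open>Phi\<close>, solved for \<open>|\<eta>|\<^sup>4\<close>. The factor \<open>Im \<tau> / Im (moebius A \<tau>)\<close> does not depend on
  \<open>\<delta>\<close>, so it cancels in eta quotients of weight \<open>0\<close>. In the upper triangular matrix only \<open>g\<close> and \<open>\<delta> div g\<close>
  affect the growth.
\<close>

lemma norm_eta_moebius:
  assumes A: "A \<in> SL2Z" and \<delta>: "\<delta> > (0::nat)"
  defines "g \<equiv> gcd (int \<delta>) (a21 A)"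
  obtains B :: int where "\<And>\<tau>. Im \<tau> > 0 \<Longrightarrow> 
    norm (dedekind_eta (of_nat \<delta> * moebius A \<tau>)) ^ 4 =
      (Im \<tau> / Im (moebius A \<tau>)) * 
      (norm (dedekind_eta ((of_int g * \<tau> + of_int B) / of_int (int \<delta> div g))) ^ 4 / of_int (int \<delta> div g) ^ 2)"
proof -
  define a b c d where "a = a11 A" and "b = a12 A" and "c = a21 A" and "d = a22 A"
  have det: "a * d - b * c = 1" using SL2Z_D[OF A] by (simp add: a_def b_def c_def d_def)
  define D where "D = int \<delta> div g"
  have "coprime a c"
  proof (rule coprimeI)
    fix x assume "x dvd a" "x dvd c"
    hence "x dvd a * d - b * c" by auto
    thus "is_unit x" by (simp add: det)
  qed
  hence g: "gcd (int \<delta> * a) c = g" 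
    by (simp add: g_def c_def gcd_mult_left_right_cancel coprime_commute)
  have gpos: "g > 0" using \<delta> by (simp add: g_def)
  have gD: "g * D = int \<delta>" by (simp add: g_def D_def)
  hence Dpos: "D > 0" using \<delta> gpos by (metis of_nat_0_less_iff zero_less_mult_pos)
  have det': "(int \<delta> * a) * d - (int \<delta> * b) * c = int \<delta>"
  proof -
    have "(int \<delta> * a) * d - (int \<delta> * b) * c = int \<delta> * (a * d - b * c)" by (simp add: algebra_simps)
    thus ?thesis using det by simp
  qed
  obtain B where B: "\<And>\<tau>. Im \<tau> > 0 \<Longrightarrow> Phi ((of_int (int \<delta> * a) * \<tau> + of_int (int \<delta> * b)) / (of_int c * \<tau> + of_int d)) =
                      Phi ((of_int g * \<tau> + of_int B) / of_int D)"
    using modular_invariant_hermite[of Phi, OF Phi_plus_int Phi_inversion det'] \<delta> unfolding g D_def by auto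
  show ?thesis
  proof (rule that[of B])
    fix \<tau> assume \<tau>: "Im \<tau> > 0"
    define \<sigma> where "\<sigma> = (of_int g * \<tau> + of_int B) / of_int D"
    have \<sigma>: "Im \<sigma> = of_int g * Im \<tau> / of_int D" by (simp add: \<sigma>_def)
    have pos: "Im (moebius A \<tau>) > 0" by (rule Im_moebius_pos[OF A \<tau>])
    have "(of_int (int \<delta> * a) * \<tau> + of_int (int \<delta> * b)) / (of_int c * \<tau> + of_int d) = of_nat \<delta> * moebius A \<tau>"
      by (simp add: moebius_def a_def b_def c_def d_def algebra_simps)
    with B[OF \<tau>] have "Phi (of_nat \<delta> * moebius A \<tau>) = Phi \<sigma>" by (simp add: \<sigma>_def)
    hence "real \<delta> * Im (moebius A \<tau>) * norm (dedekind_eta (of_nat \<delta> * moebius A \<tau>)) ^ 4 =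
             of_int g * Im \<tau> / of_int D * norm (dedekind_eta \<sigma>) ^ 4"
      by (simp add: Phi_def \<sigma>)
    moreover have "real \<delta> = of_int g * of_int D" using gD by (metis of_int_mult of_int_of_nat_eq)
    ultimately show "norm (dedekind_eta (of_nat \<delta> * moebius A \<tau>)) ^ 4 =
      (Im \<tau> / Im (moebius A \<tau>)) * (norm (dedekind_eta ((of_int g * \<tau> + of_int B) / of_int (int \<delta> div g))) ^ 4 / of_int (int \<delta> div g) ^ 2)"
      using pos gpos Dpos unfolding \<sigma>_def [symmetric] D_def [symmetric]
      by (simp add: field_simps power2_eq_square)
  qed
qed

text \<open>
  Here \<open>g = \<delta>\<close>, and the upper triangular matrix is \<open>\<tau> \<mapsto> \<delta> \<tau> + B\<close>.
\<close>

lemma norm_eta_moebius_Gamma0: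
  assumes A: "A \<in> SL2Z" and \<delta>: "\<delta> > 0" "int \<delta> dvd a21 A" and \<tau>: "Im \<tau> > 0"
  shows "norm (dedekind_eta (of_nat \<delta> * moebius A \<tau>)) ^ 4 =
           (Im \<tau> / Im (moebius A \<tau>)) * norm (dedekind_eta (of_nat \<delta> * \<tau>)) ^ 4"
proof -
  have g: "gcd (int \<delta>) (a21 A) = int \<delta>" using \<delta> by simp
  obtain B where "\<And>\<tau>. Im \<tau> > 0 \<Longrightarrow> 
    norm (dedekind_eta (of_nat \<delta> * moebius A \<tau>)) ^ 4 =
      (Im \<tau> / Im (moebius A \<tau>)) * 
      (norm (dedekind_eta ((of_int (int \<delta>) * \<tau> + of_int B) / of_int (int \<delta> div int \<delta>))) ^ 4 / of_int (int \<delta> div int \<delta>) ^ 2)"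
    using norm_eta_moebius[OF A \<delta>(1)] unfolding g by blast
  from this[OF \<tau>] show ?thesis using \<delta>(1) by (simp add: norm_eta_plus_int)
qed

section \<open>The modular group\<close>

lemma matrix_eqI_2:
  "\<lbrakk>a11 A = a11 B; a12 A = a12 B; a21 A = a21 B; a22 A = a22 B\<rbrakk> \<Longrightarrow> A = B"
  by (simp add: vec_eq_iff forall_2)

lemma mult_entries [simp]:
  "a11 (A ** B) = a11 A * a11 B + a12 A * a21 B" "a12 (A ** B) = a11 A * a12 B + a12 A * a22 B"
  "a21 (A ** B) = a21 A * a11 B + a22 A * a21 B" "a22 (A ** B) = a21 A * a12 B + a22 A * a22 B"
  by (simp_all add: matrix_matrix_mult_def sum_2)

lemma SL2Z_I: "a11 A * a22 A - a12 A * a21 A = 1 \<Longrightarrow> A \<in> SL2Z"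
  by (simp add: SL2Z_def det_2)

lemma SL2Z_mult: "A \<in> SL2Z \<Longrightarrow> B \<in> SL2Z \<Longrightarrow> A ** B \<in> SL2Z"
  by (simp add: SL2Z_def det_mul)

definition adjugate2 :: "int ^ 2 ^ 2 \<Rightarrow> int ^ 2 ^ 2" where
  "adjugate2 A = vector [vector [a22 A, - a12 A], vector [- a21 A, a11 A]]"

lemma adjugate2_entries [simp]:
  "a11 (adjugate2 A) = a22 A" "a12 (adjugate2 A) = - a12 A"
  "a21 (adjugate2 A) = - a21 A" "a22 (adjugate2 A) = a11 A"
  by (simp_all add: adjugate2_def)

lemma mat_1_entries [simp]: "a11 (mat 1) = 1" "a12 (mat 1) = 0" "a21 (mat 1) = 0" "a22 (mat 1) = 1"
  by (simp_all add: mat_def)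

lemma adjugate2_SL2Z: "A \<in> SL2Z \<Longrightarrow> adjugate2 A \<in> SL2Z"
  using SL2Z_D[of A] by (intro SL2Z_I) (simp add: mult.commute)

lemma adjugate2_inverse:
  assumes "A \<in> SL2Z"
  shows "A ** adjugate2 A = mat 1" "adjugate2 A ** A = mat 1"
  using SL2Z_D[OF assms] by (auto intro!: matrix_eqI_2 simp: algebra_simps)

lemma matrix_inv_SL2Z:
  assumes "A \<in> SL2Z"
  shows "matrix_inv A = adjugate2 A"
proof -
  have "A ** matrix_inv A = mat 1 \<and> matrix_inv A ** A = mat 1"
    unfolding matrix_inv_def by (rule someI[of _ "adjugate2 A"]) (simp add: adjugate2_inverse[OF assms])
  thus ?thesis by (metis adjugate2_inverse(2)[OF assms] matrix_mul_assoc matrix_mul_lid matrix_mul_rid)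
qed

lemma moebius_mult:
  assumes "A \<in> SL2Z" "B \<in> SL2Z" "Im \<tau> > 0"
  shows "moebius (A ** B) \<tau> = moebius A (moebius B \<tau>)"
proof -
  define n d where "n = of_int (a11 B) * \<tau> + of_int (a12 B)" and "d = of_int (a21 B) * \<tau> + of_int (a22 B)"
  have d: "d \<noteq> 0" unfolding d_def by (rule moebius_denom_nonzero[OF assms(2,3)])
  have "of_int (a21 A) * (n / d) + of_int (a22 A) \<noteq> 0"
    using moebius_denom_nonzero[OF assms(1) Im_moebius_pos[OF assms(2,3)]] by (simp add: moebius_def n_def d_def)
  moreover have "of_int (a21 A) * (n / d) + of_int (a22 A) = (of_int (a21 A) * n + of_int (a22 A) * d) / d"
    "of_int (a11 A) * (n / d) + of_int (a12 A) = (of_int (a11 A) * n + of_int (a12 A) * d) / d"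
    using d by (simp_all add: field_simps)
  moreover have "moebius (A ** B) \<tau> = (of_int (a11 A) * n + of_int (a12 A) * d) / (of_int (a21 A) * n + of_int (a22 A) * d)"
    by (simp add: moebius_def n_def d_def algebra_simps)
  moreover have "moebius A (moebius B \<tau>) = (of_int (a11 A) * (n / d) + of_int (a12 A)) / (of_int (a21 A) * (n / d) + of_int (a22 A))"
    by (simp add: moebius_def n_def d_def)
  ultimately show ?thesis using d by simp
qed

lemma moebius_1 [simp]: "moebius (mat 1) \<tau> = \<tau>"
  by (simp add: moebius_def)

text \<open>
  Every \<open>\<gamma>\<close> maps some cusp to \<open>\<infinity>\<close>, so the quantification over cusps amounts to one over all of
  \<open>SL\<^sub>2(\<int>)\<close>, and inverses may be replaced by the matrices themselves.
\<close>

lemma meromorphic_at_cusps_iff: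
  "meromorphic_at_cusps f \<longleftrightarrow> (\<forall>\<gamma>\<in>SL2Z. has_q_expansion (f \<circ> moebius \<gamma>))"
proof safe
  fix \<gamma> assume f: "meromorphic_at_cusps f" and \<gamma>: "\<gamma> \<in> SL2Z"
  define \<delta> where "\<delta> = adjugate2 \<gamma>"
  have \<delta>: "\<delta> \<in> SL2Z" "matrix_inv \<delta> = \<gamma>"
    using \<gamma> by (auto simp: \<delta>_def matrix_inv_SL2Z adjugate2_SL2Z intro!: matrix_eqI_2)
  have "\<exists>r. moebius_cusp \<delta> r = None"
  proof (cases "a21 \<delta> = 0")
    case True
    hence "moebius_cusp \<delta> None = None" by simp
    thus ?thesis by blast
  next
    case False
    hence "moebius_cusp \<delta> (Some (- of_int (a22 \<delta>) / of_int (a21 \<delta>))) = None" by simp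
    thus ?thesis by blast
  qed
  with f \<delta> show "has_q_expansion (f \<circ> moebius \<gamma>)"
    unfolding meromorphic_at_cusps_def by metis
next
  assume "\<forall>\<gamma>\<in>SL2Z. has_q_expansion (f \<circ> moebius \<gamma>)"
  thus "meromorphic_at_cusps f"
    unfolding meromorphic_at_cusps_def by (simp add: matrix_inv_SL2Z adjugate2_SL2Z)
qed

lemma Gamma0_SL2Z: "A \<in> Gamma0 N \<Longrightarrow> A \<in> SL2Z"
  by (simp add: Gamma0_def)

lemma Gamma0_iff: "A \<in> Gamma0 N \<longleftrightarrow> A \<in> SL2Z \<and> int N dvd a21 A"
  by (simp add: Gamma0_def cong_0_iff)

text \<open>
  The right coset of a matrix with respect to \<open>\<Gamma>\<^sub>0(N)\<close> depends only on its lower row modulo \<open>N\<close>.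
\<close>

lemma Gamma0_coset:
  assumes "A \<in> SL2Z" "B \<in> SL2Z" "[a21 A = a21 B] (mod int N)" "[a22 A = a22 B] (mod int N)"
  shows "A ** adjugate2 B \<in> Gamma0 N"
proof -
  have "[a21 A * a22 B - a22 A * a21 B = a21 B * a22 B - a22 B * a21 B] (mod int N)"
    by (intro cong_diff cong_mult assms cong_refl)
  thus ?thesis using assms(1,2) by (simp add: Gamma0_iff SL2Z_mult adjugate2_SL2Z cong_0_iff)
qed

lemma holomorphic_moebius: 
  assumes "A \<in> SL2Z"
  shows "moebius A holomorphic_on {\<tau>. Im \<tau> > 0}"
  unfolding moebius_def by (intro holomorphic_intros) (use moebius_denom_nonzero[OF assms] in auto)

lemma open_uhp: "open {\<tau>. Im \<tau> > Y}"
  by (simp add: open_halfspace_Im_gt)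

lemma isCont_halfplane:
  assumes "f holomorphic_on {\<tau>. Im \<tau> > Y}" "Im z > Y"
  shows "isCont f z"
  using holomorphic_on_imp_continuous_on[OF assms(1)] assms(2)
  by (simp add: continuous_on_eq_continuous_at open_uhp)

lemma eventually_at_halfplane: "Im z > Y \<Longrightarrow> eventually (\<lambda>w. Im w > Y) (at z)"
  using eventually_at_in_open'[OF open_uhp, of z Y] by simp

lemma connected_uhp: "connected {\<tau>. Im \<tau> > Y}"
  by (intro convex_connected) (simp add: convex_halfspace_Im_gt)

lemma holomorphic_compose_moebius:
  assumes "f holomorphic_on {\<tau>. Im \<tau> > 0}" "A \<in> SL2Z"
  shows "(\<lambda>\<tau>. f (moebius A \<tau>)) holomorphic_on {\<tau>. Im \<tau> > 0}"
  using holomorphic_on_compose_gen[OF holomorphic_moebius[OF assms(2)] assms(1)] Im_moebius_pos[OF assms(2)]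
  by (auto simp: o_def)

section \<open>Absolute values of u and w\<close>

lemma w_fun_eq:
  assumes "Im \<tau> > 0"
  shows "w_fun \<tau> = dedekind_eta \<tau> * dedekind_eta (18 * \<tau>) ^ 2 / (dedekind_eta (2 * \<tau>) ^ 2 * dedekind_eta (9 * \<tau>))"
  using eta_nonzero[of "3 * \<tau>"] eta_nonzero[of "6 * \<tau>"] assms
  by (simp add: w_fun_def X_fun_def)

lemma eta_scaled_nonzero: "Im \<tau> > 0 \<Longrightarrow> dedekind_eta (numeral n * \<tau>) \<noteq> 0"
  by (rule eta_nonzero) simp

lemma w_fun_nonzero: "Im \<tau> > 0 \<Longrightarrow> w_fun \<tau> \<noteq> 0"
  by (simp add: w_fun_eq eta_nonzero eta_scaled_nonzero)

lemma u_fun_nonzero: "Im \<tau> > 0 \<Longrightarrow> u_fun \<tau> \<noteq> 0"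
  by (simp add: u_fun_def eta_scaled_nonzero)

lemma holomorphic_eta_scaled: "(\<lambda>\<tau>. dedekind_eta (numeral n * \<tau>)) holomorphic_on {\<tau>. Im \<tau> > 0}"
  by (rule holomorphic_on_compose_gen[OF _ holomorphic_eta, unfolded o_def]) (auto intro!: holomorphic_intros)

lemma holomorphic_w_fun: "w_fun holomorphic_on {\<tau>. Im \<tau> > 0}"
proof (rule holomorphic_transform)
  show "(\<lambda>\<tau>. dedekind_eta \<tau> * dedekind_eta (18 * \<tau>) ^ 2 / (dedekind_eta (2 * \<tau>) ^ 2 * dedekind_eta (9 * \<tau>)))
          holomorphic_on {\<tau>. Im \<tau> > 0}"
    by (intro holomorphic_intros holomorphic_eta holomorphic_eta_scaled) (auto simp: eta_scaled_nonzero)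
qed (auto simp: w_fun_eq)

lemma holomorphic_u_fun: "u_fun holomorphic_on {\<tau>. Im \<tau> > 0}"
  unfolding u_fun_def
  by (intro holomorphic_intros holomorphic_eta_scaled) (auto simp: eta_scaled_nonzero)

text \<open>
  In both quotients the exponents of the eta factors add up to \<open>0\<close>, so the common factor in the
  transformation of \<open>|\<eta>(\<delta> \<tau>)|\<^sup>4\<close> cancels.
\<close>

lemma
  assumes A: "A \<in> Gamma0 18" and \<tau>: "Im \<tau> > 0"
  shows norm_w_fun_Gamma0: "norm (w_fun (moebius A \<tau>)) = norm (w_fun \<tau>)"
    and norm_u_fun_Gamma0: "norm (u_fun (moebius A \<tau>)) = norm (u_fun \<tau>)"
proof -
  have SL: "A \<in> SL2Z" and c: "18 dvd a21 A" using A by (auto simp: Gamma0_iff)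
  have \<sigma>: "Im (moebius A \<tau>) > 0" by (rule Im_moebius_pos[OF SL \<tau>])
  define \<rho> where "\<rho> = Im \<tau> / Im (moebius A \<tau>)"
  have \<rho>: "\<rho> > 0" using \<tau> \<sigma> by (simp add: \<rho>_def)
  have e: "norm (dedekind_eta (of_nat \<delta> * moebius A \<tau>)) ^ 4 = \<rho> * norm (dedekind_eta (of_nat \<delta> * \<tau>)) ^ 4"
    if "\<delta> dvd 18" for \<delta>
  proof -
    have "int \<delta> dvd a21 A" using that c by (metis dvd_trans int_dvd_int_iff of_nat_numeral)
    moreover have "\<delta> > 0" using that by (auto intro: Nat.gr0I)
    ultimately show ?thesis unfolding \<rho>_def by (intro norm_eta_moebius_Gamma0[OF SL _ _ \<tau>])
  qed
  have es: "norm (dedekind_eta (moebius A \<tau>)) ^ 4 = \<rho> * norm (dedekind_eta \<tau>) ^ 4"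
    "norm (dedekind_eta (2 * moebius A \<tau>)) ^ 4 = \<rho> * norm (dedekind_eta (2 * \<tau>)) ^ 4"
    "norm (dedekind_eta (3 * moebius A \<tau>)) ^ 4 = \<rho> * norm (dedekind_eta (3 * \<tau>)) ^ 4"
    "norm (dedekind_eta (6 * moebius A \<tau>)) ^ 4 = \<rho> * norm (dedekind_eta (6 * \<tau>)) ^ 4"
    "norm (dedekind_eta (9 * moebius A \<tau>)) ^ 4 = \<rho> * norm (dedekind_eta (9 * \<tau>)) ^ 4"
    "norm (dedekind_eta (18 * moebius A \<tau>)) ^ 4 = \<rho> * norm (dedekind_eta (18 * \<tau>)) ^ 4"
    using e[of 1] e[of 2] e[of 3] e[of 6] e[of 9] e[of 18] by simp_all
  have swap: "(x ^ k) ^ 4 = (x ^ 4) ^ k" for x :: real and k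
    by (simp add: mult.commute flip: power_mult)
  have "norm (w_fun (moebius A \<tau>)) ^ 4 = norm (w_fun \<tau>) ^ 4"
    unfolding w_fun_eq[OF \<tau>] w_fun_eq[OF \<sigma>] norm_divide norm_mult norm_power power_divide power_mult_distrib swap es
    using \<rho> by (simp add: power2_eq_square)
  thus "norm (w_fun (moebius A \<tau>)) = norm (w_fun \<tau>)"
    by (rule power_eq_imp_eq_base) auto
  have "norm (u_fun (moebius A \<tau>)) ^ 4 = norm (u_fun \<tau>) ^ 4"
    unfolding u_fun_def norm_divide norm_mult norm_power power_divide power_mult_distrib swap es
    using \<rho> by (simp add: power3_eq_cube)
  thus "norm (u_fun (moebius A \<tau>)) = norm (u_fun \<tau>)"
    by (rule power_eq_imp_eq_base) auto
qed

text \<open>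
  The quotient has modulus \<open>1\<close> throughout, so the maximum modulus principle makes it constant.
\<close>

lemma holomorphic_norm_eq_imp_proportional:
  assumes f: "f holomorphic_on S" and g: "g holomorphic_on S" and S: "open S" "connected S"
    and eq: "\<And>z. z \<in> S \<Longrightarrow> norm (f z) = norm (g z)" and nz: "\<And>z. z \<in> S \<Longrightarrow> g z \<noteq> 0"
  obtains c where "\<And>z. z \<in> S \<Longrightarrow> f z = c * g z"
proof (cases "S = {}")
  case False
  then obtain \<xi> where \<xi>: "\<xi> \<in> S" by auto
  have "(\<lambda>z. f z / g z) constant_on S"
  proof (rule maximum_modulus_principle[OF _ S S(1) order_refl \<xi>])
    show "(\<lambda>z. f z / g z) holomorphic_on S" by (intro holomorphic_intros f g nz)
    show "norm (f z / g z) \<le> norm (f \<xi> / g \<xi>)" if "z \<in> S" for z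
      using that \<xi> eq nz by (simp add: norm_divide)
  qed
  then obtain c where "\<And>z. z \<in> S \<Longrightarrow> f z / g z = c" by (auto simp: constant_on_def)
  hence "\<And>z. z \<in> S \<Longrightarrow> f z = c * g z" using nz by (metis nonzero_eq_divide_eq)
  thus ?thesis by (rule that)
qed (use that in auto)

text \<open>
  With \<open>g = gcd(2, c)\<close> and \<open>h = gcd(9, c)\<close>, so that \<open>gcd(18, c) = g h\<close>, the difference of the two sides is
  \<open>(g\<^sup>2 - 1) (1 - h\<^sup>2/9)\<close>. It is negative only for \<open>g = 2\<close> and \<open>h = 9\<close>.
\<close>

lemma cusp_exponent_nonneg:
  fixes c :: int
  assumes "\<not> 18 dvd c"
  shows "real_of_int (gcd 18 c) ^ 2 / 9 + 1 \<le> real_of_int (gcd 2 c) ^ 2 + real_of_int (gcd 9 c) ^ 2 / 9"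
proof -
  define k r where "k = c div 18" and "r = c mod 18"
  have c: "c = k * 18 + r" by (simp add: k_def r_def)
  have g18: "gcd 18 c = gcd 18 r" unfolding c by (rule gcd_add_mult)
  have "gcd 2 ((9 * k) * 2 + r) = gcd 2 r" "gcd 9 ((2 * k) * 9 + r) = gcd 9 r" by (rule gcd_add_mult)+
  hence g: "gcd 2 c = gcd 2 r" "gcd 9 c = gcd 9 r" unfolding c by (simp_all add: algebra_simps)
  have "r \<noteq> 0" "0 \<le> r" "r < 18" using assms by (auto simp: r_def dvd_eq_mod_eq_0)
  hence "r = 1 \<or> r = 2 \<or> r = 3 \<or> r = 4 \<or> r = 5 \<or> r = 6 \<or> r = 7 \<or> r = 8 \<or> r = 9 \<or>
         r = 10 \<or> r = 11 \<or> r = 12 \<or> r = 13 \<or> r = 14 \<or> r = 15 \<or> r = 16 \<or> r = 17" by arith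
  thus ?thesis unfolding g18 g by (elim disjE) (simp_all add: gcd_non_0_int)
qed

section \<open>Growth at the cusps\<close>

text \<open>
  The neighbourhoods of the cusp \<open>\<infinity>\<close>. Orders of growth at the cusps are stated with Landau symbols along
  this filter.
\<close>

definition im_top :: "complex filter" where "im_top = filtercomap Im at_top"

lemma eventually_im_top: "eventually P im_top \<longleftrightarrow> (\<exists>Y>0. \<forall>\<tau>. Im \<tau> > Y \<longrightarrow> P \<tau>)"
proof
  assume "eventually P im_top"
  then obtain Y where Y: "\<And>\<tau>. Im \<tau> > Y \<Longrightarrow> P \<tau>"
    by (auto simp: im_top_def eventually_filtercomap_at_top_dense)
  show "\<exists>Y>0. \<forall>\<tau>. Im \<tau> > Y \<longrightarrow> P \<tau>" by (rule exI[of _ "max Y 1"]) (auto intro: Y)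
qed (auto simp: im_top_def eventually_filtercomap_at_top_dense)

lemma eventually_im_topI: "Y > 0 \<Longrightarrow> (\<And>\<tau>. Im \<tau> > Y \<Longrightarrow> P \<tau>) \<Longrightarrow> eventually P im_top"
  unfolding eventually_im_top by blast

lemma eventually_im_top_pos: "eventually (\<lambda>\<tau>. Im \<tau> > Y) im_top"
  by (rule eventually_im_topI[of "max 1 Y"]) auto

lemma im_top_nontrivial [simp]: "im_top \<noteq> bot"
proof
  assume "im_top = bot"
  hence "eventually (\<lambda>_. False) im_top" by simp
  then obtain Y where "\<And>\<tau>. Im \<tau> > Y \<Longrightarrow> False" by (auto simp: eventually_im_top)
  from this[of "Complex 0 (Y + 1)"] show False by simp
qed

lemma filterlim_Im_im_top: "filterlim Im at_top im_top"
  by (simp add: im_top_def filterlim_filtercomap)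

lemma of_rat_inverse_of_nat: "of_rat (1 / of_nat h) = (1 / of_nat h :: 'a :: field_char_0)"
  by (simp add: of_rat_divide)

lemma norm_qpow_width: "norm (qpow (1 / of_nat h) \<tau>) = exp (- 2 * pi * Im \<tau> / h)"
  by (simp add: norm_qpow of_rat_inverse_of_nat)

lemma filterlim_qpow_width:
  assumes "h > 0"
  shows "filterlim (qpow (1 / of_nat h)) (at 0) im_top"
proof -
  have "((\<lambda>\<tau>. norm (qpow (1 / of_nat h) \<tau>)) \<longlongrightarrow> 0) im_top"
  proof -
    have "((\<lambda>y. exp (- 2 * pi * y / h)) \<longlongrightarrow> 0) at_top"
      using assms by real_asymp
    from filterlim_compose[OF this filterlim_Im_im_top] show ?thesis unfolding norm_qpow_width .
  qed
  thus ?thesis by (simp add: filterlim_at tendsto_norm_zero_iff)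
qed

lemma eta_theta_at_infinity:
  "(\<lambda>\<tau>. norm (dedekind_eta \<tau>) ^ 4) \<in> \<Theta>[im_top](\<lambda>\<tau>. exp (- (pi / 3) * Im \<tau>))"
proof (rule bigthetaI_tendsto[where c = 1])
  have "isCont euler 0"
    using holomorphic_on_imp_continuous_on[OF holomorphic_euler] by (simp add: continuous_on_eq_continuous_at)
  hence "((\<lambda>\<tau>. euler (qpow (1 / of_nat 1) \<tau>)) \<longlongrightarrow> euler 0) im_top"
    unfolding isCont_def by (rule filterlim_compose[OF _ filterlim_qpow_width]) simp
  from tendsto_power[OF tendsto_norm[OF this], of 4]
  have "((\<lambda>\<tau>. norm (euler (qpow 1 \<tau>)) ^ 4) \<longlongrightarrow> 1) im_top" by simp
  moreover have "norm (dedekind_eta \<tau>) ^ 4 / exp (- (pi / 3) * Im \<tau>) = norm (euler (qpow 1 \<tau>)) ^ 4" for \<tau>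
    by (simp add: norm_eta power_mult_distrib flip: exp_of_nat_mult)
  ultimately show "((\<lambda>\<tau>. norm (dedekind_eta \<tau>) ^ 4 / exp (- (pi / 3) * Im \<tau>)) \<longlongrightarrow> 1) im_top" by simp
qed auto

text \<open>
  The order at a cusp of a factor of an eta quotient: the leading term \<open>|q|\<^bsup>1/24\<^esup>\<close> of \<open>\<eta>\<close> is taken at
  \<open>(g \<tau> + B) / D\<close>, whose imaginary part is \<open>(g/D) Im \<tau>\<close> with \<open>g/D = g\<^sup>2/\<delta>\<close>.
\<close>

lemma eta_cusp_theta:
  assumes A: "A \<in> SL2Z" and \<delta>: "\<delta> > (0::nat)"
  defines "\<kappa> \<equiv> pi / 3 * (real_of_int (gcd (int \<delta>) (a21 A)) ^ 2 / \<delta>)"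
  shows "(\<lambda>\<tau>. norm (dedekind_eta (of_nat \<delta> * moebius A \<tau>)) ^ 4) \<in>
           \<Theta>[im_top](\<lambda>\<tau>. Im \<tau> / Im (moebius A \<tau>) * exp (- \<kappa> * Im \<tau>))"
proof -
  define g where "g = gcd (int \<delta>) (a21 A)"
  define D where "D = int \<delta> div g"
  have gpos: "g > 0" using \<delta> by (simp add: g_def)
  have gD: "g * D = int \<delta>" by (simp add: g_def D_def)
  hence Dpos: "D > 0" using \<delta> gpos by (metis of_nat_0_less_iff zero_less_mult_pos)
  have \<delta>': "real \<delta> = of_int g * of_int D" using gD by (metis of_int_mult of_int_of_nat_eq)
  have \<kappa>: "\<kappa> = pi / 3 * (of_int g / of_int D)"
    unfolding \<kappa>_def g_def [symmetric] \<delta>' using gpos by (simp add: power2_eq_square)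
  obtain B where B: "\<And>\<tau>. Im \<tau> > 0 \<Longrightarrow> 
    norm (dedekind_eta (of_nat \<delta> * moebius A \<tau>)) ^ 4 = (Im \<tau> / Im (moebius A \<tau>)) * 
      (norm (dedekind_eta ((of_int g * \<tau> + of_int B) / of_int D)) ^ 4 / of_int D ^ 2)"
    using norm_eta_moebius[OF A \<delta>] unfolding g_def D_def by blast
  define \<sigma> where "\<sigma> = (\<lambda>\<tau>. (of_int g * \<tau> + of_int B) / of_int D :: complex)"
  have Im\<sigma>: "Im (\<sigma> \<tau>) = of_int g / of_int D * Im \<tau>" for \<tau> by (simp add: \<sigma>_def)
  have "filterlim (\<lambda>\<tau>. of_int g / of_int D * Im \<tau>) at_top im_top"
    using gpos Dpos
    by (intro filterlim_tendsto_pos_mult_at_top[OF tendsto_const] filterlim_Im_im_top) auto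
  hence "filterlim \<sigma> im_top im_top"
    unfolding im_top_def[abs_def] filterlim_filtercomap_iff by (simp add: Im\<sigma> o_def)
  from landau_theta.compose[OF eta_theta_at_infinity this]
  have "(\<lambda>\<tau>. norm (dedekind_eta (\<sigma> \<tau>)) ^ 4) \<in> \<Theta>[im_top](\<lambda>\<tau>. exp (- \<kappa> * Im \<tau>))"
    by (simp add: Im\<sigma> \<kappa> mult.assoc)
  hence "(\<lambda>\<tau>. norm (dedekind_eta (\<sigma> \<tau>)) ^ 4 / of_int D ^ 2) \<in> \<Theta>[im_top](\<lambda>\<tau>. exp (- \<kappa> * Im \<tau>))"
    using Dpos by simp
  hence "(\<lambda>\<tau>. Im \<tau> / Im (moebius A \<tau>) * (norm (dedekind_eta (\<sigma> \<tau>)) ^ 4 / of_int D ^ 2)) \<in>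
           \<Theta>[im_top](\<lambda>\<tau>. Im \<tau> / Im (moebius A \<tau>) * exp (- \<kappa> * Im \<tau>))"
    by (rule landau_theta.mult_left)
  moreover have "eventually (\<lambda>\<tau>. norm (dedekind_eta (of_nat \<delta> * moebius A \<tau>)) ^ 4 =
      Im \<tau> / Im (moebius A \<tau>) * (norm (dedekind_eta (\<sigma> \<tau>)) ^ 4 / of_int D ^ 2)) im_top"
    using eventually_im_top_pos[of 0] by eventually_elim (simp only: B \<sigma>_def)
  ultimately show ?thesis by (rule landau_theta.in_cong[THEN iffD2, rotated])
qed

text \<open>
  The number \<open>\<kappa>\<close> adds up the contributions of the four eta factors of \<open>w\<close>, whose exponents are
  \<open>1\<close>, \<open>2\<close>, \<open>-2\<close>, \<open>-1\<close> for \<open>\<delta> = 1\<close>, \<open>18\<close>, \<open>2\<close>, \<open>9\<close>.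
\<close>

lemma w_cusp_theta:
  assumes A: "A \<in> SL2Z"
  defines "\<kappa> \<equiv> pi / 3 * (real_of_int (gcd 2 (a21 A)) ^ 2 + real_of_int (gcd 9 (a21 A)) ^ 2 / 9 
                            - real_of_int (gcd 18 (a21 A)) ^ 2 / 9 - 1)"
  shows "(\<lambda>\<tau>. norm (w_fun (moebius A \<tau>)) ^ 4) \<in> \<Theta>[im_top](\<lambda>\<tau>. exp (\<kappa> * Im \<tau>))"
proof -
  define e where "e = (\<lambda>\<delta>::nat. \<lambda>\<tau>. norm (dedekind_eta (of_nat \<delta> * moebius A \<tau>)) ^ 4)"
  define k where "k = (\<lambda>\<delta>::nat. pi / 3 * (real_of_int (gcd (int \<delta>) (a21 A)) ^ 2 / \<delta>))"
  define E where "E = (\<lambda>\<delta>::nat. \<lambda>\<tau>. Im \<tau> / Im (moebius A \<tau>) * exp (- k \<delta> * Im \<tau>))"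
  have t: "e \<delta> \<in> \<Theta>[im_top](E \<delta>)" if "\<delta> > 0" for \<delta>
    unfolding e_def E_def k_def by (rule eta_cusp_theta[OF A that])
  have nzE: "eventually (\<lambda>\<tau>. E \<delta> \<tau> \<noteq> 0) im_top" for \<delta>
    using eventually_im_top_pos[of 0]
  proof eventually_elim
    case (elim \<tau>)
    thus ?case using Im_moebius_pos[OF A elim] by (simp add: E_def)
  qed
  have nze: "eventually (\<lambda>\<tau>. e \<delta> \<tau> \<noteq> 0) im_top" if "\<delta> > 0" for \<delta>
    using eventually_nonzero_bigtheta[OF t[OF that]] nzE by simp
  have 1: "(\<lambda>\<tau>. (e 1 \<tau> * (e 18 \<tau> * e 18 \<tau>)) / ((e 2 \<tau> * e 2 \<tau>) * e 9 \<tau>)) \<in>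
           \<Theta>[im_top](\<lambda>\<tau>. (E 1 \<tau> * (E 18 \<tau> * E 18 \<tau>)) / ((E 2 \<tau> * E 2 \<tau>) * E 9 \<tau>))"
  proof (rule landau_theta.divide)
    show "eventually (\<lambda>\<tau>. (e 2 \<tau> * e 2 \<tau>) * e 9 \<tau> \<noteq> 0) im_top"
      using nze[of 2, simplified] nze[of 9, simplified] by eventually_elim simp
    show "eventually (\<lambda>\<tau>. (E 2 \<tau> * E 2 \<tau>) * E 9 \<tau> \<noteq> 0) im_top"
      using nzE[of 2] nzE[of 9] by eventually_elim simp
    show "(\<lambda>\<tau>. (E 2 \<tau> * E 2 \<tau>) * E 9 \<tau>) \<in> \<Theta>[im_top](\<lambda>\<tau>. (e 2 \<tau> * e 2 \<tau>) * e 9 \<tau>)"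
      by (subst bigtheta_sym, intro landau_theta.mult t) auto
    show "(\<lambda>\<tau>. e 1 \<tau> * (e 18 \<tau> * e 18 \<tau>)) \<in> \<Theta>[im_top](\<lambda>\<tau>. E 1 \<tau> * (E 18 \<tau> * E 18 \<tau>))"
      by (intro landau_theta.mult t) auto
  qed
  have 2: "eventually (\<lambda>\<tau>. norm (w_fun (moebius A \<tau>)) ^ 4 = (e 1 \<tau> * (e 18 \<tau> * e 18 \<tau>)) / ((e 2 \<tau> * e 2 \<tau>) * e 9 \<tau>)) im_top"
    using eventually_im_top_pos[of 0]
  proof eventually_elim
    case (elim \<tau>)
    have swap: "(x ^ k) ^ 4 = (x ^ 4) ^ k" for x :: real and k
      by (simp add: mult.commute flip: power_mult)
    show ?case
      unfolding w_fun_eq[OF Im_moebius_pos[OF A elim]] norm_divide norm_mult norm_power power_divide power_mult_distrib swap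
      by (simp add: e_def power2_eq_square)
  qed
  have 3: "eventually (\<lambda>\<tau>. (E 1 \<tau> * (E 18 \<tau> * E 18 \<tau>)) / ((E 2 \<tau> * E 2 \<tau>) * E 9 \<tau>) = exp (\<kappa> * Im \<tau>)) im_top"
    using eventually_im_top_pos[of 0]
  proof eventually_elim
    case (elim \<tau>)
    define r where "r = Im \<tau> / Im (moebius A \<tau>)"
    have r: "r \<noteq> 0" using elim Im_moebius_pos[OF A elim] by (simp add: r_def)
    have E': "E \<delta> \<tau> = r * exp (- k \<delta> * Im \<tau>)" for \<delta> by (simp add: E_def r_def)
    have "\<kappa> * Im \<tau> = - k 1 * Im \<tau> + (- k 18 * Im \<tau> + - k 18 * Im \<tau>) - ((- k 2 * Im \<tau> + - k 2 * Im \<tau>) + - k 9 * Im \<tau>)"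
      by (simp add: \<kappa>_def k_def algebra_simps)
    hence "exp (\<kappa> * Im \<tau>) = exp (- k 1 * Im \<tau>) * (exp (- k 18 * Im \<tau>) * exp (- k 18 * Im \<tau>)) /
              ((exp (- k 2 * Im \<tau>) * exp (- k 2 * Im \<tau>)) * exp (- k 9 * Im \<tau>))"
      by (simp only: exp_add exp_diff)
    thus ?case unfolding E' using r by (simp add: field_simps)
  qed
  from 1 show ?thesis unfolding landau_theta.cong[OF 3] landau_theta.in_cong[OF 2] .
qed

lemma bigo_power_cancel:
  fixes f g :: "'a \<Rightarrow> real"
  assumes "(\<lambda>x. f x ^ n) \<in> O[F](\<lambda>x. g x ^ n)" "n > 0"
  shows "f \<in> O[F](g)"
proof -
  obtain c where c: "eventually (\<lambda>x. norm (f x ^ n) \<le> c * norm (g x ^ n)) F"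
    using assms(1) by (elim landau_o.bigE)
  define d where "d = max c 1"
  have d: "c \<le> d ^ n" "d \<ge> 1" using self_le_power[of d n] assms(2) by (auto simp: d_def)
  from c have "eventually (\<lambda>x. norm (f x) \<le> d * norm (g x)) F"
  proof eventually_elim
    case (elim x)
    have "norm (f x) ^ n \<le> d ^ n * norm (g x) ^ n"
      using elim mult_right_mono[OF d(1), of "norm (g x) ^ n"] by (simp add: norm_power power_abs)
    hence "norm (f x) ^ n \<le> (d * norm (g x)) ^ n" by (simp add: power_mult_distrib)
    thus ?case using d assms(2) by (simp add: power_mono_iff)
  qed
  thus ?thesis by (rule bigoI)
qed

lemma inverse_w_bounded_at_cusp:
  assumes A: "A \<in> SL2Z" "\<not> 18 dvd a21 A"
  shows "(\<lambda>\<tau>. norm (1 / w_fun (moebius A \<tau>))) \<in> O[im_top](\<lambda>_. 1)"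
proof (rule bigo_power_cancel[where n = 4])
  define \<kappa> where "\<kappa> = pi / 3 * (real_of_int (gcd 2 (a21 A)) ^ 2 + real_of_int (gcd 9 (a21 A)) ^ 2 / 9 
                            - real_of_int (gcd 18 (a21 A)) ^ 2 / 9 - 1)"
  have "\<kappa> \<ge> 0" unfolding \<kappa>_def using cusp_exponent_nonneg[OF A(2)] by (intro mult_nonneg_nonneg) auto
  have "(\<lambda>\<tau>. 1) \<in> O[im_top](\<lambda>\<tau>. exp (\<kappa> * Im \<tau>))"
  proof (rule bigoI[where c = 1])
    show "eventually (\<lambda>\<tau>. norm (1::real) \<le> 1 * norm (exp (\<kappa> * Im \<tau>))) im_top"
      using eventually_im_top_pos[of 0] by eventually_elim (use \<open>\<kappa> \<ge> 0\<close> in simp)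
  qed
  also have "(\<lambda>\<tau>. exp (\<kappa> * Im \<tau>)) \<in> O[im_top](\<lambda>\<tau>. norm (w_fun (moebius A \<tau>)) ^ 4)"
    using w_cusp_theta[OF A(1)] unfolding \<kappa>_def [symmetric] bigtheta_def by (simp add: bigomega_iff_bigo)
  finally have *: "(\<lambda>\<tau>. 1) \<in> O[im_top](\<lambda>\<tau>. norm (w_fun (moebius A \<tau>)) ^ 4)" .
  have nz: "eventually (\<lambda>\<tau>. norm (w_fun (moebius A \<tau>)) ^ 4 \<noteq> 0) im_top"
    using eventually_im_top_pos[of 0] by eventually_elim (simp add: w_fun_nonzero Im_moebius_pos[OF A(1)])
  have "(\<lambda>\<tau>. inverse (norm (w_fun (moebius A \<tau>)) ^ 4)) \<in> O[im_top](\<lambda>_. inverse 1)"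
    by (rule landau_o.big.inverse[OF _ nz *]) simp
  thus "(\<lambda>\<tau>. norm (1 / w_fun (moebius A \<tau>)) ^ 4) \<in> O[im_top](\<lambda>_. 1 ^ 4)"
    by (simp add: norm_divide power_divide inverse_eq_divide)
qed auto

text \<open>
  Here the lower left entry is \<open>0\<close>, every greatest common divisor is as large as possible, and \<open>\<kappa> = -8 \<pi>\<close>.
\<close>

lemma inverse_w_at_infinity:
  "(\<lambda>\<tau>. norm (1 / w_fun \<tau>)) \<in> \<Theta>[im_top](\<lambda>\<tau>. exp (2 * pi * Im \<tau>))"
proof -
  have "mat 1 \<in> SL2Z" by (rule SL2Z_I) simp
  from w_cusp_theta[OF this] have t: "(\<lambda>\<tau>. norm (w_fun \<tau>) ^ 4) \<in> \<Theta>[im_top](\<lambda>\<tau>. exp (- (2 * pi * Im \<tau>)) ^ 4)"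
    by (simp add: mult_ac flip: exp_of_nat_mult)
  have "(\<lambda>\<tau>. norm (w_fun \<tau>)) \<in> \<Theta>[im_top](\<lambda>\<tau>. exp (- (2 * pi * Im \<tau>)))"
    using t unfolding bigtheta_def bigomega_iff_bigo[symmetric]
    by (auto simp: bigomega_iff_bigo intro!: bigo_power_cancel[where n = 4])
  moreover have "eventually (\<lambda>\<tau>. norm (w_fun \<tau>) \<noteq> 0) im_top"
    using eventually_im_top_pos[of 0] by eventually_elim (simp add: w_fun_nonzero)
  ultimately have "(\<lambda>\<tau>. inverse (norm (w_fun \<tau>))) \<in> \<Theta>[im_top](\<lambda>\<tau>. inverse (exp (- (2 * pi * Im \<tau>))))"
    by (intro landau_theta.inverse) (auto simp: bigtheta_sym)
  thus ?thesis by (simp add: norm_divide exp_minus inverse_eq_divide)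
qed

section \<open>Invariance of u and w\<close>

text \<open>
  Both functions are multiplied by constants \<open>c\<close> and \<open>d\<close>. Inserting this in \<open>1/u = 1/w - 1\<close> at the
  transformed point gives a linear equation with constant coefficients for \<open>1/w\<close>. As \<open>1/w\<close> is unbounded,
  the coefficients vanish, which means \<open>c = d = 1\<close>.
\<close>

lemma w_u_invariant:
  assumes A: "A \<in> Gamma0 18"
  shows "Im \<tau> > 0 \<Longrightarrow> w_fun (moebius A \<tau>) = w_fun \<tau>" "Im \<tau> > 0 \<Longrightarrow> u_fun (moebius A \<tau>) = u_fun \<tau>"
proof -
  have SL: "A \<in> SL2Z" using A by (rule Gamma0_SL2Z)
  obtain c where c: "\<And>\<tau>. \<tau> \<in> {\<tau>. Im \<tau> > 0} \<Longrightarrow> w_fun (moebius A \<tau>) = c * w_fun \<tau>"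
    by (rule holomorphic_norm_eq_imp_proportional[OF holomorphic_compose_moebius[OF holomorphic_w_fun SL]
          holomorphic_w_fun open_uhp connected_uhp])
       (auto simp: norm_w_fun_Gamma0[OF A] w_fun_nonzero)
  obtain d where d: "\<And>\<tau>. \<tau> \<in> {\<tau>. Im \<tau> > 0} \<Longrightarrow> u_fun (moebius A \<tau>) = d * u_fun \<tau>"
    by (rule holomorphic_norm_eq_imp_proportional[OF holomorphic_compose_moebius[OF holomorphic_u_fun SL]
          holomorphic_u_fun open_uhp connected_uhp])
       (auto simp: norm_u_fun_Gamma0[OF A] u_fun_nonzero)
  have rel: "(1 / d - 1 / c) * (1 / w_fun \<tau>) = 1 / d - 1" if \<tau>: "Im \<tau> > 0" for \<tau>
  proof -
    have "1 / d * (1 / w_fun \<tau> - 1) = 1 / c * (1 / w_fun \<tau>) - 1"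
    proof -
      have "1 / d * (1 / w_fun \<tau> - 1) = 1 / u_fun (moebius A \<tau>)"
        using d[of \<tau>] \<tau> by (simp add: inverse_u_w[OF \<tau>, symmetric])
      also have "\<dots> = 1 / w_fun (moebius A \<tau>) - 1" by (rule inverse_u_w[OF Im_moebius_pos[OF SL \<tau>]])
      also have "\<dots> = 1 / c * (1 / w_fun \<tau>) - 1" using c[of \<tau>] \<tau> by simp
      finally show ?thesis .
    qed
    thus ?thesis by (simp add: algebra_simps)
  qed
  have nz: "c \<noteq> 0" "d \<noteq> 0"
    using c[of \<i>] d[of \<i>] w_fun_nonzero[OF Im_moebius_pos[OF SL, of \<i>]] u_fun_nonzero[OF Im_moebius_pos[OF SL, of \<i>]] by auto
  have "1 / d - 1 / c = 0"
  proof (rule ccontr)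
    assume ne: "1 / d - 1 / c \<noteq> 0"
    have "1 / w_fun \<tau> = (1 / d - 1) / (1 / d - 1 / c)" if \<tau>: "Im \<tau> > 0" for \<tau>
      using rel[OF \<tau>] ne by (metis nonzero_mult_div_cancel_left)
    hence "eventually (\<lambda>\<tau>. norm (1 / w_fun \<tau>) = norm ((1 / d - 1) / (1 / d - 1 / c))) im_top"
      using eventually_im_top_pos[of 0] by (auto elim!: eventually_mono)
    hence "(\<lambda>\<tau>. norm ((1 / d - 1) / (1 / d - 1 / c))) \<in> \<Theta>[im_top](\<lambda>\<tau>. exp (2 * pi * Im \<tau>))"
      by (rule landau_theta.in_cong[THEN iffD1]) (rule inverse_w_at_infinity)
    hence "(\<lambda>\<tau>. exp (2 * pi * Im \<tau>)) \<in> O[im_top](\<lambda>\<tau>. norm ((1 / d - 1) / (1 / d - 1 / c)))"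
      by (simp add: bigtheta_def bigomega_iff_bigo)
    also have "(\<lambda>\<tau>. norm ((1 / d - 1) / (1 / d - 1 / c))) \<in> O[im_top](\<lambda>\<tau>. 1)" by simp
    finally obtain K Y where K: "\<And>\<tau>. Im \<tau> > Y \<Longrightarrow> exp (2 * pi * Im \<tau>) \<le> K"
      by (elim landau_o.bigE) (auto simp: eventually_im_top)
    \<comment> \<open>A height at which \<open>exp (2 \<pi> y)\<close> certainly exceeds the bound \<open>K\<close>.\<close>
    define y where "y = max (Y + 1) (max K 0)"
    have "exp (2 * pi * y) \<le> K" using K[of "Complex 0 y"] by (simp add: y_def)
    moreover have "exp (2 * pi * y) \<ge> 1 + 2 * pi * y" by (rule exp_ge_add_one_self)
    moreover have "1 * y \<le> 2 * pi * y" using pi_gt3 by (intro mult_right_mono) (auto simp: y_def)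
    moreover have "K \<le> y" by (simp add: y_def)
    ultimately show False by linarith
  qed
  hence "c = 1" "d = 1" using rel[of \<i>] nz by auto
  with c d show "Im \<tau> > 0 \<Longrightarrow> w_fun (moebius A \<tau>) = w_fun \<tau>" "Im \<tau> > 0 \<Longrightarrow> u_fun (moebius A \<tau>) = u_fun \<tau>"
    by auto
qed

section \<open>Fourier expansions of periodic functions\<close>

lemma qpow_width_eq:
  assumes "h > 0" "qpow (1 / of_nat h) \<tau> = qpow (1 / of_nat h) \<sigma>"
  obtains k :: int where "\<tau> = \<sigma> + of_int k * of_nat h"
proof -
  have "e2pi (\<tau> / of_nat h) = e2pi (\<sigma> / of_nat h)"
    using assms(2) by (simp add: qpow_def of_rat_inverse_of_nat)
  hence "e2pi (\<tau> / of_nat h - \<sigma> / of_nat h) = 1"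
    by (simp add: right_diff_distrib exp_diff)
  hence "\<tau> / of_nat h - \<sigma> / of_nat h \<in> \<int>" by (simp only: e2pi_eq_1_iff)
  then obtain k where "\<tau> / of_nat h - \<sigma> / of_nat h = of_int k" by (auto elim: Ints_cases)
  hence "\<tau> = \<sigma> + of_int k * of_nat h" using assms(1) by (simp add: field_simps)
  thus ?thesis by (rule that)
qed

definition qlog :: "nat \<Rightarrow> complex \<Rightarrow> complex" where
  "qlog h l = of_nat h * l / (2 * of_real pi * \<i>)"

lemma qpow_qlog: "h > 0 \<Longrightarrow> qpow (1 / of_nat h) (qlog h l) = exp l"
  by (simp add: qpow_def qlog_def of_rat_inverse_of_nat)

lemma periodic_of_int:
  fixes g :: "complex \<Rightarrow> 'a"
  assumes "\<And>\<tau>. Im \<tau> > Y \<Longrightarrow> g (\<tau> + of_nat h) = g \<tau>" "Im \<tau> > Y"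
  shows "g (\<tau> + of_int k * of_nat h) = g \<tau>"
proof (induction k rule: int_induct[where k = 0])
  case (step1 i) thus ?case using assms(1)[of "\<tau> + of_int i * of_nat h"] assms(2) by (simp add: algebra_simps)
next
  case (step2 i) thus ?case using assms(1)[of "\<tau> + of_int (i - 1) * of_nat h"] assms(2) by (simp add: algebra_simps)
qed auto

text \<open>
  The function \<open>G\<close> is defined by a branch of the logarithm. The branch does not matter since \<open>g\<close> is
  periodic, so near each point a branch that is holomorphic there may be used instead.
\<close>

lemma periodic_factors_through_qpow:
  assumes h: "h > 0" and hol: "g holomorphic_on {\<tau>. Im \<tau> > Y}"
    and per: "\<And>\<tau>. Im \<tau> > Y \<Longrightarrow> g (\<tau> + of_nat h) = g \<tau>"
  obtains G where "G holomorphic_on ball 0 (exp (- 2 * pi * Y / h)) - {0}"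
    "\<And>\<tau>. Im \<tau> > Y \<Longrightarrow> g \<tau> = G (qpow (1 / of_nat h) \<tau>)"
proof -
  define r where "r = exp (- 2 * pi * Y / h)"
  define G where "G = (\<lambda>z. g (qlog h (Ln z)))"
  have Y_iff: "Im \<tau> > Y \<longleftrightarrow> norm (qpow (1 / of_nat h) \<tau>) < r" for \<tau>
    using h pi_gt_zero unfolding norm_qpow_width r_def exp_less_cancel_iff
    by (simp add: field_simps)
  have eq: "g \<tau> = G (qpow (1 / of_nat h) \<tau>)" if "Im \<tau> > Y" for \<tau>
  proof -
    define \<sigma> where "\<sigma> = qlog h (Ln (qpow (1 / of_nat h) \<tau>))"
    have q: "qpow (1 / of_nat h) \<sigma> = qpow (1 / of_nat h) \<tau>"
      by (simp add: \<sigma>_def qpow_qlog[OF h] exp_Ln)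
    obtain k :: int where k: "\<sigma> = \<tau> + of_int k * of_nat h" by (rule qpow_width_eq[OF h q])
    have "g \<sigma> = g \<tau>" unfolding k by (rule periodic_of_int[where Y = Y]) (use per that in auto)
    thus ?thesis by (simp add: G_def \<sigma>_def)
  qed
  have "G analytic_on {z}" if z: "z \<in> ball 0 r - {0}" for z
  proof -
    define L where "L = (\<lambda>w. qlog h (Ln (w / z) + Ln z))"
    define U where "U = ball z (norm z) \<inter> ball 0 r"
    have U: "open U" "z \<in> U" using z by (auto simp: U_def)
    have nz: "w \<noteq> 0" if "w \<in> U" for w using that by (auto simp: U_def dist_norm)
    have pos: "w / z \<notin> \<real>\<^sub>\<le>\<^sub>0" if "w \<in> U" for w
    proof -
      have "norm (1 - w / z) < 1"
      proof -
        have "norm (z - w) < norm z" using that by (simp add: U_def dist_norm)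
        moreover have "1 - w / z = (z - w) / z" using z by (simp add: field_simps)
        ultimately show ?thesis using z by (simp add: norm_divide)
      qed
      hence "Re (1 - w / z) < 1" using complex_Re_le_cmod[of "1 - w / z"] by linarith
      thus ?thesis by (auto simp: complex_nonpos_Reals_iff)
    qed
    have holL: "L holomorphic_on U"
      unfolding L_def qlog_def using pos z by (intro holomorphic_intros) auto
    have qL: "qpow (1 / of_nat h) (L w) = w" if "w \<in> U" for w
      using nz[OF that] z by (simp add: L_def qpow_qlog[OF h] exp_add)
    have ImL: "Im (L w) > Y" if "w \<in> U" for w
      using that unfolding Y_iff qL[OF that] by (simp add: U_def)
    have "(g \<circ> L) holomorphic_on U"
      by (rule holomorphic_on_compose_gen[OF holL hol]) (use ImL in auto)
    moreover have "(g \<circ> L) w = G w" if "w \<in> U" for w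
      using eq[OF ImL[OF that]] qL[OF that] by simp
    ultimately have "G holomorphic_on U" by (metis holomorphic_transform)
    thus ?thesis using U by (auto simp: analytic_at)
  qed
  hence "G analytic_on ball 0 r - {0}" using analytic_on_analytic_at by blast
  hence "G holomorphic_on ball 0 r - {0}" by (rule analytic_imp_holomorphic)
  thus ?thesis using that eq by (simp add: r_def)
qed

lemma eventually_qpow_width:
  assumes "h > 0" "eventually P (at 0)"
  shows "eventually (\<lambda>\<tau>. P (qpow (1 / of_nat h) \<tau>)) im_top"
  using filterlim_qpow_width[OF assms(1)] assms(2) by (simp add: filterlim_iff)

lemma eventually_at_0_of_im_top:
  assumes h: "h > 0" and ev: "eventually (\<lambda>\<tau>. P (qpow (1 / of_nat h) \<tau>)) im_top"
  shows "eventually P (at 0)"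
proof -
  obtain Y where Y: "\<And>\<tau>. Im \<tau> > Y \<Longrightarrow> P (qpow (1 / of_nat h) \<tau>)" using ev by (auto simp: eventually_im_top)
  have "P z" if "z \<noteq> 0" "norm z < exp (- 2 * pi * Y / h)" for z
  proof -
    have e: "qpow (1 / of_nat h) (qlog h (Ln z)) = z" using that h by (simp add: qpow_qlog)
    hence "exp (- 2 * pi * Im (qlog h (Ln z)) / h) < exp (- 2 * pi * Y / h)"
      using that(2) norm_qpow_width[of h "qlog h (Ln z)"] by simp
    hence "Im (qlog h (Ln z)) > Y" using h pi_gt_zero unfolding exp_less_cancel_iff by (simp add: field_simps)
    from Y[OF this] show ?thesis by (simp add: e)
  qed
  thus ?thesis unfolding eventually_at by (intro exI[of _ "exp (- 2 * pi * Y / h)"]) (auto simp: dist_norm)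
qed

text \<open>
  Growth of exponential type means that the singularity at \<open>0\<close> in the coordinate \<open>q\<^bsup>1/h\<^esup>\<close> is at worst a pole
  of order \<open>n\<close>; after multiplication by \<open>q\<^bsup>n/h\<^esup>\<close> it is removable.
\<close>

lemma periodic_growth_factor:
  assumes h: "h > 0" and hol: "g holomorphic_on {\<tau>. Im \<tau> > Y}"
    and per: "\<And>\<tau>. Im \<tau> > Y \<Longrightarrow> g (\<tau> + of_nat h) = g \<tau>"
    and growth: "(\<lambda>\<tau>. norm (g \<tau>)) \<in> O[im_top](\<lambda>\<tau>. exp (2 * pi * real n / real h * Im \<tau>))"
  obtains G r where "r > 0" "G holomorphic_on ball 0 r"
    "eventually (\<lambda>\<tau>. g \<tau> * qpow (1 / of_nat h) \<tau> ^ n = G (qpow (1 / of_nat h) \<tau>)) im_top"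
proof -
  define r where "r = exp (- 2 * pi * Y / h)"
  obtain G where G: "G holomorphic_on ball 0 r - {0}" "\<And>\<tau>. Im \<tau> > Y \<Longrightarrow> g \<tau> = G (qpow (1 / of_nat h) \<tau>)"
    using periodic_factors_through_qpow[OF h hol per] unfolding r_def by metis
  have r: "r > 0" by (simp add: r_def)
  have "(\<lambda>z. G z * z ^ n) holomorphic_on ball 0 r - {0}" by (intro holomorphic_intros G)
  moreover have "0 \<in> interior (ball 0 r :: complex set)" using r by simp
  moreover have "\<exists>B. eventually (\<lambda>z. norm (G z * z ^ n) \<le> B) (at 0)"
  proof -
    obtain c where c: "eventually (\<lambda>\<tau>. norm (norm (g \<tau>)) \<le> c * norm (exp (2 * pi * real n / real h * Im \<tau>))) im_top"
      using growth by (elim landau_o.bigE)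
    have "eventually (\<lambda>\<tau>. norm (G (qpow (1 / of_nat h) \<tau>) * qpow (1 / of_nat h) \<tau> ^ n) \<le> c) im_top"
      using c eventually_im_top_pos[of Y]
    proof eventually_elim
      case (elim \<tau>)
      have "norm (qpow (1 / of_nat h) \<tau> ^ n) = exp (- (2 * pi * real n / real h * Im \<tau>))"
        by (simp add: norm_power norm_qpow_width mult_ac flip: exp_of_nat_mult)
      hence "norm (G (qpow (1 / of_nat h) \<tau>) * qpow (1 / of_nat h) \<tau> ^ n) = norm (g \<tau>) * exp (- (2 * pi * real n / real h * Im \<tau>))"
        using G(2)[OF elim(2)] by (simp add: norm_mult)
      also have "\<dots> \<le> (c * exp (2 * pi * real n / real h * Im \<tau>)) * exp (- (2 * pi * real n / real h * Im \<tau>))"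
        using elim(1) by (intro mult_right_mono) auto
      also have "\<dots> = c" by (simp add: mult.assoc flip: exp_add)
      finally show ?case .
    qed
    thus ?thesis by (intro exI[of _ c] eventually_at_0_of_im_top[OF h])
  qed
  ultimately obtain F where F: "F holomorphic_on ball 0 r" "\<And>z. z \<in> ball 0 r - {0} \<Longrightarrow> F z = G z * z ^ n"
    using holomorphic_on_extend_bounded[of "\<lambda>z. G z * z ^ n" "ball 0 r" 0] by blast
  have "eventually (\<lambda>z. z \<in> ball 0 r - {0}) (at (0::complex))"
    using r eventually_at_ball[of r 0 UNIV] eventually_neq_at_within[of 0 0 UNIV] by (auto elim: eventually_elim2)
  hence "eventually (\<lambda>\<tau>. qpow (1 / of_nat h) \<tau> \<in> ball 0 r - {0}) im_top" by (rule eventually_qpow_width[OF h])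
  hence "eventually (\<lambda>\<tau>. g \<tau> * qpow (1 / of_nat h) \<tau> ^ n = F (qpow (1 / of_nat h) \<tau>)) im_top"
    using eventually_im_top_pos[of Y] by eventually_elim (use F(2) G(2) in simp)
  thus ?thesis using that r F(1) by blast
qed

lemma qpow_int_width: "qpow (of_int m / of_nat h) \<tau> = qpow (1 / of_nat h) \<tau> powi m"
  unfolding qpow_def by (simp add: of_rat_divide exp_power_int mult_ac)

text \<open>
  Together with the converse \<open>has_q_expansionD\<close> this replaces expansions by three properties that are
  easy to transport: holomorphy near the cusp, periodicity and exponential growth.
\<close>

lemma has_q_expansionI:
  assumes h: "h > 0" and hol: "g holomorphic_on {\<tau>. Im \<tau> > Y}"
    and per: "\<And>\<tau>. Im \<tau> > Y \<Longrightarrow> g (\<tau> + of_nat h) = g \<tau>"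
    and growth: "(\<lambda>\<tau>. norm (g \<tau>)) \<in> O[im_top](\<lambda>\<tau>. exp (2 * pi * real n / real h * Im \<tau>))"
  shows "has_q_expansion g"
proof -
  obtain G r where G: "r > 0" "G holomorphic_on ball 0 r"
    "eventually (\<lambda>\<tau>. g \<tau> * qpow (1 / of_nat h) \<tau> ^ n = G (qpow (1 / of_nat h) \<tau>)) im_top"
    by (rule periodic_growth_factor[OF assms])
  define c where "c = (\<lambda>k. (deriv ^^ k) G 0 / fact k)"
  have c: "(\<lambda>k. c k * z ^ k) sums G z" if "norm z < r" for z
    using holomorphic_power_series[OF G(2), of z] that by (simp add: c_def)
  have hs: "((\<lambda>k. c k * z ^ k) has_sum G z) UNIV" if z: "norm z < r" for z
  proof (rule norm_summable_imp_has_sum[OF _ c[OF z]])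
    obtain s where s: "norm z < s" "s < r" using z dense by blast
    have "\<bar>s\<bar> < r" using s norm_ge_zero[of z] by linarith
    hence "summable (\<lambda>k. c k * of_real s ^ k)"
      using sums_summable[OF c[of "of_real s"]] by simp
    thus "summable (\<lambda>k. norm (c k * z ^ k))"
      by (rule powser_insidea) (use s in \<open>auto intro: le_less_trans[OF norm_ge_zero]\<close>)
  qed
  have "eventually (\<lambda>z. z \<in> ball 0 r) (at (0::complex))"
    using eventually_at_ball[OF G(1), of 0 UNIV] by (simp only: UNIV_I simp_thms)
  hence "eventually (\<lambda>\<tau>. qpow (1 / of_nat h) \<tau> \<in> ball 0 r) im_top" by (rule eventually_qpow_width[OF h])
  hence "eventually (\<lambda>\<tau>. ((\<lambda>m. c (nat (m + int n)) * qpow (of_int m / of_nat h) \<tau>) has_sum g \<tau>) {- int n..}) im_top"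
    using G(3)
  proof eventually_elim
    case (elim \<tau>)
    define q where "q = qpow (1 / of_nat h) \<tau>"
    have q: "q \<noteq> 0" by (simp add: q_def)
    have "g \<tau> = G q * q powi (- int n)" using elim(2) q by (simp add: q_def power_int_minus field_simps)
    moreover have "((\<lambda>k. c k * q ^ k * q powi (- int n)) has_sum G q * q powi (- int n)) UNIV"
      by (intro has_sum_cmult_left hs) (use elim(1) in \<open>simp add: q_def\<close>)
    ultimately have "((\<lambda>k. c k * q ^ k * q powi (- int n)) has_sum g \<tau>) UNIV" by simp
    also have "(\<lambda>k. c k * q ^ k * q powi (- int n)) = (\<lambda>m. c (nat (m + int n)) * q powi m) \<circ> (\<lambda>k. int k - int n)"
    proof
      fix k
      have "q ^ k * q powi (- int n) = q powi (int k - int n)" using q by (simp add: power_int_diff power_int_minus field_simps)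
      thus "c k * q ^ k * q powi (- int n) = ((\<lambda>m. c (nat (m + int n)) * q powi m) \<circ> (\<lambda>k. int k - int n)) k"
        by (simp add: mult.assoc)
    qed
    finally have "((\<lambda>m. c (nat (m + int n)) * q powi m) has_sum g \<tau>) (range (\<lambda>k. int k - int n))"
      by (subst has_sum_reindex) (auto simp: inj_on_def o_def)
    also have "range (\<lambda>k. int k - int n) = {- int n..}"
    proof safe
      fix m assume "m \<ge> - int n"
      hence "m = int (nat (m + int n)) - int n" by simp
      thus "m \<in> range (\<lambda>k. int k - int n)" by blast
    qed auto
    finally show ?case unfolding qpow_int_width q_def .
  qed
  then obtain Y' where "Y' > 0" "\<forall>\<tau>. Im \<tau> > Y' \<longrightarrow> ((\<lambda>m. c (nat (m + int n)) * qpow (of_int m / of_nat h) \<tau>) has_sum g \<tau>) {- int n..}"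
    by (auto simp: eventually_im_top)
  moreover have "h \<ge> 1" using h by simp
  ultimately show ?thesis unfolding has_q_expansion_def
    by (intro exI[of _ "- int n"] exI[of _ h] exI[of _ "\<lambda>m. c (nat (m + int n))"] exI[of _ Y'] conjI)
qed

lemma has_q_expansionD:
  assumes "has_q_expansion g"
  obtains Y n where "Y > 0" "g holomorphic_on {\<tau>. Im \<tau> > Y}"
    "(\<lambda>\<tau>. norm (g \<tau>)) \<in> O[im_top](\<lambda>\<tau>. exp (2 * pi * real n * Im \<tau>))"
proof -
  obtain n0 :: int and h :: nat and a Y where h: "h \<ge> 1" and Y: "Y > 0"
    and sum: "\<And>\<tau>. Im \<tau> > Y \<Longrightarrow> ((\<lambda>n. a n * qpow (of_int n / of_nat h) \<tau>) has_sum g \<tau>) {n0..}"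
    using assms unfolding has_q_expansion_def by blast
  have h0: "h > 0" using h by simp
  define r where "r = exp (- 2 * pi * Y / h)"
  define b where "b = (\<lambda>k. a (n0 + int k))"
  have b: "(\<lambda>k. b k * qpow (1 / of_nat h) \<tau> ^ k) sums (g \<tau> * qpow (1 / of_nat h) \<tau> powi (- n0))"
    if \<tau>: "Im \<tau> > Y" for \<tau>
  proof -
    define q where "q = qpow (1 / of_nat h) \<tau>"
    have q: "q \<noteq> 0" by (simp add: q_def)
    have "range (\<lambda>k. n0 + int k) = {n0..}"
    proof safe
      fix m assume "m \<ge> n0"
      hence "m = n0 + int (nat (m - n0))" by simp
      thus "m \<in> range (\<lambda>k. n0 + int k)" by blast
    qed auto
    hence "((\<lambda>n. a n * q powi n) has_sum g \<tau>) (range (\<lambda>k. n0 + int k))"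
      using sum[OF \<tau>] unfolding qpow_int_width q_def by simp
    hence "((\<lambda>k. b k * q powi (n0 + int k)) has_sum g \<tau>) UNIV"
      by (subst (asm) has_sum_reindex) (auto simp: inj_on_def b_def o_def)
    hence "((\<lambda>k. b k * q powi (n0 + int k) * q powi (- n0)) has_sum (g \<tau> * q powi (- n0))) UNIV"
      by (rule has_sum_cmult_left)
    moreover have "b k * q powi (n0 + int k) * q powi (- n0) = b k * q ^ k" for k
      using q by (simp add: power_int_add power_int_minus field_simps)
    ultimately have "((\<lambda>k. b k * q ^ k) has_sum (g \<tau> * q powi (- n0))) UNIV" by simp
    thus ?thesis unfolding q_def by (rule has_sum_imp_sums)
  qed
  define F where "F = (\<lambda>z. \<Sum>k. b k * z ^ k)"
  have F: "(\<lambda>k. b k * z ^ k) sums F z" if z: "norm z < r" for z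
  proof (cases "z = 0")
    case True
    thus ?thesis by (simp add: F_def summable_sums summable_0_powser)
  next
    case False
    define \<tau> where "\<tau> = qlog h (Ln z)"
    have e: "qpow (1 / of_nat h) \<tau> = z" using False h0 by (simp add: \<tau>_def qpow_qlog)
    hence "exp (- 2 * pi * Im \<tau> / h) < exp (- 2 * pi * Y / h)"
      using z norm_qpow_width[of h \<tau>] by (simp add: r_def)
    hence "Im \<tau> > Y" using h0 pi_gt_zero unfolding exp_less_cancel_iff by (simp add: field_simps)
    from b[OF this] show ?thesis unfolding e F_def by (simp add: sums_iff)
  qed
  have holF: "F holomorphic_on ball 0 r"
    by (rule power_series_holomorphic[where a = b]) (use F in simp)
  have g: "g \<tau> = F (qpow (1 / of_nat h) \<tau>) * qpow (1 / of_nat h) \<tau> powi n0" if "Im \<tau> > Y" for \<tau>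
    using b[OF that] unfolding F_def by (simp add: sums_iff power_int_minus field_simps)
  have in_ball: "qpow (1 / of_nat h) \<tau> \<in> ball 0 r" if "Im \<tau> > Y" for \<tau>
    using that h0 pi_gt_zero by (simp add: norm_qpow_width r_def field_simps)
  have r: "r > 0" by (simp add: r_def)
  have "g holomorphic_on {\<tau>. Im \<tau> > Y}"
  proof (rule holomorphic_transform)
    have "(F \<circ> qpow (1 / of_nat h)) holomorphic_on {\<tau>. Im \<tau> > Y}"
      by (rule holomorphic_on_compose_gen[OF _ holF]) (use in_ball in \<open>auto intro!: holomorphic_intros\<close>)
    thus "(\<lambda>\<tau>. F (qpow (1 / of_nat h) \<tau>) * qpow (1 / of_nat h) \<tau> powi n0) holomorphic_on {\<tau>. Im \<tau> > Y}"
      by (intro holomorphic_intros) (auto simp: o_def)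
  qed (use g in auto)
  moreover have "(\<lambda>\<tau>. norm (g \<tau>)) \<in> O[im_top](\<lambda>\<tau>. exp (2 * pi * real (nat \<bar>n0\<bar>) * Im \<tau>))"
  proof -
    have "isCont F 0" using holF r
      by (meson centre_in_ball continuous_on_eq_continuous_at holomorphic_on_imp_continuous_on open_ball)
    hence "eventually (\<lambda>z. dist (F z) (F 0) < 1) (at 0)"
      by (intro tendstoD) (auto simp: isCont_def)
    hence "eventually (\<lambda>z. norm (F z) \<le> norm (F 0) + 1) (at 0)"
    proof eventually_elim
      case (elim z)
      thus ?case using norm_triangle_ineq2[of "F z" "F 0"] by (simp add: dist_norm)
    qed
    hence "eventually (\<lambda>\<tau>. norm (F (qpow (1 / of_nat h) \<tau>)) \<le> norm (F 0) + 1) im_top"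
      by (rule eventually_qpow_width[OF h0])
    hence "eventually (\<lambda>\<tau>. norm (norm (g \<tau>)) \<le> (norm (F 0) + 1) * norm (exp (2 * pi * real (nat \<bar>n0\<bar>) * Im \<tau>))) im_top"
      using eventually_im_top_pos[of Y]
    proof eventually_elim
      case (elim \<tau>)
      have "norm (qpow (1 / of_nat h) \<tau> powi n0) = exp (of_int n0 * (- 2 * pi * Im \<tau> / h))"
        by (simp add: norm_power_int norm_qpow_width exp_power_int)
      also have "\<dots> \<le> exp (2 * pi * real (nat \<bar>n0\<bar>) * Im \<tau>)"
      proof (subst exp_le_cancel_iff)
        have "of_int n0 * (- 2 * pi * Im \<tau> / h) = (- real_of_int n0 / h) * (2 * pi * Im \<tau>)" by simp
        also have "- real_of_int n0 / h \<le> real (nat \<bar>n0\<bar>) / 1"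
          by (intro frac_le) (use h in auto)
        hence "(- real_of_int n0 / h) * (2 * pi * Im \<tau>) \<le> real (nat \<bar>n0\<bar>) / 1 * (2 * pi * Im \<tau>)"
          using elim Y by (intro mult_right_mono) auto
        finally show "of_int n0 * (- 2 * pi * Im \<tau> / h) \<le> 2 * pi * real (nat \<bar>n0\<bar>) * Im \<tau>" by (simp add: mult_ac)
      qed
      finally have "norm (F (qpow (1 / of_nat h) \<tau>)) * norm (qpow (1 / of_nat h) \<tau> powi n0) \<le>
          (norm (F 0) + 1) * exp (2 * pi * real (nat \<bar>n0\<bar>) * Im \<tau>)"
        using elim(1) by (intro mult_mono) auto
      thus ?case using g[OF elim(2)] by (simp add: norm_mult)
    qed
    thus ?thesis by (rule bigoI)
  qed
  ultimately show ?thesis using that Y by blast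
qed

section \<open>Bounded modular functions\<close>

text \<open>
  If one factor is nonzero at a point, the product of the others vanishes nearby, hence everywhere by
  analytic continuation.
\<close>

lemma holomorphic_prod_eq_0:
  assumes "finite I" "open S" "connected S" "S \<noteq> {}" "\<And>i. i \<in> I \<Longrightarrow> f i holomorphic_on S"
    and "\<And>z. z \<in> S \<Longrightarrow> (\<Prod>i\<in>I. f i z) = (0::complex)"
  shows "\<exists>i\<in>I. \<forall>z\<in>S. f i z = 0"
  using assms(1,5,6)
proof (induction I)
  case empty
  thus ?case using \<open>S \<noteq> {}\<close> by auto
next
  case (insert i I)
  show ?case
  proof (cases "\<forall>z\<in>S. f i z = 0")
    case False
    then obtain z0 where z0: "z0 \<in> S" "f i z0 \<noteq> 0" by auto
    define g where "g = (\<lambda>z. \<Prod>i\<in>I. f i z)"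
    have g: "g holomorphic_on S" unfolding g_def using insert.prems by (intro holomorphic_intros) auto
    have "continuous_on S (f i)" using insert.prems by (intro holomorphic_on_imp_continuous_on) auto
    then obtain e where e: "e > 0" "\<And>z. dist z0 z < e \<Longrightarrow> z \<in> S \<Longrightarrow> f i z \<noteq> 0"
      using continuous_on_avoid[of S "f i" z0 0] z0 by metis
    obtain d where d: "d > 0" "ball z0 d \<subseteq> S" using z0 \<open>open S\<close> openE by blast
    define U where "U = ball z0 (min d e)"
    have U: "open U" "U \<subseteq> S" "z0 \<in> U" using e d by (auto simp: U_def)
    have "g z = 0" if "z \<in> U" for z
    proof -
      have "f i z * g z = 0" using insert.prems(2)[of z] insert.hyps that U by (auto simp: g_def)
      thus ?thesis using e(2)[of z] that U by (auto simp: U_def)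
    qed
    hence "g z = 0" if "z \<in> S" for z
      using analytic_continuation_open[of U S g "\<lambda>_. 0" z] U assms(2,3) g that by auto
    hence "\<exists>i\<in>I. \<forall>z\<in>S. f i z = 0" using insert.prems by (intro insert.IH) (auto simp: g_def)
    thus ?thesis by auto
  qed auto
qed

lemma SL2Z_translation: "vector [vector [1, k], vector [0, 1]] \<in> SL2Z"
  by (rule SL2Z_I) simp

lemma moebius_translation: "moebius (vector [vector [1, k], vector [0, 1]]) \<tau> = \<tau> + of_int k"
  by (simp add: moebius_def)

lemma SL2Z_inversion: "vector [vector [0, -1], vector [1, 0]] \<in> SL2Z"
  by (rule SL2Z_I) simp

lemma moebius_inversion: "moebius (vector [vector [0, -1], vector [1, 0]]) \<tau> = -1 / \<tau>"
  by (simp add: moebius_def)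

text \<open>
  After a translation \<open>|Re \<tau>| \<le> 1/2\<close>. If then \<open>Im \<tau> < 1/2\<close>, we have \<open>|\<tau>|\<^sup>2 \<le> 1/2\<close>, and the inversion at least
  doubles the imaginary part; so the process stops.
\<close>

lemma exists_in_strip:
  assumes "Im \<tau> > 0"
  obtains A where "A \<in> SL2Z" "\<bar>Re (moebius A \<tau>)\<bar> \<le> 1/2" "Im (moebius A \<tau>) \<ge> 1/2"
proof -
  have "\<exists>A\<in>SL2Z. \<bar>Re (moebius A \<tau>)\<bar> \<le> 1/2 \<and> Im (moebius A \<tau>) \<ge> 1/2"
    if "Im \<tau> \<ge> (1/2) ^ n" "Im \<tau> > 0" for n \<tau>
    using that
  proof (induction n arbitrary: \<tau>)
    case (0 \<tau>)
    show ?case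
    proof (rule bexI[of _ "vector [vector [1, - round (Re \<tau>)], vector [0, 1]]"])
      show "\<bar>Re (moebius (vector [vector [1, - round (Re \<tau>)], vector [0, 1]]) \<tau>)\<bar> \<le> 1 / 2 \<and>
            1 / 2 \<le> Im (moebius (vector [vector [1, - round (Re \<tau>)], vector [0, 1]]) \<tau>)"
        using 0 of_int_round_abs_le[of "Re \<tau>"] unfolding moebius_translation by (simp add: abs_minus_commute)
    qed (rule SL2Z_translation)
  next
    case (Suc n \<tau>)
    define T where "T = (vector [vector [1, - round (Re \<tau>)], vector [0, 1]] :: int ^ 2 ^ 2)"
    define S where "S = (vector [vector [0, -1], vector [1, 0]] :: int ^ 2 ^ 2)"
    have T: "T \<in> SL2Z" and S: "S \<in> SL2Z" unfolding T_def S_def by (rule SL2Z_translation SL2Z_inversion)+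
    define \<sigma> where "\<sigma> = moebius T \<tau>"
    have \<sigma>: "\<bar>Re \<sigma>\<bar> \<le> 1/2" "Im \<sigma> = Im \<tau>"
      using of_int_round_abs_le[of "Re \<tau>"] unfolding \<sigma>_def T_def moebius_translation by (simp_all add: abs_minus_commute)
    show ?case
    proof (cases "Im \<sigma> \<ge> 1/2")
      case True
      thus ?thesis using \<sigma> T unfolding \<sigma>_def by blast
    next
      case False
      have "norm \<sigma> ^ 2 = Re \<sigma> ^ 2 + Im \<sigma> ^ 2" by (rule cmod_power2)
      also have "\<dots> \<le> (1/2) ^ 2 + (1/2) ^ 2"
        using \<sigma> False Suc.prems by (intro add_mono) (auto simp: abs_le_square_iff[symmetric] intro!: power_mono)
      finally have n: "norm \<sigma> ^ 2 \<le> 1/2" by (simp add: power2_eq_square)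
      have n0: "norm \<sigma> ^ 2 > 0" using \<sigma> Suc.prems by auto
      have "Im (moebius S \<sigma>) = Im \<tau> / norm \<sigma> ^ 2"
        using \<sigma> by (simp add: S_def moebius_inversion Im_divide cmod_power2)
      also have "\<dots> \<ge> Im \<tau> / (1/2)" by (intro divide_left_mono n mult_pos_pos n0) (use Suc.prems in auto)
      finally have "Im (moebius S \<sigma>) \<ge> 2 * Im \<tau>" by simp
      hence "Im (moebius S \<sigma>) \<ge> (1/2) ^ n" "Im (moebius S \<sigma>) > 0" using Suc.prems by auto
      from Suc.IH[OF this] obtain A where A: "A \<in> SL2Z" "\<bar>Re (moebius A (moebius S \<sigma>))\<bar> \<le> 1/2" "Im (moebius A (moebius S \<sigma>)) \<ge> 1/2"
        by blast
      have "moebius (A ** (S ** T)) \<tau> = moebius A (moebius S \<sigma>)"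
        using A(1) S T Suc.prems by (simp add: moebius_mult SL2Z_mult \<sigma>_def)
      moreover have "A ** (S ** T) \<in> SL2Z" by (intro SL2Z_mult A S T)
      ultimately show ?thesis using A by metis
    qed
  qed
  moreover obtain n where "(1/2) ^ n < Im \<tau>" using real_arch_pow_inv[of "Im \<tau>" "1/2"] assms by auto
  ultimately show ?thesis using that assms by (meson less_imp_le)
qed

text \<open>
  The strip of \<open>exists_in_strip\<close> is compact up to a neighbourhood of \<open>\<infinity>\<close>, where \<open>f\<close> is small. Unless
  \<open>f = 0\<close>, its modulus therefore attains its maximum, and the maximum principle gives a constant that
  equals the limit \<open>0\<close>.
\<close>

lemma level_one_vanishing:
  assumes hol: "f holomorphic_on {\<tau>. Im \<tau> > 0}"
    and inv: "\<And>A \<tau>. A \<in> SL2Z \<Longrightarrow> Im \<tau> > 0 \<Longrightarrow> f (moebius A \<tau>) = f \<tau>"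
    and lim: "(f \<longlongrightarrow> 0) im_top" and \<tau>: "Im \<tau> > 0"
  shows "f \<tau> = 0"
proof (rule ccontr)
  assume nz: "f \<tau> \<noteq> 0"
  have "eventually (\<lambda>z. norm (f z) < norm (f \<tau>)) im_top"
    using tendstoD[OF lim, of "norm (f \<tau>)"] nz by (simp add: dist_norm)
  then obtain Y where Y: "\<And>z. Im z > Y \<Longrightarrow> norm (f z) < norm (f \<tau>)" by (auto simp: eventually_im_top)
  define K where "K = cbox (Complex (-1/2) (1/2)) (Complex (1/2) (max Y 1))"
  have K: "z \<in> K \<longleftrightarrow> \<bar>Re z\<bar> \<le> 1/2 \<and> 1/2 \<le> Im z \<and> Im z \<le> max Y 1" for z
    by (auto simp: K_def in_cbox_complex_iff)
  have ne: "K \<noteq> {}" using K[of "\<i>"] by auto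
  have "continuous_on K f"
    using hol K by (intro holomorphic_on_imp_continuous_on holomorphic_on_subset[OF hol]) auto
  hence cont: "continuous_on K (\<lambda>z. norm (f z))" by (rule continuous_on_norm)
  have "compact K" unfolding K_def by (rule compact_cbox)
  then obtain \<xi> where \<xi>: "\<xi> \<in> K" "\<And>z. z \<in> K \<Longrightarrow> norm (f z) \<le> norm (f \<xi>)"
    using continuous_attains_sup[OF \<open>compact K\<close> ne cont] by blast
  have bound: "norm (f z) < norm (f \<tau>) \<or> norm (f z) \<le> norm (f \<xi>)" if z: "Im z > 0" for z
  proof -
    obtain A where A: "A \<in> SL2Z" "\<bar>Re (moebius A z)\<bar> \<le> 1/2" "Im (moebius A z) \<ge> 1/2"
      using exists_in_strip[OF z] by blast
    have "f z = f (moebius A z)" using inv[OF A(1) z] by simp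
    thus ?thesis using Y[of "moebius A z"] \<xi>(2)[of "moebius A z"] A K by fastforce
  qed
  from bound[OF \<tau>] have "norm (f \<tau>) \<le> norm (f \<xi>)" by simp
  hence bound': "norm (f z) \<le> norm (f \<xi>)" if "Im z > 0" for z using bound[OF that] by auto
  have "Im \<xi> > 0" using \<xi>(1) K by auto
  hence "f constant_on {\<tau>. Im \<tau> > 0}"
    using bound' by (intro maximum_modulus_principle[OF hol open_uhp connected_uhp open_uhp order_refl]) auto
  then obtain c where c: "\<And>z. Im z > 0 \<Longrightarrow> f z = c" by (auto simp: constant_on_def)
  have "norm (f (Complex 0 (max Y 0 + 1))) < norm (f \<tau>)" by (rule Y) simp
  thus False using c[of "Complex 0 (max Y 0 + 1)"] c[OF \<tau>] by simp
qed

lemma Gamma0_finite_cosets: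
  assumes "N > 0"
  obtains R where "finite R" "R \<subseteq> SL2Z" "\<And>A. A \<in> SL2Z \<Longrightarrow> \<exists>\<alpha>\<in>Gamma0 N. \<exists>B\<in>R. A = \<alpha> ** B"
proof -
  \<comment> \<open>One representative is picked for each lower row modulo \<open>N\<close> that occurs.\<close>
  define key where "key = (\<lambda>A. (a21 A mod int N, a22 A mod int N))"
  define pick where "pick = (\<lambda>p. SOME B. B \<in> SL2Z \<and> key B = p)"
  have pick: "pick (key A) \<in> SL2Z \<and> key (pick (key A)) = key A" if "A \<in> SL2Z" for A
    unfolding pick_def by (rule someI[of _ A]) (use that in simp)
  define R where "R = pick ` key ` SL2Z"
  have "key ` SL2Z \<subseteq> {0..<int N} \<times> {0..<int N}" using assms by (auto simp: key_def)
  hence "finite (key ` SL2Z)" by (rule finite_subset) auto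
  hence "finite R" unfolding R_def by (rule finite_imageI)
  moreover have "R \<subseteq> SL2Z" using pick by (auto simp: R_def)
  moreover have "\<exists>\<alpha>\<in>Gamma0 N. \<exists>B\<in>R. A = \<alpha> ** B" if A: "A \<in> SL2Z" for A
  proof (intro bexI)
    let ?B = "pick (key A)"
    have B: "?B \<in> SL2Z" "key ?B = key A" using pick[OF A] by auto
    show "A ** adjugate2 ?B \<in> Gamma0 N"
      using B(2) by (intro Gamma0_coset A B(1)) (auto simp: key_def cong_def)
    show "?B \<in> R" using A by (auto simp: R_def)
    show "A = (A ** adjugate2 ?B) ** ?B"
      by (simp add: matrix_mul_assoc [symmetric] adjugate2_inverse(2)[OF B(1)])
  qed
  ultimately show ?thesis by (rule that)
qed

text \<open>
  The product of the conjugates \<open>f \<circ> A\<close>, for \<open>A\<close> in \<open>SL\<^sub>2(\<int>)\<close>, has level one and tends to \<open>0\<close> at \<open>\<infinity>\<close>, since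
  one factor does so and the others are bounded; so some conjugate vanishes. The product runs over the
  finite set of functions \<open>f \<circ> A\<close>, cut off to \<open>0\<close> below the half-plane. This set is permuted by
  composition with any element of \<open>SL\<^sub>2(\<int>)\<close>, and no coset representatives have to be chosen.
\<close>

theorem Gamma0_vanishing:
  assumes "N > 0" and hol: "f holomorphic_on {\<tau>. Im \<tau> > 0}"
    and inv: "\<And>A \<tau>. A \<in> Gamma0 N \<Longrightarrow> Im \<tau> > 0 \<Longrightarrow> f (moebius A \<tau>) = f \<tau>"
    and bdd: "\<And>A. A \<in> SL2Z \<Longrightarrow> (\<lambda>\<tau>. norm (f (moebius A \<tau>))) \<in> O[im_top](\<lambda>_. 1)"
    and lim: "(f \<longlongrightarrow> 0) im_top" and \<tau>: "Im \<tau> > 0"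
  shows "f \<tau> = 0"
proof -
  define cj where "cj = (\<lambda>A \<tau>. if Im \<tau> > 0 then f (moebius A \<tau>) else 0)"
  define C where "C = cj ` SL2Z"
  obtain R where R: "finite R" "R \<subseteq> SL2Z" "\<And>A. A \<in> SL2Z \<Longrightarrow> \<exists>\<alpha>\<in>Gamma0 N. \<exists>B\<in>R. A = \<alpha> ** B"
    using Gamma0_finite_cosets[OF assms(1)] by metis
  have "C \<subseteq> cj ` R"
  proof
    fix g assume "g \<in> C"
    then obtain A where A: "A \<in> SL2Z" "g = cj A" by (auto simp: C_def)
    then obtain \<alpha> B where B: "\<alpha> \<in> Gamma0 N" "B \<in> R" "A = \<alpha> ** B" using R(3) by blast
    have "cj A = cj B"
    proof
      fix \<tau> show "cj A \<tau> = cj B \<tau>"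
        using B R(2) inv[OF B(1) Im_moebius_pos[of B \<tau>]] by (auto simp: cj_def moebius_mult Gamma0_SL2Z subset_eq)
    qed
    thus "g \<in> cj ` R" using A B by auto
  qed
  hence fin: "finite C" using R(1) by (meson finite_imageI finite_subset)
  define h where "h = (\<lambda>\<tau>. \<Prod>g\<in>C. g \<tau>)"
  have holC: "g holomorphic_on {\<tau>. Im \<tau> > 0}" if "g \<in> C" for g
  proof -
    from that obtain A where A: "A \<in> SL2Z" "g = cj A" by (auto simp: C_def)
    show ?thesis unfolding A(2)
      by (rule holomorphic_transform[OF holomorphic_compose_moebius[OF hol A(1)]]) (simp add: cj_def)
  qed
  have "h \<tau> = 0" if "Im \<tau> > 0" for \<tau>
  proof (rule level_one_vanishing[OF _ _ _ that])
    show "h holomorphic_on {\<tau>. Im \<tau> > 0}" unfolding h_def by (intro holomorphic_intros holC)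
    show "h (moebius B \<tau>) = h \<tau>" if B: "B \<in> SL2Z" and \<tau>: "Im \<tau> > 0" for B \<tau>
    proof -
      define sh where "sh = (\<lambda>B g \<tau>. if Im \<tau> > 0 then g (moebius B \<tau>) else (0::complex))"
      have sh: "sh B (cj A) = cj (A ** B)" if "A \<in> SL2Z" "B \<in> SL2Z" for A B
        using that by (auto simp: sh_def cj_def fun_eq_iff moebius_mult Im_moebius_pos)
      \<comment> \<open>Composition with \<open>B\<close> is undone by composition with its inverse.\<close>
      have "bij_betw (sh B) C C"
      proof (rule bij_betw_byWitness[where f' = "sh (adjugate2 B)"])
        have B': "adjugate2 B \<in> SL2Z" by (rule adjugate2_SL2Z[OF B])
        show "\<forall>g\<in>C. sh (adjugate2 B) (sh B g) = g"
          by (auto simp: C_def sh SL2Z_mult B B' adjugate2_inverse matrix_mul_assoc [symmetric])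
        show "\<forall>g\<in>C. sh B (sh (adjugate2 B) g) = g"
          by (auto simp: C_def sh SL2Z_mult B B' adjugate2_inverse matrix_mul_assoc [symmetric])
        show "sh B ` C \<subseteq> C" "sh (adjugate2 B) ` C \<subseteq> C"
          by (auto simp: C_def sh SL2Z_mult B B')
      qed
      hence "h \<tau> = (\<Prod>g\<in>C. sh B g \<tau>)"
        unfolding h_def by (rule prod.reindex_bij_betw [symmetric])
      also have "\<dots> = h (moebius B \<tau>)" using \<tau> by (simp add: h_def sh_def)
      finally show ?thesis ..
    qed
    show "(h \<longlongrightarrow> 0) im_top"
    proof -
      define f0 where "f0 = cj (mat 1)"
      have f0: "f0 \<in> C" unfolding C_def f0_def by (rule imageI, rule SL2Z_I) simp
      have "(f0 \<longlongrightarrow> 0) im_top"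
      proof (rule Lim_transform_eventually[OF lim])
        show "eventually (\<lambda>\<tau>. f \<tau> = f0 \<tau>) im_top"
          using eventually_im_top_pos[of 0] by eventually_elim (simp add: f0_def cj_def)
      qed
      hence "f0 \<in> o[im_top](\<lambda>_. 1)" by (intro smalloI_tendsto) auto
      moreover have big: "g \<in> O[im_top](\<lambda>_. 1)" if "g \<in> C" for g
      proof -
        from that obtain A where A: "A \<in> SL2Z" "g = cj A" by (auto simp: C_def)
        obtain c where "eventually (\<lambda>\<tau>. norm (norm (f (moebius A \<tau>))) \<le> c * norm (1::real)) im_top"
          using bdd[OF A(1)] by (elim landau_o.bigE)
        hence "eventually (\<lambda>\<tau>. norm (g \<tau>) \<le> c * norm (1::complex)) im_top"
          using eventually_im_top_pos[of 0] by eventually_elim (simp add: A cj_def)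
        thus ?thesis by (rule bigoI)
      qed
      have "(\<lambda>\<tau>. \<Prod>g\<in>D. g \<tau>) \<in> O[im_top](\<lambda>_. 1)" if "D \<subseteq> C" for D
        using finite_subset[OF that fin] that
      proof (induction D rule: finite_induct)
        case (insert g D)
        thus ?case using landau_o.big.mult_in_1[OF big, of g] by auto
      qed auto
      from this[of "C - {f0}"] have "(\<lambda>\<tau>. \<Prod>g\<in>C - {f0}. g \<tau>) \<in> O[im_top](\<lambda>_. 1)" by auto
      ultimately have "(\<lambda>\<tau>. f0 \<tau> * (\<Prod>g\<in>C - {f0}. g \<tau>)) \<in> o[im_top](\<lambda>_. 1 * 1)"
        by (rule landau_o.small_big_mult)
      moreover have "(\<lambda>\<tau>. f0 \<tau> * (\<Prod>g\<in>C - {f0}. g \<tau>)) = h"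
        unfolding h_def by (rule ext, rule prod.remove [symmetric, OF fin f0])
      ultimately show ?thesis by (auto dest: smalloD_tendsto)
    qed
  qed
  hence "\<exists>g\<in>C. \<forall>z\<in>{\<tau>. Im \<tau> > 0}. g z = 0"
    using fin holC by (intro holomorphic_prod_eq_0 open_uhp connected_uhp) (auto simp: h_def intro: exI[of _ \<i>])
  then obtain A where A: "A \<in> SL2Z" "\<And>z. Im z > 0 \<Longrightarrow> cj A z = 0" by (auto simp: C_def)
  define \<sigma> where "\<sigma> = moebius (adjugate2 A) \<tau>"
  have \<sigma>: "Im \<sigma> > 0" unfolding \<sigma>_def by (intro Im_moebius_pos adjugate2_SL2Z A \<tau>)
  have "moebius A \<sigma> = moebius (A ** adjugate2 A) \<tau>"
    unfolding \<sigma>_def by (subst moebius_mult) (use A \<tau> adjugate2_SL2Z in auto)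
  hence "moebius A \<sigma> = \<tau>" by (simp add: adjugate2_inverse[OF A(1)])
  thus ?thesis using A(2)[OF \<sigma>] \<sigma> by (simp add: cj_def)
qed

section \<open>Functions whose only pole is a simple pole at infinity\<close>

lemma bigo_norm_diff:
  assumes "(\<lambda>x. norm (f x)) \<in> O[F](g)" "(\<lambda>x. norm (h x)) \<in> O[F](g)"
  shows "(\<lambda>x. norm (f x - h x)) \<in> O[F](g)"
proof -
  have "(\<lambda>x. norm (f x - h x)) \<in> O[F](\<lambda>x. norm (f x) + norm (h x))"
    by (intro bigoI[where c = 1] always_eventually) (auto intro: norm_triangle_ineq4)
  thus ?thesis by (rule landau_o.big.trans[OF _ sum_in_bigo(1)[OF assms]])
qed

lemma bigo_norm_add:
  assumes "(\<lambda>x. norm (f x)) \<in> O[F](g)" "(\<lambda>x. norm (h x)) \<in> O[F](g)"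
  shows "(\<lambda>x. norm (f x + h x)) \<in> O[F](g)"
  using bigo_norm_diff[OF assms(1), of "\<lambda>x. - h x"] assms(2) by simp

lemma growth_limit:
  assumes h: "h > 0" and hol: "g holomorphic_on {\<tau>. Im \<tau> > Y}"
    and per: "\<And>\<tau>. Im \<tau> > Y \<Longrightarrow> g (\<tau> + of_nat h) = g \<tau>"
    and growth: "(\<lambda>\<tau>. norm (g \<tau>)) \<in> O[im_top](\<lambda>\<tau>. exp (2 * pi * real n / real h * Im \<tau>))"
  obtains L where "((\<lambda>\<tau>. g \<tau> * qpow (1 / of_nat h) \<tau> ^ n) \<longlongrightarrow> L) im_top"
proof -
  obtain G r where G: "r > 0" "G holomorphic_on ball 0 r"
    "eventually (\<lambda>\<tau>. g \<tau> * qpow (1 / of_nat h) \<tau> ^ n = G (qpow (1 / of_nat h) \<tau>)) im_top"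
    by (rule periodic_growth_factor[OF assms])
  have "isCont G 0" using G(1,2)
    by (meson centre_in_ball continuous_on_eq_continuous_at holomorphic_on_imp_continuous_on open_ball)
  hence lim: "((\<lambda>\<tau>. G (qpow (1 / of_nat h) \<tau>)) \<longlongrightarrow> G 0) im_top"
    unfolding isCont_def by (rule filterlim_compose[OF _ filterlim_qpow_width[OF h]])
  have "eventually (\<lambda>\<tau>. G (qpow (1 / of_nat h) \<tau>) = g \<tau> * qpow (1 / of_nat h) \<tau> ^ n) im_top"
    using G(3) by eventually_elim simp
  from Lim_transform_eventually[OF lim this] show ?thesis by (rule that)
qed

text \<open>
  A holomorphic function that vanishes at \<open>0\<close> is divisible by its argument.
\<close>

lemma growth_improve:
  assumes h: "h > 0" and hol: "g holomorphic_on {\<tau>. Im \<tau> > Y}"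
    and per: "\<And>\<tau>. Im \<tau> > Y \<Longrightarrow> g (\<tau> + of_nat h) = g \<tau>"
    and growth: "(\<lambda>\<tau>. norm (g \<tau>)) \<in> O[im_top](\<lambda>\<tau>. exp (2 * pi * real n / real h * Im \<tau>))"
    and lim: "((\<lambda>\<tau>. g \<tau> * qpow (1 / of_nat h) \<tau> ^ n) \<longlongrightarrow> 0) im_top"
  shows "(\<lambda>\<tau>. norm (g \<tau>)) \<in> O[im_top](\<lambda>\<tau>. exp (2 * pi * (real n - 1) / real h * Im \<tau>))"
proof -
  obtain G r where G: "r > 0" "G holomorphic_on ball 0 r"
    "eventually (\<lambda>\<tau>. g \<tau> * qpow (1 / of_nat h) \<tau> ^ n = G (qpow (1 / of_nat h) \<tau>)) im_top"
    by (rule periodic_growth_factor[OF h hol per growth])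
  have "isCont G 0" using G(1,2)
    by (meson centre_in_ball continuous_on_eq_continuous_at holomorphic_on_imp_continuous_on open_ball)
  hence "((\<lambda>\<tau>. G (qpow (1 / of_nat h) \<tau>)) \<longlongrightarrow> G 0) im_top"
    unfolding isCont_def by (rule filterlim_compose[OF _ filterlim_qpow_width[OF h]])
  moreover have "((\<lambda>\<tau>. G (qpow (1 / of_nat h) \<tau>)) \<longlongrightarrow> 0) im_top"
    by (rule Lim_transform_eventually[OF lim G(3)])
  ultimately have G0: "G 0 = 0" using tendsto_unique[OF im_top_nontrivial] by blast
  have "G field_differentiable at 0" using G(1,2) by (intro holomorphic_on_imp_differentiable_at[OF G(2)]) auto
  then obtain D where "(G has_field_derivative D) (at 0)" by (auto simp: field_differentiable_def)
  hence "((\<lambda>z. G z / z) \<longlongrightarrow> D) (at 0)" by (simp add: has_field_derivative_iff G0)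
  hence "((\<lambda>z. norm (G z / z)) \<longlongrightarrow> norm D) (at 0)" by (rule tendsto_norm)
  hence "eventually (\<lambda>z. norm (G z / z) < norm D + 1) (at 0)" by (rule order_tendstoD) simp
  hence "eventually (\<lambda>\<tau>. norm (G (qpow (1 / of_nat h) \<tau>) / qpow (1 / of_nat h) \<tau>) < norm D + 1) im_top"
    by (rule eventually_qpow_width[OF h])
  hence "eventually (\<lambda>\<tau>. norm (norm (g \<tau>)) \<le> (norm D + 1) * norm (exp (2 * pi * (real n - 1) / real h * Im \<tau>))) im_top"
    using G(3)
  proof eventually_elim
    case (elim \<tau>)
    define q where "q = qpow (1 / of_nat h) \<tau>"
    have nq: "norm q = exp (- (2 * pi / real h * Im \<tau>))" by (simp add: q_def norm_qpow_width)
    have q: "norm q > 0" by (simp add: q_def)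
    have e: "exp (2 * pi * (real n - 1) / real h * Im \<tau>) = norm q / norm q ^ n"
      unfolding nq exp_of_nat_mult [symmetric] exp_diff [symmetric] exp_inj_iff by (simp add: diff_divide_distrib algebra_simps)
    have "norm (g \<tau>) * norm q ^ n = norm (G q)" using elim(2) by (simp add: q_def flip: norm_mult norm_power)
    also have "\<dots> \<le> (norm D + 1) * norm q"
      using elim(1) q unfolding q_def [symmetric] by (simp add: norm_divide field_simps)
    finally have "norm (g \<tau>) \<le> (norm D + 1) * norm q / norm q ^ n" using q by (simp add: pos_le_divide_eq)
    thus ?case unfolding e by simp
  qed
  thus ?thesis by (rule bigoI)
qed

lemma Gamma0_translation: "vector [vector [1, k], vector [0, 1]] \<in> Gamma0 N"
  by (simp add: Gamma0_iff SL2Z_translation)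

text \<open>
  A conjugate \<open>A T\<^sup>N adj(A)\<close> of the translation by \<open>N\<close> is congruent to the identity modulo \<open>N\<close>.
\<close>

lemma Gamma0_invariant_conjugate_periodic:
  assumes inv: "\<And>A \<tau>. A \<in> Gamma0 N \<Longrightarrow> Im \<tau> > 0 \<Longrightarrow> f (moebius A \<tau>) = f \<tau>"
    and A: "A \<in> SL2Z" and \<tau>: "Im \<tau> > 0"
  shows "f (moebius A (\<tau> + of_nat N)) = f (moebius A \<tau>)"
proof -
  define T where "T = (vector [vector [1, int N], vector [0, 1]] :: int ^ 2 ^ 2)"
  define P where "P = A ** (T ** adjugate2 A)"
  have T: "T \<in> SL2Z" unfolding T_def by (rule SL2Z_translation)
  have SL: "P \<in> SL2Z" unfolding P_def by (intro SL2Z_mult A T adjugate2_SL2Z)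
  have Te: "a11 T = 1" "a12 T = int N" "a21 T = 0" "a22 T = 1" by (simp_all add: T_def)
  have "a21 P = - int N * (a21 A * a21 A)"
    by (simp add: P_def Te algebra_simps)
  hence P: "P \<in> Gamma0 N" using SL by (simp add: Gamma0_iff)
  have "P ** A = A ** T"
    by (simp add: P_def matrix_mul_assoc [symmetric] adjugate2_inverse(2)[OF A])
  hence "moebius P (moebius A \<tau>) = moebius A (\<tau> + of_nat N)"
    using moebius_mult[OF SL A \<tau>] moebius_mult[OF A T \<tau>] by (simp add: T_def moebius_translation)
  thus ?thesis using inv[OF P Im_moebius_pos[OF A \<tau>]] by simp
qed

text \<open>
  On the modular curve of \<open>\<Gamma>\<^sub>0(N)\<close>, such a function has a single simple pole, at the cusp \<open>\<infinity>\<close>. A matrix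
  moves \<open>\<infinity>\<close> to an equivalent cusp precisely when \<open>N\<close> divides its lower left entry.
\<close>

locale hauptmodul =
  fixes N :: nat and t :: "complex \<Rightarrow> complex"
  assumes N_pos: "N > 0"
    and holomorphic: "t holomorphic_on {\<tau>. Im \<tau> > 0}"
    and invariant: "\<And>A \<tau>. A \<in> Gamma0 N \<Longrightarrow> Im \<tau> > 0 \<Longrightarrow> t (moebius A \<tau>) = t \<tau>"
    and bounded_at_cusps: "\<And>A. A \<in> SL2Z \<Longrightarrow> \<not> int N dvd a21 A \<Longrightarrow>
            (\<lambda>\<tau>. norm (t (moebius A \<tau>))) \<in> O[im_top](\<lambda>_. 1)"
    and simple_pole_at_infinity: "(\<lambda>\<tau>. norm (t \<tau>)) \<in> \<Theta>[im_top](\<lambda>\<tau>. exp (2 * pi * Im \<tau>))"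
begin

lemma leading_coefficient:
  obtains l where "l \<noteq> 0" "((\<lambda>\<tau>. t \<tau> * qpow 1 \<tau>) \<longlongrightarrow> l) im_top"
proof -
  have per: "t (\<tau> + of_nat 1) = t \<tau>" if "Im \<tau> > 0" for \<tau>
    using invariant[OF Gamma0_translation[of 1] that] by (simp add: moebius_translation)
  have growth: "(\<lambda>\<tau>. norm (t \<tau>)) \<in> O[im_top](\<lambda>\<tau>. exp (2 * pi * real 1 / real 1 * Im \<tau>))"
    using simple_pole_at_infinity by (simp add: bigthetaD1)
  obtain l where l: "((\<lambda>\<tau>. t \<tau> * qpow (1 / of_nat 1) \<tau> ^ 1) \<longlongrightarrow> l) im_top"
    using growth_limit[OF _ holomorphic per growth] by (metis zero_less_one)
  hence l: "((\<lambda>\<tau>. t \<tau> * qpow 1 \<tau>) \<longlongrightarrow> l) im_top" by simp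
  obtain c where c: "c > 0" "eventually (\<lambda>\<tau>. norm (norm (t \<tau>)) \<ge> c * norm (exp (2 * pi * Im \<tau>))) im_top"
    using bigthetaD2[OF simple_pole_at_infinity] by (elim landau_omega.bigE)
  have "eventually (\<lambda>\<tau>. c \<le> norm (t \<tau> * qpow 1 \<tau>)) im_top"
    using c(2)
  proof eventually_elim
    case (elim \<tau>)
    have "c = c * exp (2 * pi * Im \<tau>) * norm (qpow 1 \<tau>)" by (simp add: norm_qpow mult.assoc flip: exp_add)
    also have "\<dots> \<le> norm (t \<tau>) * norm (qpow 1 \<tau>)" using elim by (intro mult_right_mono) auto
    finally show ?case by (simp add: norm_mult)
  qed
  hence "c \<le> norm l" by (intro tendsto_lowerbound[OF tendsto_norm[OF l]]) auto
  hence "l \<noteq> 0" using c(1) by auto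
  thus ?thesis using l by (rule that)
qed

text \<open>
  At the cusps equivalent to \<open>\<infinity>\<close> boundedness follows from the limit and the invariance.
\<close>

lemma constant_if_bounded:
  assumes hol: "f holomorphic_on {\<tau>. Im \<tau> > 0}"
    and inv: "\<And>A \<tau>. A \<in> Gamma0 N \<Longrightarrow> Im \<tau> > 0 \<Longrightarrow> f (moebius A \<tau>) = f \<tau>"
    and bdd: "\<And>A. A \<in> SL2Z \<Longrightarrow> \<not> int N dvd a21 A \<Longrightarrow> (\<lambda>\<tau>. norm (f (moebius A \<tau>))) \<in> O[im_top](\<lambda>_. 1)"
    and lim: "(f \<longlongrightarrow> c) im_top" and \<tau>: "Im \<tau> > 0"
  shows "f \<tau> = c"
proof -
  have "(\<lambda>\<tau>. f \<tau> - c) \<tau> = 0"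
  proof (rule Gamma0_vanishing[OF N_pos _ _ _ _ \<tau>])
    show "(\<lambda>\<tau>. f \<tau> - c) holomorphic_on {\<tau>. Im \<tau> > 0}" by (intro holomorphic_intros hol)
    show "f (moebius A \<tau>) - c = f \<tau> - c" if "A \<in> Gamma0 N" "Im \<tau> > 0" for A \<tau>
      using inv[OF that] by simp
    show lim0: "((\<lambda>\<tau>. f \<tau> - c) \<longlongrightarrow> 0) im_top" using tendsto_diff[OF lim tendsto_const[of c]] by simp
    fix A assume A: "A \<in> SL2Z"
    show "(\<lambda>\<tau>. norm (f (moebius A \<tau>) - c)) \<in> O[im_top](\<lambda>_. 1)"
    proof (cases "int N dvd a21 A")
      case True
      hence "A \<in> Gamma0 N" using A by (simp add: Gamma0_iff)
      hence ev: "eventually (\<lambda>\<tau>. norm (f (moebius A \<tau>) - c) = norm (f \<tau> - c)) im_top"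
        using eventually_im_top_pos[of 0] by (auto elim!: eventually_mono simp: inv)
      have "(\<lambda>\<tau>. norm (f \<tau> - c)) \<in> O[im_top](\<lambda>_. 1)"
        by (intro bigoI_tendsto[where c = 0]) (use tendsto_norm[OF lim0] in auto)
      thus ?thesis by (subst landau_o.big.in_cong[OF ev])
    next
      case False
      show ?thesis by (rule bigo_norm_diff[OF bdd[OF A False]]) simp
    qed
  qed
  thus ?thesis by simp
qed

text \<open>
  Induction on the order of the pole at \<open>\<infinity>\<close>. A suitable multiple of the power of \<open>t\<close> with the same order
  cancels the leading term of \<open>f\<close>, and it does no harm at the other cusps, where \<open>t\<close> is bounded.
\<close>

lemma polynomial_if_holomorphic:
  assumes "f holomorphic_on {\<tau>. Im \<tau> > 0}"
    and "\<And>A \<tau>. A \<in> Gamma0 N \<Longrightarrow> Im \<tau> > 0 \<Longrightarrow> f (moebius A \<tau>) = f \<tau>"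
    and "\<And>A. A \<in> SL2Z \<Longrightarrow> \<not> int N dvd a21 A \<Longrightarrow> (\<lambda>\<tau>. norm (f (moebius A \<tau>))) \<in> O[im_top](\<lambda>_. 1)"
    and "(\<lambda>\<tau>. norm (f \<tau>)) \<in> O[im_top](\<lambda>\<tau>. exp (2 * pi * real n * Im \<tau>))"
  shows "\<exists>p. \<forall>\<tau>. Im \<tau> > 0 \<longrightarrow> f \<tau> = poly p (t \<tau>)"
  using assms
proof (induction n arbitrary: f)
  case (0 f)
  have per: "f (\<tau> + of_nat 1) = f \<tau>" if "Im \<tau> > 0" for \<tau>
    using "0.prems"(2)[OF Gamma0_translation[of 1] that] by (simp add: moebius_translation)
  have growth: "(\<lambda>\<tau>. norm (f \<tau>)) \<in> O[im_top](\<lambda>\<tau>. exp (2 * pi * real 0 / real 1 * Im \<tau>))"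
    using "0.prems"(4) by simp
  obtain L where L: "((\<lambda>\<tau>. f \<tau> * qpow (1 / of_nat 1) \<tau> ^ 0) \<longlongrightarrow> L) im_top"
    by (rule growth_limit[OF zero_less_one "0.prems"(1) per growth])
  hence "(f \<longlongrightarrow> L) im_top" by simp
  from constant_if_bounded[OF "0.prems"(1-3) this] have "\<forall>\<tau>. Im \<tau> > 0 \<longrightarrow> f \<tau> = poly [:L:] (t \<tau>)" by simp
  thus ?case by blast
next
  case (Suc n f)
  have per: "f (\<tau> + of_nat 1) = f \<tau>" if "Im \<tau> > 0" for \<tau>
    using Suc.prems(2)[OF Gamma0_translation[of 1] that] by (simp add: moebius_translation)
  have growth: "(\<lambda>\<tau>. norm (f \<tau>)) \<in> O[im_top](\<lambda>\<tau>. exp (2 * pi * real (Suc n) / real 1 * Im \<tau>))"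
    using Suc.prems(4) by simp
  obtain L where L: "((\<lambda>\<tau>. f \<tau> * qpow (1 / of_nat 1) \<tau> ^ Suc n) \<longlongrightarrow> L) im_top"
    by (rule growth_limit[OF zero_less_one Suc.prems(1) per growth])
  obtain l where l: "l \<noteq> 0" "((\<lambda>\<tau>. t \<tau> * qpow 1 \<tau>) \<longlongrightarrow> l) im_top" by (rule leading_coefficient)
  define k where "k = L / l ^ Suc n"
  define g where "g = (\<lambda>\<tau>. f \<tau> - k * t \<tau> ^ Suc n)"
  have holg: "g holomorphic_on {\<tau>. Im \<tau> > 0}"
    unfolding g_def by (intro holomorphic_intros Suc.prems(1) holomorphic)
  have invg: "g (moebius A \<tau>) = g \<tau>" if "A \<in> Gamma0 N" "Im \<tau> > 0" for A \<tau>
    using Suc.prems(2)[OF that] invariant[OF that] by (simp add: g_def)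
  have bddg: "(\<lambda>\<tau>. norm (g (moebius A \<tau>))) \<in> O[im_top](\<lambda>_. 1)" if A: "A \<in> SL2Z" "\<not> int N dvd a21 A" for A
  proof -
    have "(\<lambda>\<tau>. norm (t (moebius A \<tau>)) ^ Suc n) \<in> O[im_top](\<lambda>_. 1 ^ Suc n)"
      by (intro landau_o.big_power bounded_at_cusps A)
    hence "(\<lambda>\<tau>. norm (k * t (moebius A \<tau>) ^ Suc n)) \<in> O[im_top](\<lambda>_. 1)"
      by (simp add: norm_mult norm_power)
    thus ?thesis unfolding g_def by (rule bigo_norm_diff[OF Suc.prems(3)[OF A]])
  qed
  have perg: "g (\<tau> + of_nat 1) = g \<tau>" if "Im \<tau> > 0" for \<tau>
    using invg[OF Gamma0_translation[of 1] that] by (simp add: moebius_translation)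
  have limg: "((\<lambda>\<tau>. g \<tau> * qpow (1 / of_nat 1) \<tau> ^ Suc n) \<longlongrightarrow> 0) im_top"
  proof -
    have "((\<lambda>\<tau>. f \<tau> * qpow (1 / of_nat 1) \<tau> ^ Suc n - k * (t \<tau> * qpow 1 \<tau>) ^ Suc n) \<longlongrightarrow> L - k * l ^ Suc n) im_top"
      by (intro tendsto_intros L l)
    moreover have "L - k * l ^ Suc n = 0" using l by (simp add: k_def)
    moreover have "(\<lambda>\<tau>. f \<tau> * qpow (1 / of_nat 1) \<tau> ^ Suc n - k * (t \<tau> * qpow 1 \<tau>) ^ Suc n) = (\<lambda>\<tau>. g \<tau> * qpow (1 / of_nat 1) \<tau> ^ Suc n)"
      by (simp add: g_def fun_eq_iff algebra_simps power_mult_distrib)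
    ultimately show ?thesis by simp
  qed
  have growthg: "(\<lambda>\<tau>. norm (g \<tau>)) \<in> O[im_top](\<lambda>\<tau>. exp (2 * pi * real (Suc n) / real 1 * Im \<tau>))"
  proof -
    have e: "exp (2 * pi * Im \<tau>) ^ Suc n = exp (2 * pi * real (Suc n) / real 1 * Im \<tau>)" for \<tau>
      unfolding exp_of_nat_mult [symmetric] by (simp add: algebra_simps)
    have "(\<lambda>\<tau>. norm (t \<tau>) ^ Suc n) \<in> O[im_top](\<lambda>\<tau>. exp (2 * pi * Im \<tau>) ^ Suc n)"
      by (intro landau_o.big_power bigthetaD1 simple_pole_at_infinity)
    hence "(\<lambda>\<tau>. norm (k * t \<tau> ^ Suc n)) \<in> O[im_top](\<lambda>\<tau>. exp (2 * pi * real (Suc n) / real 1 * Im \<tau>))"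
      unfolding e norm_mult norm_power by simp
    thus ?thesis unfolding g_def by (rule bigo_norm_diff[OF growth])
  qed
  have "(\<lambda>\<tau>. norm (g \<tau>)) \<in> O[im_top](\<lambda>\<tau>. exp (2 * pi * (real (Suc n) - 1) / real 1 * Im \<tau>))"
    by (rule growth_improve[OF zero_less_one holg perg growthg limg])
  hence "(\<lambda>\<tau>. norm (g \<tau>)) \<in> O[im_top](\<lambda>\<tau>. exp (2 * pi * real n * Im \<tau>))" by simp
  from Suc.IH[OF holg invg bddg this] obtain p where p: "\<And>\<tau>. Im \<tau> > 0 \<Longrightarrow> g \<tau> = poly p (t \<tau>)" by blast
  have "\<forall>\<tau>. Im \<tau> > 0 \<longrightarrow> f \<tau> = poly (p + monom k (Suc n)) (t \<tau>)"
    using p by (simp add: g_def poly_monom algebra_simps)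
  thus ?case by blast
qed

end

section \<open>Clearing poles\<close>

lemma meromorphic_clear_pole:
  assumes "f meromorphic_on {z}"
  obtains n where "(\<lambda>w. f w * (w - z) ^ n) \<in> O[at z](\<lambda>_. 1)"
proof -
  have iso: "isolated_singularity_at f z" and ne: "not_essential f z"
    using assms by (auto simp: meromorphic_at_iff)
  show ?thesis
  proof (cases "is_pole f z")
    case True
    obtain r where r: "r > 0" "f analytic_on ball z r - {z}" using iso by (auto simp: isolated_singularity_at_def)
    define g m where "g = zor_poly f z" and "m = nat (- zorder f z)"
    obtain r' where r': "r' > 0" "g holomorphic_on cball z r'" "\<And>w. w \<in> cball z r' - {z} \<Longrightarrow> f w = g w / (w - z) ^ m"
      using zorder_exist_pole[OF analytic_imp_holomorphic[OF r(2)] open_ball _ True] r(1) unfolding g_def m_def by auto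
    have "isCont g z"
      using r' by (meson centre_in_ball continuous_on_eq_continuous_at holomorphic_on_imp_continuous_on
                     holomorphic_on_subset ball_subset_cball open_ball)
    hence "g \<in> O[at z](\<lambda>_. 1)" by (intro bigoI_tendsto[where c = "g z"]) (auto simp: isCont_def)
    moreover have "eventually (\<lambda>w. g w = f w * (w - z) ^ m) (at z)"
    proof -
      have "eventually (\<lambda>w. w \<in> ball z r' - {z}) (at z)" using r'(1) by (intro eventually_at_in_open) auto
      thus ?thesis by eventually_elim (use r'(3) in auto)
    qed
    ultimately have "(\<lambda>w. f w * (w - z) ^ m) \<in> O[at z](\<lambda>_. 1)"
      by (rule landau_o.big.in_cong[THEN iffD1, rotated])
    thus ?thesis by (rule that)
  next
    case False
    then obtain c where "f \<midarrow>z\<rightarrow> c" using ne by (auto simp: not_essential_def)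
    hence "(\<lambda>w. f w * (w - z) ^ 0) \<in> O[at z](\<lambda>_. 1)" by (intro bigoI_tendsto[where c = c]) auto
    thus ?thesis by (rule that)
  qed
qed

lemma locally_bounded_nearby:
  fixes g :: "complex \<Rightarrow> complex"
  assumes "g \<in> O[at z](\<lambda>_. 1)"
  obtains U where "open U" "z \<in> U" "\<And>w. w \<in> U \<Longrightarrow> g \<in> O[at w](\<lambda>_. 1)"
proof -
  obtain c where "eventually (\<lambda>w. norm (g w) \<le> c * norm (1::complex)) (at z)" using assms by (elim landau_o.bigE)
  then obtain U where U: "open U" "z \<in> U" "\<And>w. w \<in> U \<Longrightarrow> w \<noteq> z \<Longrightarrow> norm (g w) \<le> c * norm (1::complex)"
    unfolding eventually_at_topological by blast
  have "g \<in> O[at w](\<lambda>_. 1)" if "w \<in> U" for w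
  proof (cases "w = z")
    case False
    have "eventually (\<lambda>x. x \<in> U - {z}) (at w)"
      using U(1) that False by (intro eventually_at_in_open') auto
    hence "eventually (\<lambda>x. norm (g x) \<le> c * norm (1::complex)) (at w)" by eventually_elim (use U(3) in auto)
    thus ?thesis by (rule bigoI)
  qed (use assms in auto)
  thus ?thesis using that U by blast
qed

lemma filterlim_moebius_at:
  assumes A: "A \<in> SL2Z" and \<tau>: "Im \<tau> > 0"
  shows "filterlim (moebius A) (at (moebius A \<tau>)) (at \<tau>)"
proof -
  have "isCont (moebius A) \<tau>" by (rule isCont_halfplane[OF holomorphic_moebius[OF A] \<tau>])
  moreover have "eventually (\<lambda>w. moebius A w \<noteq> moebius A \<tau>) (at \<tau>)"
  proof -
    have "eventually (\<lambda>w. w \<in> {w. Im w > 0} - {\<tau>}) (at \<tau>)"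
      using \<tau> by (intro eventually_at_in_open open_uhp) auto
    thus ?thesis
    proof eventually_elim
      case (elim w)
      have inj: "moebius (adjugate2 A) (moebius A x) = x" if "Im x > 0" for x
        using moebius_mult[OF adjugate2_SL2Z[OF A] A that] by (simp add: adjugate2_inverse[OF A])
      show ?case using inj[of w] inj[OF \<tau>] elim by force
    qed
  qed
  ultimately show ?thesis by (simp add: filterlim_at isCont_def)
qed

lemma nicely_meromorphic_eqI:
  assumes "f nicely_meromorphic_on S" "z \<in> S" "f \<midarrow>z\<rightarrow> c"
  shows "f z = c"
proof -
  have "\<not> is_pole f z"
    using assms(3) not_tendsto_and_filterlim_at_infinity[of "at z" f c] by (auto simp: is_pole_def)
  hence "f \<midarrow>z\<rightarrow> f z" using assms by (auto simp: nicely_meromorphic_on_def)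
  thus ?thesis using assms(3) by (metis LIM_unique)
qed

text \<open>
  The value of a nicely meromorphic function at a point is determined by its behaviour nearby: it is the
  limit, or \<open>0\<close> at a pole. So an identity that holds away from isolated points holds everywhere.
\<close>

lemma nicely_meromorphic_invariantI:
  assumes f: "f nicely_meromorphic_on {\<tau>. Im \<tau> > 0}" and A: "A \<in> SL2Z" and \<tau>: "Im \<tau> > 0"
    and ev: "eventually (\<lambda>w. f (moebius A w) = f w) (at \<tau>)"
  shows "f (moebius A \<tau>) = f \<tau>"
proof (cases "is_pole f (moebius A \<tau>)")
  case True
  have "filterlim (\<lambda>w. f (moebius A w)) at_infinity (at \<tau>)"
    using filterlim_compose[OF _ filterlim_moebius_at[OF A \<tau>]] True unfolding is_pole_def by blast
  hence "filterlim f at_infinity (at \<tau>)" using filterlim_cong[OF refl refl ev] by blast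
  hence "is_pole f \<tau>" by (simp add: is_pole_def)
  have zero: "f z = 0" if "is_pole f z" "Im z > 0" for z
    using f that not_tendsto_and_filterlim_at_infinity[of "at z" f "f z"]
    by (auto simp: nicely_meromorphic_on_def is_pole_def)
  show ?thesis using zero[OF True Im_moebius_pos[OF A \<tau>]] zero[OF \<open>is_pole f \<tau>\<close> \<tau>] by simp
next
  case False
  hence "f \<midarrow>moebius A \<tau>\<rightarrow> f (moebius A \<tau>)"
    using f Im_moebius_pos[OF A \<tau>] by (auto simp: nicely_meromorphic_on_def)
  from filterlim_compose[OF this filterlim_moebius_at[OF A \<tau>]]
  have "f \<midarrow>\<tau>\<rightarrow> f (moebius A \<tau>)" using filterlim_cong[OF refl refl ev] by blast
  from nicely_meromorphic_eqI[OF f _ this] \<tau> show ?thesis by simp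
qed

text \<open>
  In the coordinate \<open>q\<^bsup>1/h\<^esup>\<close> the function is a power times a function that does not vanish at \<open>0\<close>, so it
  cannot decay faster than exponentially.
\<close>

lemma growth_reciprocal:
  assumes h: "h > 0" and hol: "g holomorphic_on {\<tau>. Im \<tau> > Y}"
    and per: "\<And>\<tau>. Im \<tau> > Y \<Longrightarrow> g (\<tau> + of_nat h) = g \<tau>"
    and growth: "(\<lambda>\<tau>. norm (g \<tau>)) \<in> O[im_top](\<lambda>\<tau>. exp (2 * pi * real n / real h * Im \<tau>))"
    and nz: "\<not> eventually (\<lambda>\<tau>. g \<tau> = 0) im_top"
  obtains k where "eventually (\<lambda>\<tau>. g \<tau> \<noteq> 0) im_top"
    "(\<lambda>\<tau>. norm (1 / g \<tau>)) \<in> O[im_top](\<lambda>\<tau>. exp (2 * pi * real k / real h * Im \<tau>))"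
proof -
  obtain G r where G: "r > 0" "G holomorphic_on ball 0 r"
    "eventually (\<lambda>\<tau>. g \<tau> * qpow (1 / of_nat h) \<tau> ^ n = G (qpow (1 / of_nat h) \<tau>)) im_top"
    by (rule periodic_growth_factor[OF h hol per growth])
  have "\<exists>k F s. s > 0 \<and> F holomorphic_on ball 0 s \<and> F 0 \<noteq> 0 \<and> (\<forall>z\<in>ball 0 s. G z = z ^ k * F z)"
  proof (cases "G 0 = 0")
    case False
    thus ?thesis using G by (intro exI[of _ 0] exI[of _ G] exI[of _ r]) auto
  next
    case True
    have "\<not> G constant_on ball 0 r"
    proof
      assume "G constant_on ball 0 r"
      hence G0: "G z = 0" if "z \<in> ball 0 r" for z using True that G(1) unfolding constant_on_def by (metis centre_in_ball)
      have "eventually (\<lambda>z. z \<in> ball 0 r) (at (0::complex))"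
        using eventually_at_ball[OF G(1), of 0 UNIV] by (simp only: UNIV_I simp_thms)
      hence "eventually (\<lambda>\<tau>. qpow (1 / of_nat h) \<tau> \<in> ball 0 r) im_top" by (rule eventually_qpow_width[OF h])
      hence "eventually (\<lambda>\<tau>. g \<tau> = 0) im_top" using G(3) by eventually_elim (use G0 in simp)
      with nz show False by contradiction
    qed
    then obtain F s k where *: "0 < s" "F holomorphic_on ball 0 s" "\<And>w. w \<in> ball 0 s \<Longrightarrow> G w = (w - 0) ^ k * F w"
        "\<And>w. w \<in> ball 0 s \<Longrightarrow> F w \<noteq> 0"
      using holomorphic_factor_zero_nonconstant[OF G(2) open_ball connected_ball _ True] G(1)
      by (metis centre_in_ball)
    thus ?thesis by (intro exI[of _ k] exI[of _ F] exI[of _ s]) auto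
  qed
  then obtain k F s where F: "s > 0" "F holomorphic_on ball 0 s" "F 0 \<noteq> 0" "\<And>z. z \<in> ball 0 s \<Longrightarrow> G z = z ^ k * F z"
    by blast
  have "isCont F 0" using F(1,2)
    by (meson centre_in_ball continuous_on_eq_continuous_at holomorphic_on_imp_continuous_on open_ball)
  hence "((\<lambda>z. norm (F z)) \<longlongrightarrow> norm (F 0)) (at 0)" unfolding isCont_def by (rule tendsto_norm)
  hence "eventually (\<lambda>z. norm (F z) > norm (F 0) / 2) (at 0)" by (rule order_tendstoD) (use F in simp)
  moreover have "eventually (\<lambda>z. z \<in> ball 0 (min s 1)) (at (0::complex))"
  proof -
    have "min s 1 > 0" using F(1) by simp
    from eventually_at_ball[OF this, of 0 UNIV] show ?thesis by (simp only: UNIV_I simp_thms)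
  qed
  ultimately have "eventually (\<lambda>z. norm (F z) > norm (F 0) / 2 \<and> z \<in> ball 0 (min s 1)) (at 0)"
    by (rule eventually_conj)
  hence "eventually (\<lambda>\<tau>. norm (F (qpow (1 / of_nat h) \<tau>)) > norm (F 0) / 2 \<and> qpow (1 / of_nat h) \<tau> \<in> ball 0 (min s 1)) im_top"
    by (rule eventually_qpow_width[OF h])
  hence *: "eventually (\<lambda>\<tau>. g \<tau> \<noteq> 0 \<and> norm (norm (1 / g \<tau>)) \<le> (2 / norm (F 0)) * norm (exp (2 * pi * real k / real h * Im \<tau>))) im_top"
    using G(3)
  proof eventually_elim
    case (elim \<tau>)
    define q where "q = qpow (1 / of_nat h) \<tau>"
    have q: "norm q > 0" "norm q \<le> 1" "q \<in> ball 0 s" "norm (F q) > norm (F 0) / 2" using elim(1) by (auto simp: q_def)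
    have e: "exp (2 * pi * real k / real h * Im \<tau>) = 1 / norm q ^ k"
    proof -
      have "norm q ^ k = exp (- (2 * pi * real k / real h * Im \<tau>))"
        unfolding q_def norm_qpow_width exp_of_nat_mult [symmetric] by (simp add: mult_ac)
      thus ?thesis by (simp add: exp_minus inverse_eq_divide)
    qed
    have eq: "g \<tau> * q ^ n = q ^ k * F q" using elim(2) F(4)[OF q(3)] by (simp add: q_def)
    have Fq: "F q \<noteq> 0" using q(4) by auto
    have gnz: "g \<tau> \<noteq> 0" using eq q(1) Fq by auto
    have "norm (g \<tau>) * norm q ^ n = norm q ^ k * norm (F q)" using eq by (metis norm_mult norm_power)
    moreover have "norm (g \<tau>) * norm q ^ n \<le> norm (g \<tau>) * 1"
      using q by (intro mult_left_mono power_le_one) auto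
    moreover have "norm q ^ k * norm (F q) \<ge> norm q ^ k * (norm (F 0) / 2)"
      using q by (intro mult_left_mono) auto
    ultimately have le: "norm q ^ k * (norm (F 0) / 2) \<le> norm (g \<tau>)" by linarith
    have "1 / norm (g \<tau>) \<le> 1 / (norm q ^ k * (norm (F 0) / 2))"
      using q F(3) gnz by (intro divide_left_mono le mult_pos_pos) auto
    thus ?case using gnz unfolding e by (simp add: norm_divide mult_ac)
  qed
  show ?thesis
  proof (rule that)
    show "eventually (\<lambda>\<tau>. g \<tau> \<noteq> 0) im_top" using * by eventually_elim simp
    show "(\<lambda>\<tau>. norm (1 / g \<tau>)) \<in> O[im_top](\<lambda>\<tau>. exp (2 * pi * real k / real h * Im \<tau>))"
      by (rule bigoI[where c = "2 / norm (F 0)"]) (use * in \<open>eventually_elim, simp\<close>)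
  qed
qed

lemma exp_growth_mono:
  assumes "a \<le> b"
  shows "(\<lambda>\<tau>. exp (a * Im \<tau>)) \<in> O[im_top](\<lambda>\<tau>. exp (b * Im \<tau>))"
proof (rule bigoI[where c = 1])
  show "eventually (\<lambda>\<tau>. norm (exp (a * Im \<tau>)) \<le> 1 * norm (exp (b * Im \<tau>))) im_top"
    using eventually_im_top_pos[of 0] by eventually_elim (use assms in \<open>simp add: mult_right_mono\<close>)
qed

context hauptmodul
begin

lemma growth_at_cusps:
  assumes A: "A \<in> SL2Z"
  shows "(\<lambda>\<tau>. norm (t (moebius A \<tau>))) \<in> O[im_top](\<lambda>\<tau>. exp (2 * pi * Im \<tau>))"
proof (cases "int N dvd a21 A")
  case True
  hence "A \<in> Gamma0 N" using A by (simp add: Gamma0_iff)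
  hence ev: "eventually (\<lambda>\<tau>. norm (t (moebius A \<tau>)) = norm (t \<tau>)) im_top"
    using eventually_im_top_pos[of 0] by (auto elim!: eventually_mono simp: invariant)
  show ?thesis by (subst landau_o.big.in_cong[OF ev]) (rule bigthetaD1[OF simple_pole_at_infinity])
next
  case False
  have "(\<lambda>\<tau>. 1) \<in> O[im_top](\<lambda>\<tau>. exp (2 * pi * Im \<tau>))" using exp_growth_mono[of 0 "2 * pi"] by simp
  with bounded_at_cusps[OF A False] show ?thesis by (rule landau_o.big.trans)
qed

lemma poly_growth_at_cusps:
  assumes A: "A \<in> SL2Z"
  shows "\<exists>m::nat. (\<lambda>\<tau>. norm (poly p (t (moebius A \<tau>)))) \<in> O[im_top](\<lambda>\<tau>. exp (2 * pi * real m * Im \<tau>))"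
proof (induction p)
  case 0
  show ?case by (intro exI[of _ 0]) simp
next
  case (pCons a p)
  then obtain m where m: "(\<lambda>\<tau>. norm (poly p (t (moebius A \<tau>)))) \<in> O[im_top](\<lambda>\<tau>. exp (2 * pi * real m * Im \<tau>))" by blast
  have "(\<lambda>\<tau>. norm (t (moebius A \<tau>)) * norm (poly p (t (moebius A \<tau>)))) \<in>
      O[im_top](\<lambda>\<tau>. exp (2 * pi * Im \<tau>) * exp (2 * pi * real m * Im \<tau>))"
    by (intro landau_o.big_mult growth_at_cusps A m)
  also have "(\<lambda>\<tau>. exp (2 * pi * Im \<tau>) * exp (2 * pi * real m * Im \<tau>)) = (\<lambda>\<tau>. exp (2 * pi * real (Suc m) * Im \<tau>))"
    by (simp add: algebra_simps flip: exp_add)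
  finally have "(\<lambda>\<tau>. norm (t (moebius A \<tau>) * poly p (t (moebius A \<tau>)))) \<in> O[im_top](\<lambda>\<tau>. exp (2 * pi * real (Suc m) * Im \<tau>))"
    by (simp add: norm_mult)
  moreover have "(\<lambda>\<tau>. norm a) \<in> O[im_top](\<lambda>\<tau>. exp (2 * pi * real (Suc m) * Im \<tau>))"
  proof (rule landau_o.big.trans)
    show "(\<lambda>\<tau>. norm a) \<in> O[im_top](\<lambda>_. 1)" by simp
    show "(\<lambda>_. 1) \<in> O[im_top](\<lambda>\<tau>. exp (2 * pi * real (Suc m) * Im \<tau>))"
      using exp_growth_mono[of 0 "2 * pi * real (Suc m)"] by simp
  qed
  ultimately have "(\<lambda>\<tau>. norm (poly (pCons a p) (t (moebius A \<tau>)))) \<in> O[im_top](\<lambda>\<tau>. exp (2 * pi * real (Suc m) * Im \<tau>))"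
    unfolding poly_pCons by (intro bigo_norm_add)
  thus ?case by blast
qed

text \<open>
  If \<open>p(t)\<close> vanished at points accumulating at \<open>z\<close>, it would vanish identically, and \<open>t\<close> would take its
  values among the finitely many roots; but \<open>t\<close> is unbounded.
\<close>

lemma poly_nonzero:
  assumes p: "p \<noteq> 0" and z: "Im z > 0"
  shows "eventually (\<lambda>w. poly p (t w) \<noteq> 0) (at z)"
proof (rule ccontr)
  assume "\<not> ?thesis"
  hence fr: "frequently (\<lambda>w. poly p (t w) = 0) (at z)" by (simp add: frequently_def)
  have "(\<lambda>w. poly p (t w)) holomorphic_on {\<tau>. Im \<tau> > 0}" by (intro holomorphic_intros holomorphic)
  hence "(\<lambda>w. poly p (t w)) nicely_meromorphic_on {\<tau>. Im \<tau> > 0}"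
    by (intro analytic_on_imp_nicely_meromorphic_on) (simp add: analytic_on_open open_uhp)
  from frequently_eq_meromorphic_imp_constant[OF fr this open_uhp connected_uhp] z
  have zero: "poly p (t w) = 0" if "Im w > 0" for w using that by auto
  have fin: "finite {x. poly p x = 0}" by (rule poly_roots_finite[OF p])
  hence "bounded {x. poly p x = 0}" by (rule finite_imp_bounded)
  then obtain M where M: "\<And>x. poly p x = 0 \<Longrightarrow> norm x \<le> M" by (auto simp: bounded_iff)
  obtain c where c: "c > 0" "eventually (\<lambda>\<tau>. norm (norm (t \<tau>)) \<ge> c * norm (exp (2 * pi * Im \<tau>))) im_top"
    using bigthetaD2[OF simple_pole_at_infinity] by (elim landau_omega.bigE)
  from c(2) eventually_im_top_pos[of 0] eventually_im_top_pos[of "M / c"]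
  have "eventually (\<lambda>\<tau>. False) im_top"
  proof eventually_elim
    case (elim \<tau>)
    have "c * exp (2 * pi * Im \<tau>) \<le> M" using elim(1) M[OF zero[OF elim(2)]] by simp
    moreover have "exp (2 * pi * Im \<tau>) \<ge> 1 + 2 * pi * Im \<tau>" by (rule exp_ge_add_one_self)
    moreover have "1 * Im \<tau> \<le> 2 * pi * Im \<tau>" using pi_gt3 elim by (intro mult_right_mono) auto
    ultimately have "c * Im \<tau> \<le> M" using c(1) by (smt (verit) mult_left_mono)
    moreover have "M < c * Im \<tau>" using elim(3) c(1) by (simp add: field_simps)
    ultimately show False by simp
  qed
  thus False by simp
qed

text \<open>
  The difference \<open>t - t(z)\<close> vanishes at \<open>z\<close>, so a power of it as high as the order of the pole suffices.
\<close>

lemma clear_pole_local: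
  assumes f: "f meromorphic_on {z}" and z: "Im z > 0"
  shows "\<exists>p. p \<noteq> 0 \<and> (\<lambda>w. f w * poly p (t w)) \<in> O[at z](\<lambda>_. 1)"
proof -
  obtain n where n: "(\<lambda>w. f w * (w - z) ^ n) \<in> O[at z](\<lambda>_. 1)" by (rule meromorphic_clear_pole[OF f])
  have "t field_differentiable at z"
    using z by (intro holomorphic_on_imp_differentiable_at[OF holomorphic open_uhp]) auto
  hence "(\<lambda>w. t w - t z) \<in> O[at z](\<lambda>w. w - z)" by (rule taylor_bigo_linear)
  hence "(\<lambda>w. f w * (t w - t z) ^ n) \<in> O[at z](\<lambda>w. f w * (w - z) ^ n)"
    by (intro landau_o.big.mult_left landau_o.big_power)
  from landau_o.big.trans[OF this n] have "(\<lambda>w. f w * poly ([:- t z, 1:] ^ n) (t w)) \<in> O[at z](\<lambda>_. 1)"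
    by (simp add: poly_power)
  moreover have "[:- t z, 1:] ^ n \<noteq> 0" by simp
  ultimately show ?thesis by blast
qed

lemma poly_locally_bounded:
  assumes "Im z > 0"
  shows "(\<lambda>w. poly p (t w)) \<in> O[at z](\<lambda>_. 1)"
proof -
  have "isCont t z" by (rule isCont_halfplane[OF holomorphic assms])
  hence "isCont (\<lambda>w. poly p (t w)) z" by (intro continuous_intros)
  thus ?thesis by (intro bigoI_tendsto[where c = "poly p (t z)"]) (auto simp: isCont_def)
qed

text \<open>
  A polynomial that clears the pole at one point keeps working in a neighbourhood, and multiplying it by
  further polynomials does not destroy local boundedness; so a finite subcover gives a common one.
\<close>

lemma clear_poles_compact:
  assumes f: "f meromorphic_on {\<tau>. Im \<tau> > 0}" and K: "compact K" "K \<subseteq> {\<tau>. Im \<tau> > 0}"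
  shows "\<exists>p. p \<noteq> 0 \<and> (\<forall>z\<in>K. (\<lambda>w. f w * poly p (t w)) \<in> O[at z](\<lambda>_. 1))"
proof -
  have "\<exists>p U. p \<noteq> 0 \<and> open U \<and> z \<in> U \<and> (\<forall>w\<in>U. (\<lambda>w. f w * poly p (t w)) \<in> O[at w](\<lambda>_. 1))" if z: "z \<in> K" for z
  proof -
    have "Im z > 0" using z K(2) by auto
    have "f meromorphic_on {z}" by (rule meromorphic_on_subset[OF f]) (use \<open>Im z > 0\<close> in auto)
    from clear_pole_local[OF this \<open>Im z > 0\<close>] obtain p
      where p: "p \<noteq> 0" "(\<lambda>w. f w * poly p (t w)) \<in> O[at z](\<lambda>_. 1)" by (elim exE conjE)
    obtain U where "open U" "z \<in> U" "\<And>w. w \<in> U \<Longrightarrow> (\<lambda>w. f w * poly p (t w)) \<in> O[at w](\<lambda>_. 1)"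
      using locally_bounded_nearby[OF p(2)] by metis
    with p(1) show ?thesis by blast
  qed
  then obtain p U where pU: "\<And>z. z \<in> K \<Longrightarrow> p z \<noteq> 0" "\<And>z. z \<in> K \<Longrightarrow> open (U z)" "\<And>z. z \<in> K \<Longrightarrow> z \<in> U z"
     "\<And>z w. z \<in> K \<Longrightarrow> w \<in> U z \<Longrightarrow> (\<lambda>w. f w * poly (p z) (t w)) \<in> O[at w](\<lambda>_. 1)"
    by metis
  have "K \<subseteq> (\<Union>z\<in>K. U z)" using pU(3) by auto
  then obtain C where C: "C \<subseteq> K" "finite C" "K \<subseteq> (\<Union>z\<in>C. U z)"
    using compactE_image[OF K(1), of K U] pU(2) by auto
  define P where "P = (\<Prod>z\<in>C. p z)"
  have "P \<noteq> 0" unfolding P_def using C pU(1) by (auto simp: prod_zero_iff)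
  moreover have "(\<lambda>x. f x * poly P (t x)) \<in> O[at w](\<lambda>_. 1)" if w: "w \<in> K" for w
  proof -
    obtain z where z: "z \<in> C" "w \<in> U z" using C w by auto
    have "(\<lambda>x. f x * poly (p z) (t x) * poly (\<Prod>z\<in>C - {z}. p z) (t x)) \<in> O[at w](\<lambda>_. 1)"
      using z C K w by (intro landau_o.big.mult_in_1 pU(4)[of z] poly_locally_bounded) auto
    moreover have "P = p z * (\<Prod>z\<in>C - {z}. p z)" unfolding P_def by (rule prod.remove[OF C(2) z(1)])
    ultimately show ?thesis by (simp add: mult.assoc)
  qed
  ultimately show ?thesis by blast
qed

text \<open>
  At such a cusp \<open>t\<close> has a finite limit \<open>L\<close>, and \<open>t - L\<close> decays like \<open>q\<^bsup>1/N\<^esup>\<close>, which beats any exponential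
  growth of \<open>f\<close> when raised to a high power.
\<close>

lemma clear_pole_at_cusp:
  assumes exp: "has_q_expansion (f \<circ> moebius A)" and A: "A \<in> SL2Z" "\<not> int N dvd a21 A"
  shows "\<exists>p. p \<noteq> 0 \<and> (\<lambda>\<tau>. norm (f (moebius A \<tau>) * poly p (t (moebius A \<tau>)))) \<in> O[im_top](\<lambda>_. 1)"
proof -
  obtain n where "(\<lambda>\<tau>. norm ((f \<circ> moebius A) \<tau>)) \<in> O[im_top](\<lambda>\<tau>. exp (2 * pi * real n * Im \<tau>))"
    by (rule has_q_expansionD[OF exp])
  hence n: "(\<lambda>\<tau>. norm (f (moebius A \<tau>))) \<in> O[im_top](\<lambda>\<tau>. exp (2 * pi * real n * Im \<tau>))" by simp
  define s where "s = (\<lambda>\<tau>. t (moebius A \<tau>))"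
  have hols: "s holomorphic_on {\<tau>. Im \<tau> > 0}" unfolding s_def by (rule holomorphic_compose_moebius[OF holomorphic A(1)])
  have pers: "s (\<tau> + of_nat N) = s \<tau>" if "Im \<tau> > 0" for \<tau>
    unfolding s_def by (rule Gamma0_invariant_conjugate_periodic[OF invariant A(1) that])
  have growth: "(\<lambda>\<tau>. norm (s \<tau>)) \<in> O[im_top](\<lambda>\<tau>. exp (2 * pi * real 0 / real N * Im \<tau>))"
    using bounded_at_cusps[OF A] by (simp add: s_def)
  obtain L where L: "((\<lambda>\<tau>. s \<tau> * qpow (1 / of_nat N) \<tau> ^ 0) \<longlongrightarrow> L) im_top"
    by (rule growth_limit[OF N_pos hols pers growth])
  have lim: "((\<lambda>\<tau>. (s \<tau> - L) * qpow (1 / of_nat N) \<tau> ^ 0) \<longlongrightarrow> 0) im_top"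
    using tendsto_diff[OF L tendsto_const[of L]] by simp
  have growth': "(\<lambda>\<tau>. norm (s \<tau> - L)) \<in> O[im_top](\<lambda>\<tau>. exp (2 * pi * real 0 / real N * Im \<tau>))"
    by (intro bigoI_tendsto[where c = 0]) (use tendsto_norm[OF lim] in auto)
  have "(\<lambda>\<tau>. norm (s \<tau> - L)) \<in> O[im_top](\<lambda>\<tau>. exp (2 * pi * (real 0 - 1) / real N * Im \<tau>))"
    by (rule growth_improve[OF N_pos _ _ growth' lim, where Y = 0]) (auto intro!: holomorphic_intros hols simp: pers)
  hence "(\<lambda>\<tau>. norm (f (moebius A \<tau>)) * norm (s \<tau> - L) ^ (n * N)) \<in> 
      O[im_top](\<lambda>\<tau>. exp (2 * pi * real n * Im \<tau>) * exp (2 * pi * (real 0 - 1) / real N * Im \<tau>) ^ (n * N))"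
    by (intro landau_o.big_mult n landau_o.big_power)
  also have "(\<lambda>\<tau>. exp (2 * pi * real n * Im \<tau>) * exp (2 * pi * (real 0 - 1) / real N * Im \<tau>) ^ (n * N)) = (\<lambda>\<tau>. 1)"
    using N_pos by (simp add: fun_eq_iff flip: exp_of_nat_mult exp_add)
  finally have "(\<lambda>\<tau>. norm (f (moebius A \<tau>) * poly ([:- L, 1:] ^ (n * N)) (t (moebius A \<tau>)))) \<in> O[im_top](\<lambda>_. 1)"
    by (simp add: s_def norm_mult norm_power poly_power)
  moreover have "[:- L, 1:] ^ (n * N) \<noteq> 0" by simp
  ultimately show ?thesis by blast
qed

end

section \<open>Modular functions as rational functions\<close>

lemma uhp_eq: "upper_half_plane = {\<tau>. Im \<tau> > 0}"
  by (simp add: upper_half_plane_def)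

lemma modular_functions_iff:
  "f \<in> modular_functions N \<longleftrightarrow> f nicely_meromorphic_on {\<tau>. Im \<tau> > 0} \<and>
     (\<forall>A\<in>Gamma0 N. \<forall>\<tau>. Im \<tau> > 0 \<longrightarrow> f (moebius A \<tau>) = f \<tau>) \<and>
     (\<forall>A\<in>SL2Z. has_q_expansion (f \<circ> moebius A))"
  by (auto simp: modular_functions_def uhp_eq meromorphic_at_cusps_iff)

lemma rational_functions_in_iff:
  "f \<in> rational_functions_in g \<longleftrightarrow> f nicely_meromorphic_on {\<tau>. Im \<tau> > 0} \<and>
     (\<exists>p q. \<forall>z. Im z > 0 \<longrightarrow> eventually (\<lambda>w. poly q (g w) \<noteq> 0 \<and> f w = poly p (g w) / poly q (g w)) (at z))"
  by (simp add: rational_functions_in_def uhp_eq eventually_cosparse_open_eq open_uhp)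

lemma tendsto_if_continuous_moebius:
  assumes f: "f nicely_meromorphic_on {\<tau>. Im \<tau> > 0}" and A: "A \<in> SL2Z" and \<tau>: "Im \<tau> > 0"
    and cont: "isCont (f \<circ> moebius A) \<tau>"
  shows "f \<midarrow>moebius A \<tau>\<rightarrow> f (moebius A \<tau>)"
proof -
  have "\<not> is_pole f (moebius A \<tau>)"
  proof
    assume "is_pole f (moebius A \<tau>)"
    hence "filterlim (\<lambda>w. f (moebius A w)) at_infinity (at \<tau>)"
      using filterlim_compose[OF _ filterlim_moebius_at[OF A \<tau>]] unfolding is_pole_def by blast
    moreover have "(\<lambda>w. f (moebius A w)) \<midarrow>\<tau>\<rightarrow> f (moebius A \<tau>)" using cont by (simp add: isCont_def o_def)
    ultimately show False using not_tendsto_and_filterlim_at_infinity[OF at_neq_bot] by blast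
  qed
  thus ?thesis using f Im_moebius_pos[OF A \<tau>] by (auto simp: nicely_meromorphic_on_def)
qed

lemma eventually_tendsto_at_cusp:
  assumes f: "f nicely_meromorphic_on {\<tau>. Im \<tau> > 0}" and A: "A \<in> SL2Z"
    and exp: "has_q_expansion (f \<circ> moebius A)"
  shows "eventually (\<lambda>\<tau>. f \<midarrow>moebius A \<tau>\<rightarrow> f (moebius A \<tau>)) im_top"
proof -
  obtain Y where Y: "Y > 0" "(f \<circ> moebius A) holomorphic_on {\<tau>. Im \<tau> > Y}" by (rule has_q_expansionD[OF exp])
  show ?thesis
  proof (rule eventually_im_topI[OF Y(1)])
    fix \<tau> assume \<tau>: "Im \<tau> > Y"
    have "isCont (f \<circ> moebius A) \<tau>" by (rule isCont_halfplane[OF Y(2) \<tau>])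
    thus "f \<midarrow>moebius A \<tau>\<rightarrow> f (moebius A \<tau>)" using Y(1) \<tau> by (intro tendsto_if_continuous_moebius f A) auto
  qed
qed

context hauptmodul
begin

lemma poly_bounded_at_cusps:
  assumes A: "A \<in> SL2Z" "\<not> int N dvd a21 A"
  shows "(\<lambda>\<tau>. norm (poly p (t (moebius A \<tau>)))) \<in> O[im_top](\<lambda>_. 1)"
proof (induction p)
  case (pCons a p)
  have "(\<lambda>\<tau>. norm (t (moebius A \<tau>)) * norm (poly p (t (moebius A \<tau>)))) \<in> O[im_top](\<lambda>_. 1)"
    by (intro landau_o.big.mult_in_1 bounded_at_cusps A pCons.IH)
  thus ?case unfolding poly_pCons by (intro bigo_norm_add) (simp_all add: norm_mult)
qed auto

text \<open>
  Coset representatives \<open>B\<close> reduce all points to \<open>moebius B \<tau>\<close> with \<open>\<tau>\<close> in the strip of \<open>exists_in_strip\<close>.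
  For large \<open>Im \<tau>\<close> there are no poles, and the rest of the strip is compact. The cusps are treated one
  representative at a time.
\<close>

lemma clear_poles:
  assumes f: "f \<in> modular_functions N"
  shows "\<exists>p. p \<noteq> 0 \<and> (\<forall>z. Im z > 0 \<longrightarrow> (\<lambda>w. f w * poly p (t w)) \<in> O[at z](\<lambda>_. 1)) \<and>
           (\<forall>A\<in>SL2Z. \<not> int N dvd a21 A \<longrightarrow>
              (\<lambda>\<tau>. norm (f (moebius A \<tau>) * poly p (t (moebius A \<tau>)))) \<in> O[im_top](\<lambda>_. 1))"
proof -
  have nice: "f nicely_meromorphic_on {\<tau>. Im \<tau> > 0}"
    and inv: "\<And>A \<tau>. A \<in> Gamma0 N \<Longrightarrow> Im \<tau> > 0 \<Longrightarrow> f (moebius A \<tau>) = f \<tau>"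
    and exp: "\<And>A. A \<in> SL2Z \<Longrightarrow> has_q_expansion (f \<circ> moebius A)"
    using f by (auto simp: modular_functions_iff)
  have mero: "f meromorphic_on {\<tau>. Im \<tau> > 0}" using nice by (simp add: nicely_meromorphic_on_def)
  obtain R where R: "finite R" "R \<subseteq> SL2Z" "\<And>A. A \<in> SL2Z \<Longrightarrow> \<exists>\<alpha>\<in>Gamma0 N. \<exists>B\<in>R. A = \<alpha> ** B"
    using Gamma0_finite_cosets[OF N_pos] by metis
  have "eventually (\<lambda>\<tau>. \<forall>B\<in>R. f \<midarrow>moebius B \<tau>\<rightarrow> f (moebius B \<tau>)) im_top"
    using R(1,2) by (intro eventually_ball_finite ballI eventually_tendsto_at_cusp nice exp) auto
  then obtain Y where Y: "\<And>B \<tau>. Im \<tau> > Y \<Longrightarrow> B \<in> R \<Longrightarrow> f \<midarrow>moebius B \<tau>\<rightarrow> f (moebius B \<tau>)"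
    unfolding eventually_im_top by blast
  define K0 where "K0 = cbox (Complex (-1/2) (1/2)) (Complex (1/2) Y)"
  have K0: "z \<in> K0 \<longleftrightarrow> \<bar>Re z\<bar> \<le> 1/2 \<and> 1/2 \<le> Im z \<and> Im z \<le> Y" for z
    by (auto simp: K0_def in_cbox_complex_iff)
  define K where "K = (\<Union>B\<in>R. moebius B ` K0)"
  have "compact K" unfolding K_def
  proof (intro compact_UN R(1) compact_continuous_image)
    fix B assume B: "B \<in> R"
    have "K0 \<subseteq> {\<tau>. Im \<tau> > 0}" using K0 by auto
    thus "continuous_on K0 (moebius B)"
      using B R(2) by (intro holomorphic_on_imp_continuous_on holomorphic_on_subset[OF holomorphic_moebius]) auto
  qed (simp add: K0_def compact_cbox)
  moreover have "K \<subseteq> {\<tau>. Im \<tau> > 0}" using R(2) K0 by (auto simp: K_def intro!: Im_moebius_pos)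
  ultimately obtain p1 where p1: "p1 \<noteq> 0" "\<And>z. z \<in> K \<Longrightarrow> (\<lambda>w. f w * poly p1 (t w)) \<in> O[at z](\<lambda>_. 1)"
    using clear_poles_compact[OF mero] by metis
  have "\<exists>p. p \<noteq> 0 \<and> (\<not> int N dvd a21 B \<longrightarrow> 
          (\<lambda>\<tau>. norm (f (moebius B \<tau>) * poly p (t (moebius B \<tau>)))) \<in> O[im_top](\<lambda>_. 1))" if "B \<in> R" for B
  proof (cases "int N dvd a21 B")
    case True
    thus ?thesis by (intro exI[of _ 1]) auto
  next
    case False
    thus ?thesis using clear_pole_at_cusp[OF exp, of B] that R(2) by auto
  qed
  then obtain pc where pc: "\<And>B. B \<in> R \<Longrightarrow> pc B \<noteq> 0" "\<And>B. B \<in> R \<Longrightarrow> \<not> int N dvd a21 B \<Longrightarrow>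
          (\<lambda>\<tau>. norm (f (moebius B \<tau>) * poly (pc B) (t (moebius B \<tau>)))) \<in> O[im_top](\<lambda>_. 1)"
    by metis
  \<comment> \<open>The factor \<open>p1\<close> takes care of the half-plane and \<open>pc B\<close> of the cusp \<open>B \<infinity>\<close>.\<close>
  define p where "p = p1 * (\<Prod>B\<in>R. pc B)"
  define F where "F = (\<lambda>w. f w * poly p (t w))"
  have Finv: "F (moebius A \<tau>) = F \<tau>" if "A \<in> Gamma0 N" "Im \<tau> > 0" for A \<tau>
    using inv[OF that] invariant[OF that] by (simp add: F_def)
  have "p \<noteq> 0" using p1(1) pc(1) R(1) by (auto simp: p_def prod_zero_iff)
  moreover have "F \<in> O[at z](\<lambda>_. 1)" if z: "Im z > 0" for z
  proof -
    obtain A where A: "A \<in> SL2Z" "\<bar>Re (moebius A z)\<bar> \<le> 1/2" "Im (moebius A z) \<ge> 1/2"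
      using exists_in_strip[OF z] by blast
    define \<tau> where "\<tau> = moebius A z"
    have \<tau>: "Im \<tau> > 0" unfolding \<tau>_def by (rule Im_moebius_pos[OF A(1) z])
    obtain \<alpha> B where \<alpha>: "\<alpha> \<in> Gamma0 N" "B \<in> R" "adjugate2 A = \<alpha> ** B" using R(3)[OF adjugate2_SL2Z[OF A(1)]] by blast
    have SL: "\<alpha> \<in> SL2Z" "B \<in> SL2Z" using \<alpha> R(2) Gamma0_SL2Z by auto
    define w where "w = moebius B \<tau>"
    have w: "Im w > 0" unfolding w_def by (rule Im_moebius_pos[OF SL(2) \<tau>])
    have "moebius (adjugate2 A) \<tau> = z"
      unfolding \<tau>_def using moebius_mult[OF adjugate2_SL2Z[OF A(1)] A(1) z] by (simp add: adjugate2_inverse[OF A(1)])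
    hence zw: "z = moebius \<alpha> w" unfolding \<alpha>(3) w_def using moebius_mult[OF SL \<tau>] by simp
    have Fw: "F \<in> O[at w](\<lambda>_. 1)"
    proof (cases "Im \<tau> > Y")
      case True
      hence "f \<in> O[at w](\<lambda>_. 1)" using Y[OF True \<alpha>(2)] unfolding w_def by (intro bigoI_tendsto[where c = "f (moebius B \<tau>)"]) auto
      thus ?thesis unfolding F_def by (intro landau_o.big.mult_in_1 poly_locally_bounded w)
    next
      case False
      hence "\<tau> \<in> K0" using A by (simp add: K0 \<tau>_def)
      hence "w \<in> K" using \<alpha>(2) by (auto simp: K_def w_def)
      hence "(\<lambda>x. f x * poly p1 (t x) * poly (\<Prod>B\<in>R. pc B) (t x)) \<in> O[at w](\<lambda>_. 1)"
        by (intro landau_o.big.mult_in_1 p1 poly_locally_bounded w)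
      thus ?thesis by (simp add: F_def p_def mult.assoc)
    qed
    define \<beta> where "\<beta> = adjugate2 \<alpha>"
    have \<beta>: "\<beta> \<in> SL2Z" "\<beta> \<in> Gamma0 N" using \<alpha>(1) SL by (auto simp: \<beta>_def Gamma0_iff adjugate2_SL2Z)
    have \<beta>z: "moebius \<beta> z = w"
      unfolding zw \<beta>_def using moebius_mult[OF adjugate2_SL2Z[OF SL(1)] SL(1) w] by (simp add: adjugate2_inverse[OF SL(1)])
    have "(\<lambda>x. F (moebius \<beta> x)) \<in> O[at z](\<lambda>_. 1)"
      by (rule landau_o.big.compose[OF Fw]) (use filterlim_moebius_at[OF \<beta>(1) z] \<beta>z in simp)
    moreover have "eventually (\<lambda>x. F (moebius \<beta> x) = F x) (at z)"
    proof -
      have "eventually (\<lambda>x. Im x > 0) (at z)" by (rule eventually_at_halfplane[OF z])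
      thus ?thesis by eventually_elim (use Finv[OF \<beta>(2)] in simp)
    qed
    ultimately show ?thesis by (rule landau_o.big.in_cong[THEN iffD1, rotated])
  qed
  moreover have "(\<lambda>\<tau>. norm (F (moebius A \<tau>))) \<in> O[im_top](\<lambda>_. 1)" if A: "A \<in> SL2Z" "\<not> int N dvd a21 A" for A
  proof -
    obtain \<alpha> B where \<alpha>: "\<alpha> \<in> Gamma0 N" "B \<in> R" "A = \<alpha> ** B" using R(3)[OF A(1)] by blast
    have SL: "\<alpha> \<in> SL2Z" "B \<in> SL2Z" using \<alpha> R(2) Gamma0_SL2Z by auto
    have B: "\<not> int N dvd a21 B" using A(2) \<alpha>(1) by (auto simp: \<alpha>(3) Gamma0_iff)
    have p: "p = pc B * (p1 * (\<Prod>B\<in>R - {B}. pc B))"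
      unfolding p_def by (subst prod.remove[OF R(1) \<alpha>(2)]) (simp add: mult_ac)
    have "(\<lambda>\<tau>. norm (f (moebius B \<tau>) * poly (pc B) (t (moebius B \<tau>))) * norm (poly (p1 * (\<Prod>B\<in>R - {B}. pc B)) (t (moebius B \<tau>)))) \<in> O[im_top](\<lambda>_. 1)"
      by (intro landau_o.big.mult_in_1 pc(2) \<alpha>(2) B poly_bounded_at_cusps SL(2))
    hence "(\<lambda>\<tau>. norm (F (moebius B \<tau>))) \<in> O[im_top](\<lambda>_. 1)"
      by (simp add: F_def p norm_mult mult.assoc)
    moreover have "eventually (\<lambda>\<tau>. norm (F (moebius A \<tau>)) = norm (F (moebius B \<tau>))) im_top"
      using eventually_im_top_pos[of 0]
      by eventually_elim (simp add: \<alpha>(3) moebius_mult SL Finv[OF \<alpha>(1)] Im_moebius_pos)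
    ultimately show ?thesis by (rule landau_o.big.in_cong[THEN iffD2, rotated])
  qed
  ultimately show ?thesis unfolding F_def by blast
qed

text \<open>
  After the poles are cleared, the removable singularities of \<open>f q(t)\<close> are filled in, and what results is a
  polynomial in \<open>t\<close>.
\<close>

lemma modular_imp_rational:
  assumes f: "f \<in> modular_functions N"
  shows "f \<in> rational_functions_in t"
proof -
  have nice: "f nicely_meromorphic_on {\<tau>. Im \<tau> > 0}"
    and inv: "\<And>A \<tau>. A \<in> Gamma0 N \<Longrightarrow> Im \<tau> > 0 \<Longrightarrow> f (moebius A \<tau>) = f \<tau>"
    and exp: "\<And>A. A \<in> SL2Z \<Longrightarrow> has_q_expansion (f \<circ> moebius A)"
    using f by (auto simp: modular_functions_iff)
  have mero: "f meromorphic_on {\<tau>. Im \<tau> > 0}" using nice by (simp add: nicely_meromorphic_on_def)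
  obtain q where q: "q \<noteq> 0" "\<And>z. Im z > 0 \<Longrightarrow> (\<lambda>w. f w * poly q (t w)) \<in> O[at z](\<lambda>_. 1)"
    "\<And>A. A \<in> SL2Z \<Longrightarrow> \<not> int N dvd a21 A \<Longrightarrow>
       (\<lambda>\<tau>. norm (f (moebius A \<tau>) * poly q (t (moebius A \<tau>)))) \<in> O[im_top](\<lambda>_. 1)"
    using clear_poles[OF f] by blast
  define F0 where "F0 = (\<lambda>w. f w * poly q (t w))"
  define F where "F = remove_sings F0"
  have holq: "(\<lambda>w. poly q (t w)) holomorphic_on {\<tau>. Im \<tau> > 0}" by (intro holomorphic_intros holomorphic)
  hence "(\<lambda>w. poly q (t w)) analytic_on {\<tau>. Im \<tau> > 0}" by (simp add: analytic_on_open open_uhp)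
  hence F0_mero: "F0 meromorphic_on {\<tau>. Im \<tau> > 0}" unfolding F0_def by (intro meromorphic_intros mero analytic_on_imp_meromorphic_on)
  have F0_z: "F0 meromorphic_on {z}" if "Im z > 0" for z
    by (rule meromorphic_on_subset[OF F0_mero]) (use that in auto)
  have lim: "\<exists>c. F0 \<midarrow>z\<rightarrow> c" if z: "Im z > 0" for z
  proof -
    have "not_essential F0 z" using F0_z[OF z] by (simp add: meromorphic_at_iff)
    moreover have "\<not> is_pole F0 z"
    proof
      assume "is_pole F0 z"
      hence inf: "filterlim (\<lambda>w. norm (F0 w)) at_top (at z)"
        by (simp add: is_pole_def filterlim_at_infinity_conv_norm_at_top)
      obtain c where c: "eventually (\<lambda>w. norm (F0 w) \<le> c * norm (1::complex)) (at z)"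
        using q(2)[OF z] unfolding F0_def by (elim landau_o.bigE)
      have "eventually (\<lambda>w. norm (F0 w) > c) (at z)" using inf by (simp add: filterlim_at_top_dense)
      with c have "eventually (\<lambda>w. False) (at z)" by eventually_elim simp
      thus False by simp
    qed
    ultimately show ?thesis by (auto simp: not_essential_def)
  qed
  have F_lim: "F0 \<midarrow>z\<rightarrow> F z" if z: "Im z > 0" for z
  proof -
    obtain c where c: "F0 \<midarrow>z\<rightarrow> c" using lim[OF z] by blast
    hence "F z = c" unfolding F_def by (rule remove_sings_eqI)
    with c show ?thesis by simp
  qed
  have F_ev: "eventually (\<lambda>w. F w = F0 w) (at z)" if "Im z > 0" for z
    using F0_z[OF that] unfolding F_def by (intro eventually_remove_sings_eq_at) (simp add: meromorphic_at_iff)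
  have "F analytic_on {z}" if "Im z > 0" for z
    using F0_z[OF that] lim[OF that] unfolding F_def by (auto simp: meromorphic_at_iff intro: remove_sings_analytic_at)
  hence "F analytic_on {\<tau>. Im \<tau> > 0}" using analytic_on_analytic_at by blast
  hence holF: "F holomorphic_on {\<tau>. Im \<tau> > 0}" by (rule analytic_imp_holomorphic)
  have invF: "F (moebius A \<tau>) = F \<tau>" if A: "A \<in> Gamma0 N" and \<tau>: "Im \<tau> > 0" for A \<tau>
  proof -
    have SL: "A \<in> SL2Z" by (rule Gamma0_SL2Z[OF A])
    have "(\<lambda>w. F0 (moebius A w)) \<midarrow>\<tau>\<rightarrow> F (moebius A \<tau>)"
      by (rule filterlim_compose[OF F_lim[OF Im_moebius_pos[OF SL \<tau>]] filterlim_moebius_at[OF SL \<tau>]])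
    moreover have "eventually (\<lambda>w. F0 (moebius A w) = F0 w) (at \<tau>)"
    proof -
      have "eventually (\<lambda>x. Im x > 0) (at \<tau>)" by (rule eventually_at_halfplane[OF \<tau>])
      thus ?thesis by eventually_elim (simp add: F0_def inv[OF A] invariant[OF A])
    qed
    ultimately have "F0 \<midarrow>\<tau>\<rightarrow> F (moebius A \<tau>)" by (rule Lim_transform_eventually)
    thus ?thesis using LIM_unique F_lim[OF \<tau>] by blast
  qed
  have F_cusp: "eventually (\<lambda>\<tau>. norm (F (moebius A \<tau>)) = norm (F0 (moebius A \<tau>))) im_top" if A: "A \<in> SL2Z" for A
    using eventually_tendsto_at_cusp[OF nice A exp[OF A]] eventually_im_top_pos[of 0]
  proof eventually_elim
    case (elim \<tau>)
    have "isCont (\<lambda>w. poly q (t w)) (moebius A \<tau>)"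
      by (rule isCont_halfplane[OF holq Im_moebius_pos[OF A elim(2)]])
    hence "F0 \<midarrow>moebius A \<tau>\<rightarrow> F0 (moebius A \<tau>)"
      unfolding F0_def isCont_def by (intro tendsto_mult elim(1))
    hence "F (moebius A \<tau>) = F0 (moebius A \<tau>)" unfolding F_def by (rule remove_sings_eqI)
    thus ?case by simp
  qed
  have bddF: "(\<lambda>\<tau>. norm (F (moebius A \<tau>))) \<in> O[im_top](\<lambda>_. 1)" if A: "A \<in> SL2Z" "\<not> int N dvd a21 A" for A
    by (subst landau_o.big.in_cong[OF F_cusp[OF A(1)]]) (use q(3)[OF A] in \<open>simp add: F0_def\<close>)
  have one: "mat 1 \<in> SL2Z" by (rule SL2Z_I) simp
  obtain n where "(\<lambda>\<tau>. norm ((f \<circ> moebius (mat 1)) \<tau>)) \<in> O[im_top](\<lambda>\<tau>. exp (2 * pi * real n * Im \<tau>))"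
    by (rule has_q_expansionD[OF exp[OF one]])
  hence n: "(\<lambda>\<tau>. norm (f \<tau>)) \<in> O[im_top](\<lambda>\<tau>. exp (2 * pi * real n * Im \<tau>))" by simp
  obtain m :: nat where m: "(\<lambda>\<tau>. norm (poly q (t \<tau>))) \<in> O[im_top](\<lambda>\<tau>. exp (2 * pi * real m * Im \<tau>))"
    using poly_growth_at_cusps[OF one, of q] by auto
  have growthF: "(\<lambda>\<tau>. norm (F \<tau>)) \<in> O[im_top](\<lambda>\<tau>. exp (2 * pi * real (n + m) * Im \<tau>))"
  proof -
    have "(\<lambda>\<tau>. norm (f \<tau>) * norm (poly q (t \<tau>))) \<in> O[im_top](\<lambda>\<tau>. exp (2 * pi * real n * Im \<tau>) * exp (2 * pi * real m * Im \<tau>))"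
      by (intro landau_o.big_mult n m)
    also have "(\<lambda>\<tau>. exp (2 * pi * real n * Im \<tau>) * exp (2 * pi * real m * Im \<tau>)) = (\<lambda>\<tau>. exp (2 * pi * real (n + m) * Im \<tau>))"
      by (simp add: algebra_simps flip: exp_add)
    finally have "(\<lambda>\<tau>. norm (F0 \<tau>)) \<in> O[im_top](\<lambda>\<tau>. exp (2 * pi * real (n + m) * Im \<tau>))"
      by (simp add: F0_def norm_mult)
    thus ?thesis using landau_o.big.in_cong[OF F_cusp[OF one]] by simp
  qed
  obtain p where p: "\<And>\<tau>. Im \<tau> > 0 \<Longrightarrow> F \<tau> = poly p (t \<tau>)"
    using polynomial_if_holomorphic[OF holF invF bddF growthF] by blast
  have "eventually (\<lambda>w. poly q (t w) \<noteq> 0 \<and> f w = poly p (t w) / poly q (t w)) (at z)" if z: "Im z > 0" for z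
  proof -
    have "eventually (\<lambda>x. Im x > 0) (at z)" by (rule eventually_at_halfplane[OF z])
    with F_ev[OF z] poly_nonzero[OF q(1) z] show ?thesis
    proof eventually_elim
      case (elim w)
      have "f w * poly q (t w) = poly p (t w)" using elim(1,3) p[of w] by (simp add: F0_def)
      thus ?case using elim(2) by (simp add: field_simps)
    qed
  qed
  thus ?thesis using nice unfolding rational_functions_in_iff by blast
qed

text \<open>
  The quotient \<open>p(t)/q(t)\<close> describes \<open>f\<close> only outside isolated points. Invariance at the remaining points
  and the values near the cusps are recovered from limits, because \<open>f\<close> is nicely meromorphic.
\<close>

lemma rational_imp_modular:
  assumes f: "f \<in> rational_functions_in t"
  shows "f \<in> modular_functions N"
proof -
  obtain p q where nice: "f nicely_meromorphic_on {\<tau>. Im \<tau> > 0}"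
    and pq: "\<And>z. Im z > 0 \<Longrightarrow> eventually (\<lambda>w. poly q (t w) \<noteq> 0 \<and> f w = poly p (t w) / poly q (t w)) (at z)"
    using f unfolding rational_functions_in_iff by blast
  have inv: "f (moebius A \<tau>) = f \<tau>" if A: "A \<in> Gamma0 N" and \<tau>: "Im \<tau> > 0" for A \<tau>
  proof -
    have SL: "A \<in> SL2Z" by (rule Gamma0_SL2Z[OF A])
    have "eventually (\<lambda>w. f (moebius A w) = poly p (t (moebius A w)) / poly q (t (moebius A w))) (at \<tau>)"
      using filterlim_moebius_at[OF SL \<tau>] pq[OF Im_moebius_pos[OF SL \<tau>]] unfolding filterlim_iff by (auto elim: eventually_mono)
    moreover have "eventually (\<lambda>x. Im x > 0) (at \<tau>)" by (rule eventually_at_halfplane[OF \<tau>])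
    ultimately have "eventually (\<lambda>w. f (moebius A w) = f w) (at \<tau>)"
      using pq[OF \<tau>] by eventually_elim (simp add: invariant[OF A])
    thus ?thesis by (rule nicely_meromorphic_invariantI[OF nice SL \<tau>])
  qed
  have exp: "has_q_expansion (f \<circ> moebius A)" if A: "A \<in> SL2Z" for A
  proof -
    define s where "s = (\<lambda>\<tau>. t (moebius A \<tau>))"
    have hols: "s holomorphic_on {\<tau>. Im \<tau> > 0}" unfolding s_def by (rule holomorphic_compose_moebius[OF holomorphic A])
    have pers: "s (\<tau> + of_nat N) = s \<tau>" if "Im \<tau> > 0" for \<tau>
      unfolding s_def by (rule Gamma0_invariant_conjugate_periodic[OF invariant A that])
    obtain m1 :: nat where m1: "(\<lambda>\<tau>. norm (poly q (s \<tau>))) \<in> O[im_top](\<lambda>\<tau>. exp (2 * pi * real m1 * Im \<tau>))"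
      using poly_growth_at_cusps[OF A, of q] unfolding s_def by blast
    have growthq: "(\<lambda>\<tau>. norm (poly q (s \<tau>))) \<in> O[im_top](\<lambda>\<tau>. exp (2 * pi * real (m1 * N) / real N * Im \<tau>))"
      using m1 N_pos by (simp add: mult.assoc)
    have "\<not> eventually (\<lambda>\<tau>. poly q (s \<tau>) = 0) im_top"
    proof
      assume "eventually (\<lambda>\<tau>. poly q (s \<tau>) = 0) im_top"
      then obtain Y where Y: "Y > 0" "\<And>\<tau>. Im \<tau> > Y \<Longrightarrow> poly q (s \<tau>) = 0" by (auto simp: eventually_im_top)
      define \<tau> where "\<tau> = Complex 0 (Y + 1)"
      have \<tau>: "Im \<tau> > 0" "Im \<tau> > Y" using Y(1) by (simp_all add: \<tau>_def)
      have "eventually (\<lambda>w. poly q (t (moebius A w)) \<noteq> 0) (at \<tau>)"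
        using filterlim_moebius_at[OF A \<tau>(1)] pq[OF Im_moebius_pos[OF A \<tau>(1)]] unfolding filterlim_iff by (auto elim: eventually_mono)
      moreover have "eventually (\<lambda>w. Im w > Y) (at \<tau>)" by (rule eventually_at_halfplane[OF \<tau>(2)])
      ultimately have "eventually (\<lambda>w. False) (at \<tau>)" by eventually_elim (use Y(2) in \<open>simp add: s_def\<close>)
      thus False by simp
    qed
    then obtain k where k: "eventually (\<lambda>\<tau>. poly q (s \<tau>) \<noteq> 0) im_top"
      "(\<lambda>\<tau>. norm (1 / poly q (s \<tau>))) \<in> O[im_top](\<lambda>\<tau>. exp (2 * pi * real k / real N * Im \<tau>))"
      using growth_reciprocal[OF N_pos _ _ growthq, of 0] pers by (auto intro!: holomorphic_intros hols)
    from k(1) obtain Y where Y: "Y > 0" "\<And>\<tau>. Im \<tau> > Y \<Longrightarrow> poly q (s \<tau>) \<noteq> 0" by (auto simp: eventually_im_top)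
    have eq: "f (moebius A \<tau>) = poly p (s \<tau>) / poly q (s \<tau>)" if \<tau>: "Im \<tau> > Y" for \<tau>
    proof (rule nicely_meromorphic_eqI[OF nice])
      have pos: "Im (moebius A \<tau>) > 0" using Im_moebius_pos[OF A, of \<tau>] \<tau> Y(1) by simp
      thus "moebius A \<tau> \<in> {\<tau>. Im \<tau> > 0}" by simp
      have "isCont t (moebius A \<tau>)" by (rule isCont_halfplane[OF holomorphic pos])
      hence "isCont (\<lambda>w. poly p (t w) / poly q (t w)) (moebius A \<tau>)"
        using Y(2)[OF \<tau>] by (intro continuous_intros) (auto simp: s_def)
      hence lim: "(\<lambda>w. poly p (t w) / poly q (t w)) \<midarrow>moebius A \<tau>\<rightarrow> poly p (s \<tau>) / poly q (s \<tau>)" by (simp add: isCont_def s_def)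
      show "f \<midarrow>moebius A \<tau>\<rightarrow> poly p (s \<tau>) / poly q (s \<tau>)"
        by (rule Lim_transform_eventually[OF lim]) (use pq[OF pos] in \<open>auto elim: eventually_mono\<close>)
    qed
    obtain m2 :: nat where m2: "(\<lambda>\<tau>. norm (poly p (s \<tau>))) \<in> O[im_top](\<lambda>\<tau>. exp (2 * pi * real m2 * Im \<tau>))"
      using poly_growth_at_cusps[OF A, of p] unfolding s_def by blast
    show ?thesis
    proof (rule has_q_expansionI[OF N_pos, where Y = Y and n = "m2 * N + k"])
      have "s holomorphic_on {\<tau>. Im \<tau> > Y}" by (rule holomorphic_on_subset[OF hols]) (use Y in auto)
      hence "(\<lambda>\<tau>. poly p (s \<tau>) / poly q (s \<tau>)) holomorphic_on {\<tau>. Im \<tau> > Y}" by (intro holomorphic_intros) (use Y in auto)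
      thus "(f \<circ> moebius A) holomorphic_on {\<tau>. Im \<tau> > Y}"
        by (rule holomorphic_transform) (simp add: eq)
      show "(f \<circ> moebius A) (\<tau> + of_nat N) = (f \<circ> moebius A) \<tau>" if "Im \<tau> > Y" for \<tau>
        using that Y(1) Gamma0_invariant_conjugate_periodic[OF inv A] by simp
      have "(\<lambda>\<tau>. norm (poly p (s \<tau>)) * norm (1 / poly q (s \<tau>))) \<in>
          O[im_top](\<lambda>\<tau>. exp (2 * pi * real m2 * Im \<tau>) * exp (2 * pi * real k / real N * Im \<tau>))"
        by (intro landau_o.big_mult m2 k)
      also have "(\<lambda>\<tau>. exp (2 * pi * real m2 * Im \<tau>) * exp (2 * pi * real k / real N * Im \<tau>)) =
            (\<lambda>\<tau>. exp (2 * pi * real (m2 * N + k) / real N * Im \<tau>))"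
        using N_pos by (simp add: fun_eq_iff field_simps flip: exp_add)
      finally have "(\<lambda>\<tau>. norm (poly p (s \<tau>) / poly q (s \<tau>))) \<in> O[im_top](\<lambda>\<tau>. exp (2 * pi * real (m2 * N + k) / real N * Im \<tau>))"
        by (simp add: norm_divide)
      moreover have "eventually (\<lambda>\<tau>. norm ((f \<circ> moebius A) \<tau>) = norm (poly p (s \<tau>) / poly q (s \<tau>))) im_top"
        using eventually_im_top_pos[of Y] by eventually_elim (simp add: eq)
      ultimately show "(\<lambda>\<tau>. norm ((f \<circ> moebius A) \<tau>)) \<in> O[im_top](\<lambda>\<tau>. exp (2 * pi * real (m2 * N + k) / real N * Im \<tau>))"
        by (rule landau_o.big.in_cong[THEN iffD2, rotated])
    qed
  qed
  show ?thesis unfolding modular_functions_iff using nice inv exp by blast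
qed

theorem modular_functions_eq: "modular_functions N = rational_functions_in t"
  using modular_imp_rational rational_imp_modular by blast

end

section \<open>The generators u and w\<close>

text \<open>
  Reversing the coefficients of a polynomial turns \<open>p(1/x)\<close> into \<open>p(x)\<close> up to a power of \<open>x\<close>; the extra
  factors of \<open>x\<close> make the powers in numerator and denominator equal.
\<close>

lemma rational_functions_in_reciprocal_subset:
  assumes "\<And>\<tau>. Im \<tau> > 0 \<Longrightarrow> g \<tau> * h \<tau> = 1"
  shows "rational_functions_in g \<subseteq> rational_functions_in h"
proof
  fix f assume "f \<in> rational_functions_in g"
  then obtain p q where nice: "f nicely_meromorphic_on {\<tau>. Im \<tau> > 0}"
    and pq: "\<And>z. Im z > 0 \<Longrightarrow> eventually (\<lambda>w. poly q (g w) \<noteq> 0 \<and> f w = poly p (g w) / poly q (g w)) (at z)"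
    unfolding rational_functions_in_iff by blast
  define p' q' where "p' = reflect_poly p * monom 1 (degree q)" and "q' = reflect_poly q * monom 1 (degree p)"
  have "eventually (\<lambda>w. poly q' (h w) \<noteq> 0 \<and> f w = poly p' (h w) / poly q' (h w)) (at z)" if z: "Im z > 0" for z
  proof -
    have "eventually (\<lambda>x. Im x > 0) (at z)" by (rule eventually_at_halfplane[OF z])
    with pq[OF z] show ?thesis
    proof eventually_elim
      case (elim w)
      have gh: "g w * h w = 1" using assms elim(2) by simp
      hence nz: "h w \<noteq> 0" by auto
      have g: "inverse (h w) = g w" using gh nz by (simp add: field_simps)
      have "poly p' (h w) = h w ^ (degree p + degree q) * poly p (g w)"
        "poly q' (h w) = h w ^ (degree p + degree q) * poly q (g w)"
        using nz by (simp_all add: p'_def q'_def poly_monom poly_reflect_poly_nz g power_add)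
      thus ?case using elim(1) nz by simp
    qed
  qed
  thus "f \<in> rational_functions_in h" using nice unfolding rational_functions_in_iff by blast
qed

lemma rational_functions_in_reciprocal:
  assumes "\<And>\<tau>. Im \<tau> > 0 \<Longrightarrow> g \<tau> * h \<tau> = 1"
  shows "rational_functions_in g = rational_functions_in h"
proof (rule equalityI)
  show "rational_functions_in g \<subseteq> rational_functions_in h"
    by (rule rational_functions_in_reciprocal_subset) (rule assms)
  show "rational_functions_in h \<subseteq> rational_functions_in g"
    by (rule rational_functions_in_reciprocal_subset) (use assms in \<open>simp add: mult.commute\<close>)
qed

lemma hauptmodul_inverse_w: "hauptmodul 18 (\<lambda>\<tau>. 1 / w_fun \<tau>)"
proof
  show "(\<lambda>\<tau>. 1 / w_fun \<tau>) holomorphic_on {\<tau>. Im \<tau> > 0}"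
    by (intro holomorphic_intros holomorphic_w_fun) (auto simp: w_fun_nonzero)
qed (use w_u_invariant(1) inverse_w_bounded_at_cusp inverse_w_at_infinity in auto)

text \<open>
  The conditions are inherited from \<open>1/w\<close>, which differs from \<open>1/u\<close> by a constant.
\<close>

lemma hauptmodul_inverse_u: "hauptmodul 18 (\<lambda>\<tau>. 1 / u_fun \<tau>)"
proof
  show "(\<lambda>\<tau>. 1 / u_fun \<tau>) holomorphic_on {\<tau>. Im \<tau> > 0}"
    by (intro holomorphic_intros holomorphic_u_fun) (auto simp: u_fun_nonzero)
  show "1 / u_fun (moebius A \<tau>) = 1 / u_fun \<tau>" if "A \<in> Gamma0 18" "Im \<tau> > 0" for A \<tau>
    using w_u_invariant(2)[OF that] by simp
  show "(\<lambda>\<tau>. norm (1 / u_fun (moebius A \<tau>))) \<in> O[im_top](\<lambda>_. 1)" if A: "A \<in> SL2Z" "\<not> int 18 dvd a21 A" for A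
  proof -
    have "(\<lambda>\<tau>. norm (1 / w_fun (moebius A \<tau>) - 1)) \<in> O[im_top](\<lambda>_. 1)"
      using A by (intro bigo_norm_diff inverse_w_bounded_at_cusp) auto
    moreover have "eventually (\<lambda>\<tau>. norm (1 / u_fun (moebius A \<tau>)) = norm (1 / w_fun (moebius A \<tau>) - 1)) im_top"
      using eventually_im_top_pos[of 0] by eventually_elim (simp only: inverse_u_w[OF Im_moebius_pos[OF A(1)]])
    ultimately show ?thesis by (rule landau_o.big.in_cong[THEN iffD2, rotated])
  qed
  show "(\<lambda>\<tau>. norm (1 / u_fun \<tau>)) \<in> \<Theta>[im_top](\<lambda>\<tau>. exp (2 * pi * Im \<tau>))"
  proof -
    have "filterlim (\<lambda>y. exp (2 * pi * y)) at_top at_top" by real_asymp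
    from filterlim_compose[OF this filterlim_Im_im_top]
    have exp: "filterlim (\<lambda>\<tau>. exp (2 * pi * Im \<tau>)) at_top im_top" .
    obtain c where c: "c > 0" "eventually (\<lambda>\<tau>. norm (norm (1 / w_fun \<tau>)) \<ge> c * norm (exp (2 * pi * Im \<tau>))) im_top"
      using bigthetaD2[OF inverse_w_at_infinity] by (elim landau_omega.bigE)
    obtain C where C: "C > 0" "eventually (\<lambda>\<tau>. norm (norm (1 / w_fun \<tau>)) \<le> C * norm (exp (2 * pi * Im \<tau>))) im_top"
      using bigthetaD1[OF inverse_w_at_infinity] by (elim landau_o.bigE)
    have big: "eventually (\<lambda>\<tau>. exp (2 * pi * Im \<tau>) \<ge> max 1 (2 / c)) im_top"
      using exp unfolding filterlim_at_top by blast
    have "eventually (\<lambda>\<tau>. c / 2 * norm (exp (2 * pi * Im \<tau>)) \<le> norm (norm (1 / u_fun \<tau>)) \<and>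
            norm (norm (1 / u_fun \<tau>)) \<le> (C + 1) * norm (exp (2 * pi * Im \<tau>))) im_top"
      using c(2) C(2) big eventually_im_top_pos[of 0]
    proof eventually_elim
      case (elim \<tau>)
      have u: "1 / u_fun \<tau> = 1 / w_fun \<tau> - 1" by (rule inverse_u_w[OF elim(4)])
      have "norm (1 / u_fun \<tau>) \<le> norm (1 / w_fun \<tau>) + 1" unfolding u using norm_triangle_ineq4[of "1 / w_fun \<tau>" 1] by simp
      moreover have "norm (1 / w_fun \<tau>) - 1 \<le> norm (1 / u_fun \<tau>)" unfolding u using norm_triangle_ineq2[of "1 / w_fun \<tau>" 1] by simp
      moreover have "c / 2 * exp (2 * pi * Im \<tau>) \<ge> 1" using elim(3) c(1) by (simp add: field_simps)
      moreover have "exp (2 * pi * Im \<tau>) \<ge> 1" using elim(3) by linarith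
      moreover have "c * exp (2 * pi * Im \<tau>) \<le> norm (1 / w_fun \<tau>)" "norm (1 / w_fun \<tau>) \<le> C * exp (2 * pi * Im \<tau>)"
        using elim(1,2) by simp_all
      moreover have "(C + 1) * exp (2 * pi * Im \<tau>) = C * exp (2 * pi * Im \<tau>) + exp (2 * pi * Im \<tau>)"
        by (simp add: algebra_simps)
      ultimately have "c / 2 * exp (2 * pi * Im \<tau>) \<le> norm (1 / u_fun \<tau>) \<and> norm (1 / u_fun \<tau>) \<le> (C + 1) * exp (2 * pi * Im \<tau>)"
        by linarith
      thus ?case by simp
    qed
    thus ?thesis using c(1) C(1) by (intro bigthetaI'[of "c / 2" "C + 1"]) auto
  qed
qed simp

theorem theorem1p2:
  shows "modular_functions 18 = rational_functions_in u_fun \<and>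
         modular_functions 18 = rational_functions_in w_fun"
  using hauptmodul.modular_functions_eq[OF hauptmodul_inverse_u] hauptmodul.modular_functions_eq[OF hauptmodul_inverse_w]
    rational_functions_in_reciprocal[of "\<lambda>\<tau>. 1 / u_fun \<tau>" u_fun] rational_functions_in_reciprocal[of "\<lambda>\<tau>. 1 / w_fun \<tau>" w_fun]
  by (simp add: u_fun_nonzero w_fun_nonzero)

end
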